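(* Let $U$ be a finite set of numbers in $(0,1)$, let $U=U_1\cup U_2\cup U_3$ be its natural partition, and let $m_i=|U_i|$, $i=1,2,3$, $r=|U|=m_1+m_2+m_3$. Then $H_U$ is isomorphic to a semidirect product $$H_U\cong [F,F]^{r+1}\rtimes \mathbb{Z}^{2m_1+m_2+2}.$$ Moreover (since $[F,F]$ is simple), the rank of the first integral homology group of $H_U$ is $2m_1+m_2+2$.
   Context: $F$ (R. Thompson's group) is the group of all piecewise-linear increasing self-homeomorphisms of $[0,1]$ with finitely many break points of the derivative, all lying in $\mathbb{Z}[\frac12]$, and with all slopes powers of $2$. $[F,F]$ is its derived subgroup. For a finite set $U\subset(0,1)$, $H_U=\{f\in F: f(x)=x \text{ for all } x\in U\}$. The natural partition of $U$ is $U=U_1\cup U_2\cup U_3$ where $U_1=U\cap\mathbb{Z}[\frac12]$, $U_2$ is the set of rational numbers in $U$ not in $\mathbb{Z}[\frac12]$, and $U_3$ is the set of irrational numbers in $U$. *)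

theory Defs
  imports
    "HOL-Analysis.Analysis"
    "HOL-Algebra.Algebra"
    "HOL-Library.Extended_Nat"
begin

section \<open>Thompson's group F\<close>

text \<open>The ring \<open>\<int>[1/2]\<close> as a set of reals (the library's \<^const>\<open>dyadics\<close> contains only
  its nonnegative elements).\<close>

definition dyadic_rationals :: "real set" where
  "dyadic_rationals = {of_int a / 2 ^ k | (a :: int) (k :: nat). True}"

text \<open>\<open>B\<close> is a subdivision of \<open>[0,1]\<close> containing all break points of \<open>f\<close>; the condition is
  imposed on each pair \<open>a < b\<close> of consecutive elements of \<open>B\<close>.\<close>

definition dyadic_piecewise_linear :: "(real \<Rightarrow> real) \<Rightarrow> bool" where
  "dyadic_piecewise_linear f \<longleftrightarrow>
     (\<exists>B. finite B \<and> {0, 1} \<subseteq> B \<and> B \<subseteq> {0..1} \<inter> dyadic_rationals \<and>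
        (\<forall>a\<in>B. \<forall>b\<in>B. a < b \<and> {a<..<b} \<inter> B = {} \<longrightarrow>
           (\<exists>(k :: int) (c :: real). \<forall>x\<in>{a..b}. f x = 2 powi k * x + c)))"

text \<open>As in \<^const>\<open>BijGroup\<close>, self-maps of \<open>[0,1]\<close> are represented by functions that are
  \<^const>\<open>undefined\<close> outside \<open>[0,1]\<close>, and the product is composition.\<close>

definition thompson_F :: "(real \<Rightarrow> real) monoid" where
  "thompson_F = BijGroup {0..1} \<lparr>carrier :=
     {f \<in> extensional {0..1}. (\<exists>g. homeomorphism {0..1} {0..1} f g) \<and>
        strict_mono_on {0..1} f \<and> dyadic_piecewise_linear f}\<rparr>"

definition derived_F :: "(real \<Rightarrow> real) monoid" where
  "derived_F = thompson_F \<lparr>carrier := derived thompson_F (carrier thompson_F)\<rparr>"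

definition fixing_subgroup :: "real set \<Rightarrow> (real \<Rightarrow> real) monoid" where
  "fixing_subgroup U = thompson_F \<lparr>carrier := {f \<in> carrier thompson_F. \<forall>x\<in>U. f x = x}\<rparr>"

section \<open>Group-theoretic notions\<close>

definition group_power :: "('a, 'b) monoid_scheme \<Rightarrow> nat \<Rightarrow> (nat \<Rightarrow> 'a) monoid" where
  "group_power G n = product_group {..<n} (\<lambda>_. G)"

definition semidirect_product ::
    "('a, 'c) monoid_scheme \<Rightarrow> ('b, 'd) monoid_scheme \<Rightarrow> ('b \<Rightarrow> 'a \<Rightarrow> 'a) \<Rightarrow> ('a \<times> 'b) monoid" where
  "semidirect_product N Q \<phi> =
     \<lparr>carrier = carrier N \<times> carrier Q,
      mult = (\<lambda>(n, q) (n', q'). (n \<otimes>\<^bsub>N\<^esub> \<phi> q n', q \<otimes>\<^bsub>Q\<^esub> q')),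
      one = (\<one>\<^bsub>N\<^esub>, \<one>\<^bsub>Q\<^esub>)\<rparr>"

definition is_semidirect_product ::
    "('e, 'f) monoid_scheme \<Rightarrow> ('a, 'c) monoid_scheme \<Rightarrow> ('b, 'd) monoid_scheme \<Rightarrow> bool" where
  "is_semidirect_product G N Q \<longleftrightarrow>
     (\<exists>\<phi> \<in> hom Q (AutoGroup N). G \<cong> semidirect_product N Q \<phi>)"

section \<open>Integral group homology\<close>

text \<open>The homology with trivial integer coefficients is that of the (inhomogeneous) bar complex:
  the group of \<open>n\<close>-chains is free abelian on \<open>n\<close>-tuples (lists) of group elements, with
  \<open>\<partial>[g\<^sub>1|\<dots>|g\<^sub>n] = [g\<^sub>2|\<dots>|g\<^sub>n] + (\<Sum>0<i<n. (-1)\<^sup>i [g\<^sub>1|\<dots>|g\<^sub>ig\<^sub>i\<^sub>+\<^sub>1|\<dots>|g\<^sub>n]) + (-1)\<^sup>n [g\<^sub>1|\<dots>|g\<^sub>n\<^sub>-\<^sub>1]\<close>.\<close>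

definition bar_chains :: "('a, 'b) monoid_scheme \<Rightarrow> nat \<Rightarrow> ('a list \<Rightarrow>\<^sub>0 int) monoid" where
  "bar_chains G n = free_Abelian_group {gs. length gs = n \<and> set gs \<subseteq> carrier G}"

text \<open>List positions count from 0, so the summand for \<open>i\<close> multiplies \<open>gs ! (i - 1)\<close> and \<open>gs ! i\<close>.\<close>

definition bar_boundary_basis :: "('a, 'b) monoid_scheme \<Rightarrow> 'a list \<Rightarrow> ('a list \<Rightarrow>\<^sub>0 int)" where
  "bar_boundary_basis G gs =
     (if gs = [] then 0
      else frag_of (tl gs)
         + (\<Sum>i = 1..<length gs. frag_cmul ((- 1) ^ i)
              (frag_of (take (i - 1) gs @ [gs ! (i - 1) \<otimes>\<^bsub>G\<^esub> gs ! i] @ drop (i + 1) gs)))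
         + frag_cmul ((- 1) ^ length gs) (frag_of (butlast gs)))"

definition bar_boundary ::
    "('a, 'b) monoid_scheme \<Rightarrow> ('a list \<Rightarrow>\<^sub>0 int) \<Rightarrow> ('a list \<Rightarrow>\<^sub>0 int)" where
  "bar_boundary G = frag_extend (bar_boundary_basis G)"

definition integral_homology ::
    "nat \<Rightarrow> ('a, 'b) monoid_scheme \<Rightarrow> ('a list \<Rightarrow>\<^sub>0 int) set monoid" where
  "integral_homology n G =
     (bar_chains G n) \<lparr>carrier := {c \<in> carrier (bar_chains G n). bar_boundary G c = 0}\<rparr>
       Mod (bar_boundary G ` carrier (bar_chains G (Suc n)))"

section \<open>Rank of an abelian group\<close>

definition int_independent :: "('a, 'b) monoid_scheme \<Rightarrow> 'a set \<Rightarrow> bool" where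
  "int_independent A S \<longleftrightarrow> finite S \<and> S \<subseteq> carrier A \<and>
     (\<forall>c :: 'a \<Rightarrow> int. (\<Otimes>\<^bsub>A\<^esub>s\<in>S. s [^]\<^bsub>A\<^esub> c s) = \<one>\<^bsub>A\<^esub> \<longrightarrow> (\<forall>s\<in>S. c s = 0))"

definition abelian_rank :: "('a, 'b) monoid_scheme \<Rightarrow> enat" where
  "abelian_rank A = (SUP S\<in>{S. int_independent A S}. enat (card S))"

end

theory Submission
  imports Defs
begin

text \<open>
  An element of Thompson's group is extended by the identity to a homeomorphism of the real line.
  All groups involved then become subgroups of the group \<open>PL2\<close> of increasing homeomorphisms of the
  line that are dyadic piecewise linear, with break points that may accumulate only at infinity.
  Membership in \<open>PL2\<close> is a condition on the germ at each point, so it is preserved by composition,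
  by inversion, by cutting and pasting at dyadic points, and even by changes of variable with
  infinitely many break points.

  Let \<open>V = U \<union> {0, 1}\<close> and let \<open>f\<close> fix \<open>V\<close> pointwise. The logarithms of the one-sided slopes of
  \<open>f\<close> at points of \<open>V\<close> are homomorphisms to the integers. At a dyadic point the two sides are
  independent; at any other point the two slopes agree, because break points are dyadic. If the
  slope at the fixed point \<open>x\<close> is \<open>2\<^sup>k\<close>, then \<open>(1 - 2\<^sup>k) x\<close> is dyadic. For irrational \<open>x\<close> this
  forces \<open>k = 0\<close>, and for rational \<open>x\<close> the possible \<open>k\<close> are the multiples of a positive number,
  the period of \<open>x\<close>. Since only the right slope at 0 and the left slope at 1 can be nontrivial, this
  gives a homomorphism onto a free abelian group of rank \<open>2 m\<^sub>1 + m\<^sub>2 + 2\<close>. It splits: bumps with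
  disjoint supports realise its generators and commute (\<open>sections_exist\<close>).

  The kernel consists of the elements that are the identity near each point of \<open>V\<close>. It is the direct
  product, over the \<open>r + 1\<close> gaps \<open>(a, b)\<close> of \<open>V\<close>, of the groups of elements with compact support in
  \<open>(a, b)\<close> (\<open>kernel_H_is_power\<close>). Two facts identify these factors with \<open>[F,F]\<close>.

  First, they are all isomorphic to the group of compactly supported elements of \<open>PL2\<close>, even if \<open>a\<close>
  and \<open>b\<close> are not dyadic: there is a dyadic piecewise linear homeomorphism from the line to \<open>(a, b)\<close>
  whose infinitely many break points accumulate only at the ends (\<open>dyadic_chart\<close>), and conjugation
  with it preserves compactly supported elements (\<open>compact_support_iso_PLc\<close>).

  Second, the compactly supported group is perfect (\<open>PLc_perfect\<close>). Modulo its commutator subgroup,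
  an element is unchanged by conjugation with any element of \<open>PL2\<close>, in particular by rescaling. The
  standard generator \<open>x0\<close> of \<open>F\<close> satisfies the pentagon relation \<open>x0\<^sup>2 = x\<^sub>r x0 x\<^sub>l\<close>, where \<open>x\<^sub>l\<close> and
  \<open>x\<^sub>r\<close> are its copies on the two halves of the unit interval; hence \<open>x0\<^sup>2 = x0\<^sup>3\<close> modulo commutators,
  and \<open>x0\<close> is trivial there. Rescaled copies of \<open>x0\<close> suffice to move any dyadic point \<open>f(1/2)\<close> back to
  \<open>1/2\<close> without breaking the standard dyadic intervals on either side of it. Thus \<open>f\<close>
  reduces to two elements supported on the halves, and an induction on the fineness of a mesh kills
  \<open>f\<close>. Since commutators in \<open>F\<close> have slope 1
  at 0 and at 1, it follows that \<open>[F,F]\<close> is the group of compactly supported elements on \<open>(0, 1)\<close>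
  (\<open>derived_PLu\<close>).

  In degree one the bar complex has no condition on cycles, and its boundaries impose the relations
  \<open>[g] + [h] = [gh]\<close>. So the first homology is the abelianisation. As the kernel of the slope
  homomorphism is perfect, the abelianisation is free of rank \<open>2 m\<^sub>1 + m\<^sub>2 + 2\<close>
  (\<open>rank_first_homology\<close>).
\<close>

section \<open>Dyadic rationals\<close>

abbreviation Dyadics :: "real set" ("\<D>") where "\<D> \<equiv> dyadic_rationals"

lemma dyadic_iff: "x \<in> \<D> \<longleftrightarrow> (\<exists>k::nat. x * 2 ^ k \<in> \<int>)"
proof
  assume "x \<in> \<D>"
  then obtain a k where "x = of_int a / 2 ^ k" by (auto simp: dyadic_rationals_def)
  then have "x * 2 ^ k = of_int a" by simp
  then show "\<exists>k::nat. x * 2 ^ k \<in> \<int>" by (metis Ints_of_int)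
next
  assume "\<exists>k::nat. x * 2 ^ k \<in> \<int>"
  then obtain k a where "x * 2 ^ k = of_int a" by (metis Ints_cases)
  then have "x = of_int a / 2 ^ k" by (simp add: field_simps)
  then show "x \<in> \<D>" by (auto simp: dyadic_rationals_def)
qed

lemma dyadic_scale_large:
  assumes "x * 2 ^ k \<in> \<int>" "k \<le> n"
  shows "(x::real) * 2 ^ n \<in> \<int>"
proof -
  have "x * 2 ^ n = x * 2 ^ k * 2 ^ (n - k)"
    using assms(2) by (simp add: mult.assoc flip: power_add)
  then show ?thesis using assms(1) by (metis Ints_mult Ints_numeral Ints_power)
qed

lemma dyadic_eventually_Ints: "x \<in> \<D> \<Longrightarrow> \<exists>K. \<forall>k\<ge>K. x * 2 ^ k \<in> \<int>"
  by (meson dyadic_iff dyadic_scale_large)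

lemma dyadic_Ints: "x \<in> \<int> \<Longrightarrow> x \<in> \<D>"
  unfolding dyadic_iff by (rule exI[of _ 0]) simp

lemma dyadic_add [intro]: assumes "x \<in> \<D>" "y \<in> \<D>" shows "x + y \<in> \<D>"
proof -
  obtain j k where "x * 2 ^ j \<in> \<int>" "y * 2 ^ k \<in> \<int>" using assms by (auto simp: dyadic_iff)
  then have "x * 2 ^ (max j k) \<in> \<int>" "y * 2 ^ (max j k) \<in> \<int>"
    by (auto intro: dyadic_scale_large)
  then show ?thesis unfolding dyadic_iff by (metis Ints_add distrib_right)
qed

lemma dyadic_mult [intro]: assumes "x \<in> \<D>" "y \<in> \<D>" shows "x * y \<in> \<D>"
proof -
  obtain j k where "x * 2 ^ j \<in> \<int>" "y * 2 ^ k \<in> \<int>" using assms by (auto simp: dyadic_iff)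
  then have "(x * 2 ^ j) * (y * 2 ^ k) \<in> \<int>" by (rule Ints_mult)
  then have "x * y * 2 ^ (j + k) \<in> \<int>" by (simp add: power_add mult_ac)
  then show ?thesis unfolding dyadic_iff by blast
qed

lemma dyadic_simps [simp]: "0 \<in> \<D>" "1 \<in> \<D>" "numeral n \<in> \<D>" "real m \<in> \<D>" "of_int i \<in> \<D>"
  by (auto intro: dyadic_Ints)

lemma dyadic_uminus [simp]: "- x \<in> \<D> \<longleftrightarrow> x \<in> \<D>"
  by (simp add: dyadic_iff)

lemma dyadic_diff [intro]: "x \<in> \<D> \<Longrightarrow> y \<in> \<D> \<Longrightarrow> x - y \<in> \<D>"
  using dyadic_add[of x "- y"] by simp

lemma dyadic_divide_power [intro]: assumes "x \<in> \<D>" shows "x / 2 ^ k \<in> \<D>"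
proof -
  have "(1 / 2 ^ k) * 2 ^ k \<in> (\<int> :: real set)" by simp
  then have "1 / 2 ^ k \<in> \<D>" unfolding dyadic_iff by blast
  then show ?thesis using dyadic_mult[OF assms] by fastforce
qed

lemma dyadic_powi [simp]: "2 powi k \<in> \<D>"
proof (cases "k \<ge> 0")
  case True
  then have "(2::real) powi k = 2 ^ nat k" by (simp add: power_int_def)
  then show ?thesis by (auto intro!: dyadic_Ints)
next
  case False
  then have "(2::real) powi k = 1 / 2 ^ nat (- k)" by (simp add: power_int_def field_simps)
  then show ?thesis by (auto intro: dyadic_divide_power)
qed

lemma dyadic_powi_mult_iff [simp]: "2 powi k * x \<in> \<D> \<longleftrightarrow> x \<in> \<D>"
proof
  assume "2 powi k * x \<in> \<D>"
  then have "2 powi (- k) * (2 powi k * x) \<in> \<D>" by (rule dyadic_mult[OF dyadic_powi])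
  moreover have "2 powi (- k) * (2 powi k * x) = x" by (simp add: power_int_minus)
  ultimately show "x \<in> \<D>" by simp
qed auto

lemma dyadic_dense: assumes "(x::real) < y" obtains q where "q \<in> \<D>" "x < q" "q < y"
proof -
  obtain n where n: "1 / (y - x) < 2 ^ n" using real_arch_pow[of 2 "1 / (y - x)"] by auto
  have pos: "y - x > 0" using assms by simp
  have n': "1 / 2 ^ n < y - x"
    using n pos by (simp add: field_simps)
  let ?q = "of_int (\<lfloor>x * 2 ^ n\<rfloor> + 1) / 2 ^ n :: real"
  have "x < ?q" by (simp add: field_simps) linarith
  moreover have "of_int (\<lfloor>x * 2 ^ n\<rfloor> + 1) \<le> x * 2 ^ n + 1" by linarith
  then have "?q \<le> x + 1 / 2 ^ n" by (simp add: field_simps)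
  ultimately show thesis using that[of ?q] n' by (force intro!: dyadic_divide_power)
qed

lemma dyadic_less: obtains q where "q \<in> \<D>" "q < x"
  using dyadic_dense[of "x - 1" x] by auto

lemma dyadic_greater: obtains q where "q \<in> \<D>" "x < q"
  using dyadic_dense[of x "x + 1"] by auto

lemma dyadic_Rats: "x \<in> \<D> \<Longrightarrow> x \<in> \<rat>"
  by (auto simp: dyadic_rationals_def)

section \<open>Dyadic piecewise linear homeomorphisms of the line\<close>

text \<open>The germ of \<open>f\<close> at \<open>x\<close> has slope \<open>2 powi l\<close> on the left and \<open>2 powi k\<close> on the right. Both
  half-lines start at the value \<open>f x\<close>, so continuity at \<open>x\<close> is part of the condition.\<close>

definition has_slopes :: "(real \<Rightarrow> real) \<Rightarrow> real \<Rightarrow> int \<Rightarrow> int \<Rightarrow> bool" where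
  "has_slopes f x l k \<longleftrightarrow>
     (\<forall>\<^sub>F y in nhds x. f y = f x + 2 powi (if y < x then l else k) * (y - x))"

text \<open>The intercept \<open>f x - 2 powi k * x\<close> of the right-hand piece is dyadic, and the slopes may differ
  only at dyadic points. The intercept of the left-hand piece is then dyadic as well: at a dyadic
  point either condition says that \<open>f x\<close> is dyadic, and elsewhere the two pieces coincide.\<close>

definition dpl_at :: "(real \<Rightarrow> real) \<Rightarrow> real \<Rightarrow> bool" where
  "dpl_at f x \<longleftrightarrow> (\<exists>k l. has_slopes f x l k \<and> f x - 2 powi k * x \<in> \<D> \<and> (x \<notin> \<D> \<longrightarrow> k = l))"

lemma dpl_atE:
  assumes "dpl_at f x"
  obtains k l where "has_slopes f x l k" "f x - 2 powi k * x \<in> \<D>" "x \<notin> \<D> \<Longrightarrow> k = l"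
  using assms unfolding dpl_at_def by blast

lemma dpl_atI:
  assumes "has_slopes f x l k" "f x - 2 powi k * x \<in> \<D>" "x \<notin> \<D> \<Longrightarrow> k = l"
  shows "dpl_at f x"
  using assms unfolding dpl_at_def by blast

definition PL2 :: "(real \<Rightarrow> real) set" where
  "PL2 = {f. strict_mono f \<and> surj f \<and> (\<forall>x. dpl_at f x)}"

definition PL2_group :: "(real \<Rightarrow> real) monoid" where
  "PL2_group = \<lparr>carrier = PL2, mult = (\<circ>), one = id\<rparr>"

lemma has_slopes_isCont: assumes "has_slopes f x l k" shows "isCont f x"
proof -
  let ?C = "2 powi k + 2 powi l :: real"
  have "\<forall>\<^sub>F y in nhds x. dist (f y) (f x) \<le> ?C * dist y x"
    using assms unfolding has_slopes_def
  proof eventually_elim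
    case (elim y)
    have "2 powi (if y < x then l else k) \<le> ?C" by auto
    then show ?case unfolding elim dist_real_def
      by (simp add: abs_mult mult_right_mono)
  qed
  then have ev2: "\<forall>\<^sub>F y in at x. dist (f y) (f x) \<le> ?C * dist y x"
    by (rule eventually_nhds_conv_at[THEN iffD1, THEN conjunct1])
  have "((\<lambda>y. ?C * dist y x) \<longlongrightarrow> ?C * dist x x) (at x)"
    by (intro tendsto_intros)
  then have lim: "((\<lambda>y. ?C * dist y x) \<longlongrightarrow> 0) (at x)" by simp
  show ?thesis unfolding isCont_def tendsto_dist_iff[of f]
    by (rule tendsto_sandwich[OF _ ev2 tendsto_const lim]) simp
qed

lemma dpl_at_isCont: "dpl_at f x \<Longrightarrow> isCont f x"
  by (auto simp: dpl_at_def intro: has_slopes_isCont)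

lemma has_slopes_cong:
  assumes "\<forall>\<^sub>F y in nhds x. f y = g y" "has_slopes f x l k" shows "has_slopes g x l k"
proof -
  have x: "f x = g x" using assms(1) by (rule eventually_nhds_x_imp_x)
  show ?thesis using assms unfolding has_slopes_def by eventually_elim (simp add: x)
qed

lemma dpl_at_cong:
  assumes "\<forall>\<^sub>F y in nhds x. f y = g y" "dpl_at f x" shows "dpl_at g x"
proof -
  have "f x = g x" using assms(1) by (rule eventually_nhds_x_imp_x)
  then show ?thesis using assms(2) has_slopes_cong[OF assms(1)] unfolding dpl_at_def by auto
qed

lemma has_slopes_affine: "has_slopes (\<lambda>y. 2 powi k * y + c) x k k"
  unfolding has_slopes_def by (simp add: algebra_simps)

lemma dpl_at_affine: "c \<in> \<D> \<Longrightarrow> dpl_at (\<lambda>y. 2 powi k * y + c) x"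
  by (rule dpl_atI[OF has_slopes_affine]) simp_all

text \<open>An increasing germ respects the two sides of the point, so the left and right slopes multiply
  separately.\<close>

lemma has_slopes_compose:
  assumes g: "has_slopes g x l k" and f: "has_slopes f (g x) l' k'"
  shows "has_slopes (f \<circ> g) x (l + l') (k + k')"
proof -
  have "filterlim g (nhds (g x)) (nhds x)"
    using has_slopes_isCont[OF g] tendsto_at_iff_tendsto_nhds[of g x] by (simp add: isCont_def)
  from eventually_compose_filterlim[OF f[unfolded has_slopes_def] this] g
  show ?thesis unfolding has_slopes_def
  proof eventually_elim
    case (elim y)
    have "g y < g x \<longleftrightarrow> y < x"
      unfolding elim(2) by (simp add: mult_less_0_iff not_less)
    then show ?case using elim by (simp add: power_int_add)
  qed
qed

lemma dpl_at_compose: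
  assumes g: "dpl_at g x" and f: "dpl_at f (g x)"
  shows "dpl_at (f \<circ> g) x"
proof -
  obtain k l where kl: "has_slopes g x l k" "g x - 2 powi k * x \<in> \<D>" "x \<notin> \<D> \<Longrightarrow> k = l"
    using g by (rule dpl_atE) blast
  obtain k' l' where kl': "has_slopes f (g x) l' k'" "f (g x) - 2 powi k' * g x \<in> \<D>"
      "g x \<notin> \<D> \<Longrightarrow> k' = l'"
    using f by (rule dpl_atE) blast
  show ?thesis
  proof (rule dpl_atI[OF has_slopes_compose[OF kl(1) kl'(1)]])
    have "(f (g x) - 2 powi k' * g x) + 2 powi k' * (g x - 2 powi k * x) \<in> \<D>"
      using kl(2) kl'(2) by (intro dyadic_add) simp_all
    then show "(f \<circ> g) x - 2 powi (k + k') * x \<in> \<D>"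
      by (simp add: power_int_add algebra_simps)
    assume x: "x \<notin> \<D>"
    then have "g x \<notin> \<D>"
      using dyadic_diff[OF _ kl(2), of "g x"] by auto
    with x show "k + k' = l + l'" using kl(3) kl'(3) by simp
  qed
qed

lemma has_slopes_glue:
  assumes "has_slopes f p l k" "has_slopes g p l' k'" "f p = g p"
  shows "has_slopes (\<lambda>y. if y < p then f y else g y) p l k'"
  using assms(1,2) unfolding has_slopes_def by eventually_elim (simp add: assms(3))

text \<open>Pasting is possible at dyadic points only: elsewhere it could create a break point that is not
  dyadic.\<close>

lemma dpl_at_glue:
  assumes "dpl_at f p" "dpl_at g p" "f p = g p" "p \<in> \<D>"
  shows "dpl_at (\<lambda>y. if y < p then f y else g y) p"
proof -
  obtain k l where kl: "has_slopes f p l k" using assms(1) by (rule dpl_atE) blast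
  obtain k' l' where kl': "has_slopes g p l' k'" "g p - 2 powi k' * p \<in> \<D>"
    using assms(2) by (rule dpl_atE) blast
  show ?thesis
    by (rule dpl_atI[OF has_slopes_glue[OF kl kl'(1)]]) (use assms kl' in auto)
qed

lemma PL2_D: assumes "f \<in> PL2"
  shows PL2_strict_mono: "strict_mono f" and PL2_surj: "surj f" and PL2_dpl_at: "dpl_at f x"
    and PL2_bij: "bij f" and PL2_inj: "inj f" and PL2_isCont: "isCont f x"
    and PL2_less_iff: "f x < f y \<longleftrightarrow> x < y" and PL2_le_iff: "f x \<le> f y \<longleftrightarrow> x \<le> y"
    and PL2_eq_iff: "f x = f y \<longleftrightarrow> x = y"
  using assms by (auto simp: PL2_def bij_def strict_mono_less strict_mono_less_eq strict_mono_eq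
      strict_mono_imp_inj_on intro: dpl_at_isCont)

lemma PL2_I: "strict_mono f \<Longrightarrow> surj f \<Longrightarrow> (\<And>x. dpl_at f x) \<Longrightarrow> f \<in> PL2"
  by (auto simp: PL2_def)

lemma PL2_affine: assumes "c \<in> \<D>" shows "(\<lambda>y. 2 powi k * y + c) \<in> PL2"
proof -
  have "surj (\<lambda>y. 2 powi k * y + c)"
    by (rule surjI[where f = "\<lambda>y. (y - c) / 2 powi k"]) simp
  then show ?thesis using dpl_at_affine[OF assms] by (intro PL2_I) (simp_all add: strict_mono_def)
qed

lemma PL2_id: "id \<in> PL2"
  using PL2_affine[of 0 0] by (simp add: id_def)

lemma PL2_compose: "f \<in> PL2 \<Longrightarrow> g \<in> PL2 \<Longrightarrow> f \<circ> g \<in> PL2"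
  by (intro PL2_I strict_monoI comp_surj dpl_at_compose) (simp_all add: PL2_D)

text \<open>The map \<open>h\<close> need be a right inverse only near \<open>f x\<close>, since \<open>f\<close> may map the line onto a
  bounded interval; such maps occur below as changes of variable.\<close>

lemma has_slopes_inverse:
  assumes mono: "strict_mono f" and f: "has_slopes f x l k"
    and hf: "\<And>y. h (f y) = y" and fh: "\<forall>\<^sub>F w in nhds (f x). f (h w) = w"
  shows "has_slopes h (f x) (- l) (- k)"
proof -
  obtain e where e: "e > 0" "\<And>y. dist y x < e \<Longrightarrow> f y = f x + 2 powi (if y < x then l else k) * (y - x)"
    using f unfolding has_slopes_def eventually_nhds_metric by blast
  have "f x \<in> {f (x - e)<..<f (x + e)}"
    using e(1) mono by (simp add: strict_mono_less)
  then have "\<forall>\<^sub>F w in nhds (f x). w \<in> {f (x - e)<..<f (x + e)}"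
    by (rule eventually_nhds_in_open[OF open_greaterThanLessThan])
  with fh show ?thesis unfolding has_slopes_def
  proof eventually_elim
    case (elim w)
    define y where "y = h w"
    have w: "w = f y" using elim by (simp add: y_def)
    have "dist y x < e" using elim mono by (auto simp: w strict_mono_less dist_real_def)
    then have "f y = f x + 2 powi (if y < x then l else k) * (y - x)" by (rule e(2))
    then have "w - f x = 2 powi (if y < x then l else k) * (y - x)" by (simp only: w)
    moreover have "w < f x \<longleftrightarrow> y < x" using mono by (simp add: w strict_mono_less)
    ultimately have "2 powi (if w < f x then - l else - k) * (w - f x) = y - x"
      by (simp add: power_int_minus)
    then show ?case by (simp add: hf flip: y_def)
  qed
qed

lemma dpl_at_inverse:
  assumes "strict_mono f" "dpl_at f x" "\<And>y. h (f y) = y" "\<forall>\<^sub>F w in nhds (f x). f (h w) = w"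
  shows "dpl_at h (f x)"
proof -
  obtain k l where kl: "has_slopes f x l k" "f x - 2 powi k * x \<in> \<D>" "x \<notin> \<D> \<Longrightarrow> k = l"
    using assms(2) by (rule dpl_atE) blast
  show ?thesis
  proof (rule dpl_atI[OF has_slopes_inverse[OF assms(1) kl(1) assms(3,4)]])
    have "- (2 powi (- k) * (f x - 2 powi k * x)) \<in> \<D>" using kl(2) by (simp del: minus_mult_right)
    moreover have "- (2 powi (- k) * (f x - 2 powi k * x)) = x - 2 powi (- k) * f x"
      by (simp add: power_int_minus algebra_simps)
    ultimately show "h (f x) - 2 powi (- k) * f x \<in> \<D>" by (simp add: assms(3))
    assume "f x \<notin> \<D>"
    then have "x \<notin> \<D>" using dyadic_add[OF kl(2), of "2 powi k * x"] by auto
    then show "- k = - l" using kl(3) by simp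
  qed
qed

lemma PL2_inverse: assumes "f \<in> PL2" shows "inv_into UNIV f \<in> PL2"
proof -
  let ?h = "inv_into UNIV f"
  note f = PL2_D[OF assms]
  have fh: "f (?h y) = y" for y using f(2) by (simp add: surj_f_inv_f)
  have hf: "?h (f x) = x" for x using f(5) by simp
  have "strict_mono ?h" unfolding strict_mono_def using f(7) fh by metis
  moreover have "surj ?h" using hf by (rule surjI)
  moreover have "dpl_at ?h z" for z
    using dpl_at_inverse[OF f(1) f(3) hf, of "?h z"] by (simp add: fh)
  ultimately show ?thesis by (rule PL2_I)
qed

lemma PL2_group_simps [simp]: "carrier PL2_group = PL2" "mult PL2_group = (\<circ>)" "one PL2_group = id"
  by (simp_all add: PL2_group_def)

lemma PL2_group: "group PL2_group"
proof (rule groupI)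
  fix f assume "f \<in> carrier PL2_group"
  then have f: "f \<in> PL2" by simp
  have "inv_into UNIV f \<circ> f = id" using PL2_inj[OF f] by simp
  then show "\<exists>g\<in>carrier PL2_group. g \<otimes>\<^bsub>PL2_group\<^esub> f = \<one>\<^bsub>PL2_group\<^esub>"
    using PL2_inverse[OF f] by auto
qed (auto simp: PL2_compose PL2_id comp_assoc)

abbreviation PL2_inv :: "(real \<Rightarrow> real) \<Rightarrow> real \<Rightarrow> real" where
  "PL2_inv \<equiv> m_inv PL2_group"

interpretation PL2: group PL2_group by (rule PL2_group)

lemma PL2_inv_eq: "f \<in> PL2 \<Longrightarrow> PL2_inv f = inv_into UNIV f"
  by (rule PL2.inv_equality) (use PL2_inverse PL2_inj in auto)

lemma PL2_inv_inverts:
  assumes "f \<in> PL2"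
  shows "PL2_inv f (f x) = x" "f (PL2_inv f x) = x" "PL2_inv f \<in> PL2"
  using assms PL2_inj[OF assms] PL2_surj[OF assms] PL2.inv_closed[of f]
  by (simp_all add: PL2_inv_eq surj_f_inv_f)

lemma PL2_glue:
  assumes "f \<in> PL2" "g \<in> PL2" "f p = g p" "p \<in> \<D>"
  shows "(\<lambda>y. if y < p then f y else g y) \<in> PL2" (is "?h \<in> _")
proof -
  have "strict_mono ?h"
  proof (rule strict_monoI)
    fix x y :: real assume "x < y"
    then show "?h x < ?h y"
      using PL2_less_iff[OF assms(1), of x y] PL2_less_iff[OF assms(2), of x y]
        PL2_less_iff[OF assms(1), of x p] PL2_le_iff[OF assms(2), of p y] assms(3)
      by auto
  qed
  moreover have "\<exists>x. y = ?h x" for y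
  proof (cases "y < f p")
    case True
    obtain x where "f x = y" using PL2_surj[OF assms(1)] by (metis surjD)
    then show ?thesis using True PL2_less_iff[OF assms(1), of x p] by (intro exI[of _ x]) auto
  next
    case False
    obtain x where "g x = y" using PL2_surj[OF assms(2)] by (metis surjD)
    then show ?thesis using False assms(3) PL2_less_iff[OF assms(2), of x p] by (intro exI[of _ x]) auto
  qed
  then have "surj ?h" unfolding surj_def by blast
  moreover have "dpl_at ?h x" for x
  proof (cases x p rule: linorder_cases)
    case less
    then have "\<forall>\<^sub>F y in nhds x. f y = ?h y"
      using eventually_nhds_in_open[of "{..<p}" x] by (auto elim: eventually_mono)
    then show ?thesis using PL2_dpl_at[OF assms(1)] by (rule dpl_at_cong)
  next
    case equal
    then show ?thesis using dpl_at_glue PL2_dpl_at assms by blast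
  next
    case greater
    then have "\<forall>\<^sub>F y in nhds x. g y = ?h y"
      using eventually_nhds_in_open[of "{p<..}" x] by (auto elim: eventually_mono)
    then show ?thesis using PL2_dpl_at[OF assms(2)] by (rule dpl_at_cong)
  qed
  ultimately show ?thesis by (rule PL2_I)
qed

section \<open>Interpolation\<close>

lemma PL2_translation: "c \<in> \<D> \<Longrightarrow> (\<lambda>x. x + c) \<in> PL2"
  using PL2_affine[of c 0] by simp

lemma PL2_scaling: "(\<lambda>x. 2 powi k * x) \<in> PL2"
  using PL2_affine[of 0 k] by simp

text \<open>Doubling the unit interval \<open>[n, n + 1]\<close> and shifting everything to the right of it moves \<open>n + 1\<close>
  to \<open>n + 2\<close> and fixes \<open>n\<close>. Repetition moves 1 to any positive integer, and a scaling by a power of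
  2 then reaches any positive dyadic number.\<close>

lemma PL2_fixing_0_maps_1:
  assumes "d \<in> \<D>" "d > 0" shows "\<exists>g\<in>PL2. g 0 = 0 \<and> g 1 = d"
proof -
  have nat: "\<exists>g\<in>PL2. g 0 = 0 \<and> g 1 = real (Suc n)" for n
  proof (induction n)
    case 0
    show ?case using PL2_id by (intro bexI[of _ id]) auto
  next
    case (Suc n)
    then obtain g where g: "g \<in> PL2" "g 0 = 0" "g 1 = real (Suc n)" by blast
    let ?a = "\<lambda>x. if x < real (Suc n) then 2 powi 1 * x + (- real n) else x + 1"
    have "?a \<in> PL2"
      by (intro PL2_glue[OF PL2_affine PL2_translation]) auto
    then have "(\<lambda>x. if x < real n then id x else ?a x) \<in> PL2" (is "?b \<in> _")
      by (intro PL2_glue[OF PL2_id]) auto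
    then have "?b \<circ> g \<in> PL2" using g(1) by (rule PL2_compose)
    moreover have "(?b \<circ> g) 0 = 0" "(?b \<circ> g) 1 = real (Suc (Suc n))" using g by auto
    ultimately show ?case by blast
  qed
  obtain k where "d * 2 ^ k \<in> \<int>" using assms(1) by (auto simp: dyadic_iff)
  then obtain i where i: "d * 2 ^ k = of_int i" by (rule Ints_cases)
  have "i > 0" using i assms(2) by (metis of_int_0_less_iff zero_less_mult_iff zero_less_numeral zero_less_power)
  then obtain n where n: "i = int (Suc n)" using gr0_implies_Suc pos_int_cases by metis
  obtain g where g: "g \<in> PL2" "g 0 = 0" "g 1 = real (Suc n)" using nat by blast
  have d: "2 powi (- int k) * real (Suc n) = d" using i by (simp add: n power_int_minus field_simps)
  have "(\<lambda>x. 2 powi (- int k) * x) \<circ> g \<in> PL2" by (intro PL2_compose PL2_scaling g)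
  then show ?thesis using g d by (intro bexI[of _ "(\<lambda>x. 2 powi (- int k) * x) \<circ> g"]) auto
qed

lemma PL2_interpolation:
  assumes "a \<in> \<D>" "b \<in> \<D>" "c \<in> \<D>" "d \<in> \<D>" "a < b" "c < d"
  shows "\<exists>g\<in>PL2. g a = c \<and> g b = d"
proof -
  obtain g where g: "g \<in> PL2" "g 0 = 0" "g 1 = b - a"
    using PL2_fixing_0_maps_1[of "b - a"] assms by auto
  obtain h where h: "h \<in> PL2" "h 0 = 0" "h 1 = d - c"
    using PL2_fixing_0_maps_1[of "d - c"] assms by auto
  let ?f = "(\<lambda>x. x + c) \<circ> (h \<circ> (PL2_inv g \<circ> (\<lambda>x. x + (- a))))"
  have "?f \<in> PL2" using assms PL2_inv_inverts(3)[OF g(1)] h(1)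
    by (intro PL2_compose PL2_translation) auto
  moreover have "?f a = c" "?f b = d"
    using PL2_inv_inverts(1)[OF g(1), of 0] PL2_inv_inverts(1)[OF g(1), of 1] g h by simp_all
  ultimately show ?thesis by blast
qed

text \<open>The graph of \<open>h\<close> over \<open>[p, q]\<close> is joined to the diagonal by interpolation on \<open>[a, p]\<close> and on
  \<open>[q, b]\<close>; all four joints are dyadic.\<close>

lemma PL2_compact_extension:
  assumes h: "h \<in> PL2" and dy: "a \<in> \<D>" "p \<in> \<D>" "q \<in> \<D>" "b \<in> \<D>"
    and "a < p" "p < q" "q < b" "a < h p" "h q < b"
  obtains f where "f \<in> PL2" "\<And>y. y \<in> {p..q} \<Longrightarrow> f y = h y" "\<And>y. y \<notin> {a<..<b} \<Longrightarrow> f y = y"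
proof -
  have hd: "h x \<in> \<D>" if "x \<in> \<D>" for x
  proof -
    obtain k where "h x - 2 powi k * x \<in> \<D>"
      using PL2_dpl_at[OF h, of x] by (rule dpl_atE) blast
    then show ?thesis using dyadic_add[of "h x - 2 powi k * x" "2 powi k * x"] that by simp
  qed
  obtain g1 where g1: "g1 \<in> PL2" "g1 a = a" "g1 p = h p"
    using PL2_interpolation[of a p a "h p"] assms hd by blast
  obtain g2 where g2: "g2 \<in> PL2" "g2 q = h q" "g2 b = b"
    using PL2_interpolation[of q b "h q" b] assms hd by blast
  let ?f1 = "\<lambda>y. if y < b then g2 y else id y"
  let ?f2 = "\<lambda>y. if y < q then h y else ?f1 y"
  let ?f3 = "\<lambda>y. if y < p then g1 y else ?f2 y"
  let ?f4 = "\<lambda>y. if y < a then id y else ?f3 y"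
  have 1: "?f1 \<in> PL2" using g2 dy by (intro PL2_glue PL2_id) auto
  have 2: "?f2 \<in> PL2" using g2 assms by (intro PL2_glue 1) auto
  have 3: "?f3 \<in> PL2" using g1 assms by (intro PL2_glue 2) auto
  have "?f4 \<in> PL2" using g1 assms by (intro PL2_glue 3 PL2_id) auto
  then show thesis
  proof (rule that)
    show "?f4 y = h y" if "y \<in> {p..q}" for y using that assms g2(2) by auto
    show "?f4 y = y" if "y \<notin> {a<..<b}" for y using that assms g1(2) by auto
  qed
qed

section \<open>Compactly supported homeomorphisms and their commutators\<close>

definition support_in :: "real set \<Rightarrow> (real \<Rightarrow> real) set" where
  "support_in W = {f \<in> PL2. \<forall>x. x \<notin> W \<longrightarrow> f x = x}"

definition compact_support_in :: "real set \<Rightarrow> (real \<Rightarrow> real) set" where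
  "compact_support_in W = (\<Union>{support_in {c..d} | c d. c \<le> d \<and> {c..d} \<subseteq> W})"

lemma support_inD: "f \<in> support_in W \<Longrightarrow> f \<in> PL2" "f \<in> support_in W \<Longrightarrow> x \<notin> W \<Longrightarrow> f x = x"
  by (auto simp: support_in_def)

lemma support_in_mono: "V \<subseteq> W \<Longrightarrow> support_in V \<subseteq> support_in W"
  by (auto simp: support_in_def)

lemma support_in_subgroup: "subgroup (support_in W) PL2_group"
proof (rule PL2.subgroupI)
  fix f assume "f \<in> support_in W"
  then have f: "f \<in> PL2" "\<And>x. x \<notin> W \<Longrightarrow> f x = x" by (auto simp: support_in_def)
  have "PL2_inv f x = x" if "x \<notin> W" for x
    using PL2_inv_inverts(1)[OF f(1), of x] f(2)[OF that] by simp
  then show "PL2_inv f \<in> support_in W"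
    using PL2_inv_inverts(3)[OF f(1)] by (simp add: support_in_def)
next
  have "id \<in> support_in W" by (simp add: support_in_def PL2_id)
  then show "support_in W \<noteq> {}" by blast
qed (auto simp: support_in_def PL2_compose)

lemma compact_support_in_iff:
  "f \<in> compact_support_in W \<longleftrightarrow> (\<exists>c d. c \<le> d \<and> {c..d} \<subseteq> W \<and> f \<in> support_in {c..d})"
  by (auto simp: compact_support_in_def)

lemma compact_support_inE:
  assumes "f \<in> compact_support_in W"
  obtains c d where "c \<le> d" "{c..d} \<subseteq> W" "f \<in> support_in {c..d}"
  using assms unfolding compact_support_in_iff by (elim exE conjE) rule

lemma compact_support_inI:
  "c \<le> d \<Longrightarrow> {c..d} \<subseteq> W \<Longrightarrow> f \<in> support_in {c..d} \<Longrightarrow> f \<in> compact_support_in W"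
  unfolding compact_support_in_iff by (intro exI conjI)

lemma support_in_maps:
  assumes "f \<in> support_in W" shows "f x \<in> W \<longleftrightarrow> x \<in> W"
proof
  have f: "f \<in> PL2" "\<And>x. x \<notin> W \<Longrightarrow> f x = x" using assms by (auto simp: support_in_def)
  show "x \<in> W" if "f x \<in> W" using that f(2)[of x] by (cases "x \<in> W") auto
  show "f x \<in> W" if "x \<in> W"
  proof (rule ccontr)
    assume "f x \<notin> W"
    then have "f x = x" using f(2)[of "f x"] by (simp add: PL2_eq_iff[OF f(1)])
    then show False using that \<open>f x \<notin> W\<close> by simp
  qed
qed

lemma compact_support_in_subgroup:
  assumes "is_interval W" "W \<noteq> {}"
  shows "subgroup (compact_support_in W) PL2_group"
proof -
  have join: "\<exists>c d. c \<le> d \<and> {c..d} \<subseteq> W \<and> f \<in> support_in {c..d} \<and> g \<in> support_in {c..d}"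
    if fW: "f \<in> compact_support_in W" and gW: "g \<in> compact_support_in W" for f g
  proof -
    obtain a b where f: "a \<le> b" "{a..b} \<subseteq> W" "f \<in> support_in {a..b}"
      using fW by (rule compact_support_inE)
    obtain c d where g: "c \<le> d" "{c..d} \<subseteq> W" "g \<in> support_in {c..d}"
      using gW by (rule compact_support_inE)
    have W: "min a c \<in> W" "max b d \<in> W" using f g by (auto simp: min_def max_def)
    have "{min a c..max b d} \<subseteq> W"
    proof
      fix x assume "x \<in> {min a c..max b d}"
      then show "x \<in> W" using mem_is_interval_1_I[OF assms(1) W] by simp
    qed
    moreover have "f \<in> support_in {min a c..max b d}" "g \<in> support_in {min a c..max b d}"
      using f(3) g(3) support_in_mono[of "{a..b}" "{min a c..max b d}"]
        support_in_mono[of "{c..d}" "{min a c..max b d}"] by auto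
    moreover have "min a c \<le> max b d" using f(1) by linarith
    ultimately show ?thesis by (intro exI[of _ "min a c"] exI[of _ "max b d"] conjI)
  qed
  show ?thesis
  proof (rule PL2.subgroupI)
    show "compact_support_in W \<subseteq> carrier PL2_group"
      by (auto simp: compact_support_in_iff support_in_def)
    obtain w where "w \<in> W" using assms(2) by blast
    then have "id \<in> compact_support_in W"
      by (intro compact_support_inI[of w w]) (auto simp: support_in_def PL2_id)
    then show "compact_support_in W \<noteq> {}" by blast
  next
    fix f assume "f \<in> compact_support_in W"
    then obtain a b where f: "a \<le> b" "{a..b} \<subseteq> W" "f \<in> support_in {a..b}"
      by (rule compact_support_inE)
    then show "PL2_inv f \<in> compact_support_in W"
      using subgroup.m_inv_closed[OF support_in_subgroup f(3)] by (intro compact_support_inI[of a b])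
  next
    fix f g assume fg: "f \<in> compact_support_in W" "g \<in> compact_support_in W"
    obtain c d where cd: "c \<le> d" "{c..d} \<subseteq> W" "f \<in> support_in {c..d}" "g \<in> support_in {c..d}"
      using join[OF fg] by (elim exE conjE)
    then show "f \<otimes>\<^bsub>PL2_group\<^esub> g \<in> compact_support_in W"
      using subgroup.m_closed[OF support_in_subgroup cd(3,4)] by (intro compact_support_inI[of c d])
  qed
qed

abbreviation PLc :: "(real \<Rightarrow> real) set" where "PLc \<equiv> compact_support_in UNIV"

lemma PLc_subgroup: "subgroup PLc PL2_group"
  by (rule compact_support_in_subgroup) auto

lemma PLcD: "f \<in> PLc \<Longrightarrow> f \<in> PL2"
  by (auto simp: compact_support_in_iff support_in_def)

lemma PLc_conj:
  assumes "f \<in> PLc" "g \<in> PL2"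
  shows "g \<circ> f \<circ> PL2_inv g \<in> PLc"
proof -
  obtain c d where cd: "c \<le> d" "f \<in> support_in {c..d}"
    using assms(1) by (rule compact_support_inE)
  note f = cd(2)[unfolded support_in_def]
  have "g \<circ> f \<circ> PL2_inv g \<in> support_in {g c..g d}"
  proof -
    have "g \<circ> f \<circ> PL2_inv g \<in> PL2"
      using f assms(2) by (intro PL2_compose PL2_inv_inverts) auto
    moreover have "g (f (PL2_inv g y)) = y" if "y \<notin> {g c..g d}" for y
    proof -
      define x where "x = PL2_inv g y"
      have y: "y = g x" using PL2_inv_inverts[OF assms(2)] by (simp add: x_def)
      then have "x \<notin> {c..d}" using that PL2_le_iff[OF assms(2)] by auto
      then have "g (f x) = y" using f y by simp
      then show ?thesis by (simp add: x_def)
    qed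
    ultimately show ?thesis by (simp add: support_in_def)
  qed
  moreover have "g c \<le> g d" using cd(1) PL2_le_iff[OF assms(2)] by simp
  ultimately show ?thesis by (intro compact_support_inI) auto
qed

lemma PLc_extension:
  assumes "g \<in> PL2"
  obtains h where "h \<in> PLc" "\<And>y. y \<in> {c..d} \<Longrightarrow> h y = g y"
proof -
  obtain p where p: "p \<in> \<D>" "p < min c d" by (rule dyadic_less)
  obtain q where q: "q \<in> \<D>" "max c d < q" by (rule dyadic_greater)
  obtain a where a: "a \<in> \<D>" "a < min p (g p)" by (rule dyadic_less)
  obtain b where b: "b \<in> \<D>" "max q (g q) < b" by (rule dyadic_greater)
  obtain h where h: "h \<in> PL2" "\<And>y. y \<in> {p..q} \<Longrightarrow> h y = g y" "\<And>y. y \<notin> {a<..<b} \<Longrightarrow> h y = y"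
  proof (rule PL2_compact_extension[OF assms, of a p q b])
    show "p < q" using p q by linarith
  qed (use p q a b in auto)
  have "h \<in> support_in {a..b}" using h by (auto simp: support_in_def)
  moreover have "a \<le> b" using p q a b by auto
  ultimately have "h \<in> PLc" by (intro compact_support_inI) auto
  then show thesis using h(2) p q by (intro that[of h]) auto
qed

abbreviation PLc_derived :: "(real \<Rightarrow> real) set" where
  "PLc_derived \<equiv> derived PL2_group PLc"

lemma PLc_derived_subgroup: "subgroup PLc_derived PL2_group"
  by (rule PL2.derived_is_subgroup) (auto dest: PLcD)

lemma PLc_derived_subset: "PLc_derived \<subseteq> PLc"
  by (rule PL2.derived_incl[OF order_refl PLc_subgroup])

lemma PLc_derived_compose: "f \<in> PLc_derived \<Longrightarrow> g \<in> PLc_derived \<Longrightarrow> f \<circ> g \<in> PLc_derived"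
  using subgroup.m_closed[OF PLc_derived_subgroup] by simp

lemma PLc_derived_inv: "f \<in> PLc_derived \<Longrightarrow> PL2_inv f \<in> PLc_derived"
  using subgroup.m_inv_closed[OF PLc_derived_subgroup] by simp

lemma PLc_derivedD: "f \<in> PLc_derived \<Longrightarrow> f \<in> PL2"
  using PLc_derived_subset PLcD by blast

lemma PLc_derived_conj:
  assumes "f \<in> PLc_derived" "g \<in> PL2"
  shows "g \<circ> f \<circ> PL2_inv g \<in> PLc_derived"
proof -
  let ?c = "\<lambda>f. g \<otimes>\<^bsub>PL2_group\<^esub> f \<otimes>\<^bsub>PL2_group\<^esub> PL2_inv g"
  have "?c \<in> hom PL2_group PL2_group"
  proof (rule homI)
    fix x y assume "x \<in> carrier PL2_group" "y \<in> carrier PL2_group"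
    then show "?c (x \<otimes>\<^bsub>PL2_group\<^esub> y) = ?c x \<otimes>\<^bsub>PL2_group\<^esub> ?c y"
      by (simp add: fun_eq_iff PL2_inv_inverts[OF assms(2)])
  qed (auto intro: PL2_compose PL2_inv_inverts assms(2))
  then interpret c: group_hom PL2_group PL2_group ?c
    by unfold_locales
  have "?c ` PLc_derived = derived PL2_group (?c ` PLc)"
    by (rule c.derived_img[symmetric]) (auto dest: PLcD)
  also have "\<dots> \<subseteq> PLc_derived"
    using PLc_conj[OF _ assms(2)] PLcD by (intro PL2.mono_derived) auto
  finally show ?thesis using assms(1) by auto
qed

text \<open>On the compact support of \<open>f\<close>, the element \<open>g\<close> agrees with some compactly supported \<open>h\<close>.
  Conjugation by \<open>g\<close> therefore has the same effect on \<open>f\<close> as conjugation by \<open>h\<close>, which is trivial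
  modulo commutators of compactly supported elements.\<close>

lemma PLc_conj_mod_derived:
  assumes "f \<in> PLc" "g \<in> PL2"
  shows "\<exists>a\<in>PLc_derived. g \<circ> f \<circ> PL2_inv g = a \<circ> f"
proof -
  note g = PL2_inv_inverts[OF assms(2)]
  obtain c d where cd: "f \<in> support_in {c..d}"
    using assms(1) by (rule compact_support_inE)
  obtain h where h: "h \<in> PLc" "\<And>y. y \<in> {c..d} \<Longrightarrow> h y = g y"
    using PLc_extension[OF assms(2)] by blast
  note h2 = PL2_inv_inverts[OF PLcD[OF h(1)]] and f = PL2_inv_inverts[OF PLcD[OF assms(1)]]
  have eq: "g \<circ> f \<circ> PL2_inv g = h \<circ> f \<circ> PL2_inv h"
  proof
    fix y
    show "(g \<circ> f \<circ> PL2_inv g) y = (h \<circ> f \<circ> PL2_inv h) y"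
    proof (cases "\<exists>x\<in>{c..d}. y = g x")
      case True
      then obtain x where x: "x \<in> {c..d}" "y = g x" by blast
      then have "f x \<in> {c..d}" using support_in_maps[OF cd] by simp
      then have "h (f x) = g (f x)" using h(2) by blast
      moreover have "y = h x" using x h(2) by simp
      ultimately show ?thesis using x(2) g h2 by (metis comp_apply)
    next
      case False
      have "PL2_inv g y \<notin> {c..d}" using False g(2) by metis
      moreover have "PL2_inv h y \<notin> {c..d}" using False h(2) h2(2) by metis
      ultimately show ?thesis using support_inD(2)[OF cd] g(2) h2(2) by simp
    qed
  qed
  let ?a = "h \<circ> f \<circ> PL2_inv h \<circ> PL2_inv f"
  have "?a \<in> PLc_derived"
    unfolding derived_def
    by (rule generate.incl) (use h(1) assms(1) in auto)
  moreover have "h \<circ> f \<circ> PL2_inv h = ?a \<circ> f" using f by (simp add: fun_eq_iff)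
  ultimately show ?thesis using eq by metis
qed

section \<open>The standard generator of Thompson's group\<close>

text \<open>The elements of Thompson's group, extended by the identity to the line.\<close>

abbreviation PLu :: "(real \<Rightarrow> real) set" where "PLu \<equiv> support_in {0<..<1}"

lemma PLu_subset_PLc: "PLu \<subseteq> PLc"
proof
  fix f assume "f \<in> PLu"
  then have "f \<in> support_in {0..1}" by (auto simp: support_in_def)
  then show "f \<in> PLc" by (rule compact_support_inI[rotated 2]) auto
qed

text \<open>The conjugate of \<open>f\<close> by \<open>y \<mapsto> (y + e) / 2\<close>. For \<open>e = 0\<close> and \<open>e = 1\<close> it is the copy on the left and
  on the right half of the unit interval of an element \<open>f\<close> living on the unit interval.\<close>

lemma PLc_derived_rescale:
  assumes "f \<in> PLc_derived" "e \<in> \<D>"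
  shows "(\<lambda>y. (f (2 * y - e) + e) / 2) \<in> PLc_derived"
proof -
  have g: "(\<lambda>y. 2 powi (- 1) * y + e / 2) \<in> PL2"
    using dyadic_divide_power[OF assms(2), of 1] by (intro PL2_affine) simp
  have "PL2_inv (\<lambda>y. 2 powi (- 1) * y + e / 2) z = 2 * z - e" for z
    using PL2_inv_inverts(2)[OF g, of z] by simp
  then show ?thesis using PLc_derived_conj[OF assms(1) g]
    by (simp add: comp_def add_divide_distrib)
qed

definition x0 :: "real \<Rightarrow> real" where
  "x0 y = (if y < 0 then y else if y < 1/4 then 2 * y else if y < 1/2 then y + 1/4
     else if y < 1 then y / 2 + 1/2 else y)"

lemma dyadic_fractions [simp]: "1/2 \<in> \<D>" "1/4 \<in> \<D>"
  using dyadic_divide_power[of 1 1] dyadic_divide_power[of 1 2] by simp_all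

lemma x0_PLu: "x0 \<in> PLu"
proof -
  have 1: "(\<lambda>y. y / 2 + 1/2) \<in> PL2" using PL2_affine[of "1/2" "-1"] by simp
  have 2: "(\<lambda>y. 2 * y) \<in> PL2" using PL2_scaling[of 1] by simp
  have 3: "(\<lambda>y. y + 1/4) \<in> PL2" using PL2_translation[of "1/4"] by simp
  have id: "(\<lambda>y. y) \<in> PL2" using PL2_translation[of 0] by simp
  have a: "(\<lambda>y. if y < 1 then y / 2 + 1/2 else y) \<in> PL2"
    by (rule PL2_glue[OF 1 id]) auto
  have b: "(\<lambda>y. if y < 1/2 then y + 1/4 else if y < 1 then y / 2 + 1/2 else y) \<in> PL2"
    by (rule PL2_glue[OF 3 a]) auto
  have c: "(\<lambda>y. if y < 1/4 then 2 * y else if y < 1/2 then y + 1/4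
      else if y < 1 then y / 2 + 1/2 else y) \<in> PL2"
    by (rule PL2_glue[OF 2 b]) auto
  have "x0 \<in> PL2" unfolding x0_def[abs_def]
    by (rule PL2_glue[OF id c]) auto
  moreover have "x0 y = y" if "y \<notin> {0<..<1}" for y
    using that by (auto simp: x0_def)
  ultimately show ?thesis by (simp add: support_in_def)
qed

lemma x0_pieces:
  "y < 0 \<Longrightarrow> x0 y = y" "0 \<le> y \<Longrightarrow> y < 1/4 \<Longrightarrow> x0 y = 2 * y" "1/4 \<le> y \<Longrightarrow> y < 1/2 \<Longrightarrow> x0 y = y + 1/4"
  "1/2 \<le> y \<Longrightarrow> y < 1 \<Longrightarrow> x0 y = y / 2 + 1/2" "1 \<le> y \<Longrightarrow> x0 y = y"
  by (auto simp: x0_def)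

text \<open>On binary trees \<open>x0\<close> is the rotation \<open>(AB)C \<rightarrow> A(BC)\<close>. Two routes lead from the left comb to the
  right comb with four leaves: two rotations at the root, or three rotations, of which one happens in
  the left subtree, one at the root and one in the right subtree.\<close>

lemma x0_pentagon: "x0 (x0 y) = (x0 (2 * (x0 (x0 (2 * y) / 2)) - 1) + 1) / 2"
proof -
  consider "y < 0" | "0 \<le> y" "y < 1/8" | "1/8 \<le> y" "y < 1/4" | "1/4 \<le> y" "y < 1/2" | "1/2 \<le> y" "y < 1" | "1 \<le> y"
    by linarith
  then show ?thesis by cases (simp_all add: x0_pieces add_divide_distrib diff_divide_distrib)
qed

text \<open>Modulo commutators all conjugates of \<open>x0\<close> coincide, so the pentagon relation reads
  \<open>x0\<^sup>2 = x0\<^sup>3\<close>. The proof carries elements \<open>a\<close> and \<open>b\<close> of the commutator subgroup along explicitly.\<close>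

lemma x0_derived: "x0 \<in> PLc_derived"
proof -
  have x: "x0 \<in> PLc" using x0_PLu PLu_subset_PLc by blast
  note X = PL2_inv_inverts[OF PLcD[OF x]]
  have conj: "\<exists>a\<in>PLc_derived. \<forall>y. (x0 (2 * y - e) + e) / 2 = a (x0 y)" if "e \<in> \<D>" for e
  proof -
    have g: "(\<lambda>y. 2 powi (- 1) * y + e / 2) \<in> PL2"
      using dyadic_divide_power[OF that, of 1] by (intro PL2_affine) simp
    have "PL2_inv (\<lambda>y. 2 powi (- 1) * y + e / 2) z = 2 * z - e" for z
      using PL2_inv_inverts(2)[OF g, of z] by simp
    then show ?thesis using PLc_conj_mod_derived[OF x g]
      by (simp add: fun_eq_iff add_divide_distrib)
  qed
  obtain b where b: "b \<in> PLc_derived" "\<And>y. x0 (2 * y) / 2 = b (x0 y)"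
    using conj[of 0] by auto
  obtain a where a: "a \<in> PLc_derived" "\<And>y. (x0 (2 * y - 1) + 1) / 2 = a (x0 y)"
    using conj[of 1] by auto
  have 1: "x0 y = a (x0 (x0 (b y)))" for y
  proof -
    define z where "z = PL2_inv x0 y"
    have "x0 (x0 z) = a (x0 (x0 (b (x0 z))))" unfolding x0_pentagon[of z] a(2) b(2) ..
    then show ?thesis by (simp add: z_def X)
  qed
  have xx: "x0 \<circ> x0 \<in> PL2" using PL2_compose PLcD[OF x] by blast
  define c where "c = (x0 \<circ> x0) \<circ> b \<circ> PL2_inv (x0 \<circ> x0)"
  have c: "c \<in> PLc_derived" unfolding c_def using b(1) xx by (rule PLc_derived_conj)
  have cb: "x0 (x0 (b y)) = c (x0 (x0 y))" for y
    using PL2_inv_inverts(1)[OF xx, of y] by (simp add: c_def)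
  have ac: "a (c (x0 y)) = y" for y
  proof -
    have "x0 (PL2_inv x0 y) = a (c (x0 (x0 (PL2_inv x0 y))))" using 1 cb by simp
    then show ?thesis by (simp add: X)
  qed
  have d: "a \<circ> c \<in> PLc_derived" using a(1) c by (rule PLc_derived_compose)
  have "x0 = PL2_inv (a \<circ> c)"
    using ac PL2_inv_inverts(1)[OF PLc_derivedD[OF d]] by (simp add: fun_eq_iff) (metis)
  then show ?thesis using PLc_derived_inv[OF d] by simp
qed

section \<open>Standard dyadic intervals\<close>

text \<open>The intervals \<open>[j / 2\<^sup>l, (j + 1) / 2\<^sup>l]\<close> inside the unit interval, generated as the nodes of the
  infinite binary tree. Case analysis says that such an interval is the whole unit interval or a
  rescaled copy, in the left or right half, of a smaller instance.\<close>

inductive std_dyadic :: "real \<Rightarrow> real \<Rightarrow> bool" where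
  unit: "std_dyadic 0 1"
| half: "std_dyadic a b \<Longrightarrow> e = 0 \<or> e = 1 \<Longrightarrow> std_dyadic ((a + e) / 2) ((b + e) / 2)"

lemma std_dyadic_bounds: "std_dyadic a b \<Longrightarrow> 0 \<le> a \<and> a < b \<and> b \<le> 1"
  by (induction rule: std_dyadic.induct) auto

lemma std_dyadic_mesh: "i < 2 ^ k \<Longrightarrow> std_dyadic (real i / 2 ^ k) ((real i + 1) / 2 ^ k)"
proof (induction k arbitrary: i)
  case 0
  then show ?case using std_dyadic.unit by simp
next
  case (Suc k)
  show ?case
  proof (cases "i < 2 ^ k")
    case True
    from std_dyadic.half[OF Suc.IH[OF this], of 0] show ?thesis by (simp add: field_simps)
  next
    case False
    then have i: "i - 2 ^ k < 2 ^ k" "real (i - 2 ^ k) = real i - 2 ^ k" using Suc.prems by auto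
    have eq: "(real (i - 2 ^ k) / 2 ^ k + 1) / 2 = real i / 2 ^ Suc k"
        "((real (i - 2 ^ k) + 1) / 2 ^ k + 1) / 2 = (real i + 1) / 2 ^ Suc k"
      unfolding i(2) by (simp_all add: field_simps)
    from std_dyadic.half[OF Suc.IH[OF i(1)], of 1] show ?thesis unfolding eq by simp
  qed
qed

definition carries :: "(real \<Rightarrow> real) \<Rightarrow> real \<Rightarrow> real \<Rightarrow> bool" where
  "carries f a b \<longleftrightarrow> std_dyadic (f a) (f b) \<and>
     (\<forall>x\<in>{a..b}. f x = f a + (f b - f a) / (b - a) * (x - a))"

lemma carriesD:
  assumes "carries f a b"
  shows carries_std: "std_dyadic (f a) (f b)"
    and carries_eq: "x \<in> {a..b} \<Longrightarrow> f x = f a + (f b - f a) / (b - a) * (x - a)"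
  using assms by (auto simp only: carries_def)

lemma carries_cong:
  assumes f: "carries f a b" and eq: "\<And>x. x \<in> {a..b} \<Longrightarrow> g x = f x" and "a \<le> b"
  shows "carries g a b"
proof -
  have ends: "g a = f a" "g b = f b" using assms(3) by (auto intro!: eq)
  show ?thesis unfolding carries_def ends
  proof (intro conjI ballI carries_std[OF f])
    fix x assume "x \<in> {a..b}"
    then show "g x = f a + (f b - f a) / (b - a) * (x - a)"
      using eq carries_eq[OF f] by metis
  qed
qed

lemma carries_compose:
  assumes f: "carries f a b" and g: "carries g (f a) (f b)" and "a < b"
  shows "carries (g \<circ> f) a b"
  unfolding carries_def
proof (intro conjI ballI)
  show "std_dyadic ((g \<circ> f) a) ((g \<circ> f) b)" using carries_std[OF g] by simp
  fix x assume x: "x \<in> {a..b}"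
  define t where "t = (x - a) / (b - a)"
  have t: "0 \<le> t" "t \<le> 1" using x \<open>a < b\<close> by (auto simp: t_def)
  have lt: "f a < f b" using std_dyadic_bounds[OF carries_std[OF f]] by simp
  have fx: "f x = f a + (f b - f a) * t" using carries_eq[OF f x] by (simp add: t_def)
  have "(f b - f a) * t \<le> (f b - f a) * 1" using lt t by (intro mult_left_mono) auto
  then have "f a + (f b - f a) * t \<le> f b" by simp
  then have "f x \<in> {f a..f b}" using lt t by (simp add: fx)
  then have "g (f x) = g (f a) + (g (f b) - g (f a)) / (f b - f a) * (f x - f a)"
    by (rule carries_eq[OF g])
  also have "\<dots> = g (f a) + (g (f b) - g (f a)) * t" using lt by (simp add: fx)
  finally show "(g \<circ> f) x = (g \<circ> f) a + ((g \<circ> f) b - (g \<circ> f) a) / (b - a) * (x - a)"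
    by (simp add: t_def)
qed

lemma carries_affine:
  assumes "\<And>x. x \<in> {a..b} \<Longrightarrow> f x = s * x + c" "a < b" "std_dyadic (s * a + c) (s * b + c)"
  shows "carries f a b"
proof -
  have ab: "f a = s * a + c" "f b = s * b + c" using assms by auto
  have s: "(s * b - s * a) / (b - a) = s" using assms(2) by (simp add: field_simps)
  show ?thesis unfolding carries_def
    using assms s by (simp add: ab) (simp add: algebra_simps)
qed

lemma carries_rescale:
  assumes "carries f a b" "e = 0 \<or> e = 1"
  shows "carries (\<lambda>y. (f (2 * y - e) + e) / 2) ((a + e) / 2) ((b + e) / 2)"
  unfolding carries_def
proof (intro conjI ballI)
  have e: "2 * ((z + e) / 2) - e = z" for z by (simp add: field_simps)
  show "std_dyadic ((f (2 * ((a + e) / 2) - e) + e) / 2) ((f (2 * ((b + e) / 2) - e) + e) / 2)"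
    unfolding e by (rule std_dyadic.half[OF carries_std[OF assms(1)] assms(2)])
  fix x assume "x \<in> {(a + e) / 2..(b + e) / 2}"
  then have "2 * x - e \<in> {a..b}" by auto
  then have f: "f (2 * x - e) = f a + (f b - f a) / (b - a) * (2 * x - e - a)"
    by (rule carries_eq[OF assms(1)])
  have d: "(p + e) / 2 - (q + e) / 2 = (p - q) / 2" for p q :: real by (simp add: field_simps)
  have r: "((f b + e) / 2 - (f a + e) / 2) / ((b + e) / 2 - (a + e) / 2) = (f b - f a) / (b - a)"
    unfolding d by (rule mult_divide_mult_cancel_right[of "inverse 2", folded divide_inverse]) simp
  have "(p + s * (2 * x - e - a) + e) / 2 = (p + e) / 2 + s * (x - (a + e) / 2)" for p s
    by (simp add: field_simps)
  from this[of "f a" "(f b - f a) / (b - a)"]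
  show "(f (2 * x - e) + e) / 2 = (f (2 * ((a + e) / 2) - e) + e) / 2 +
      ((f (2 * ((b + e) / 2) - e) + e) / 2 - (f (2 * ((a + e) / 2) - e) + e) / 2) /
      ((b + e) / 2 - (a + e) / 2) * (x - (a + e) / 2)"
    unfolding e r f .
qed

lemma carries_id: "std_dyadic a b \<Longrightarrow> (\<And>x. x \<in> {a..b} \<Longrightarrow> f x = x) \<Longrightarrow> carries f a b"
  using std_dyadic_bounds[of a b] by (intro carries_affine[of a b f 1 0]) auto

text \<open>Seen on trees, \<open>x0\<close> moves every node to a node, except the root and its left child.\<close>

lemma x0_carries:
  assumes "std_dyadic a b" "\<not> (a < 1/4 \<and> 1/4 < b)" "a > 0 \<or> b < 1"
  shows "carries x0 a b"
  using assms(1)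
proof (cases rule: std_dyadic.cases)
  case unit
  then show ?thesis using assms by auto
next
  case (half a' b' e)
  note b' = std_dyadic_bounds[OF half(3)]
  show ?thesis
  proof (cases "e = 1")
    case True
    show ?thesis
    proof (rule carries_affine[where s = "1/2" and c = "1/2"])
      show "x0 x = 1/2 * x + 1/2" if "x \<in> {a..b}" for x
        using that b' half True by (auto simp: x0_def)
      show "std_dyadic (1/2 * a + 1/2) (1/2 * b + 1/2)"
        using std_dyadic.half[OF assms(1), of 1] by (simp add: add_divide_distrib)
    qed (use b' half in auto)
  next
    case False
    then have e: "e = 0" using half by simp
    from half(3) show ?thesis
    proof (cases rule: std_dyadic.cases)
      case unit
      then show ?thesis using half e assms(2) by auto
    next
      case (half a'' b'' e')
      note ab = \<open>a = (a' + e) / 2\<close> \<open>b = (b' + e) / 2\<close>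
      note b'' = std_dyadic_bounds[OF half(3)]
      show ?thesis
      proof (cases "e' = 0")
        case True
        show ?thesis
        proof (rule carries_affine[where s = 2 and c = 0])
          show "x0 x = 2 * x + 0" if "x \<in> {a..b}" for x
            using that b'' half ab e True by (auto simp: x0_def)
          show "std_dyadic (2 * a + 0) (2 * b + 0)"
            using \<open>std_dyadic a' b'\<close> unfolding ab e by (simp add: field_simps)
        qed (use b' ab in auto)
      next
        case False
        then have e': "e' = 1" using half by simp
        have ab': "a = (a'' + 1) / 4" "b = (b'' + 1) / 4" using ab half e e' by simp_all
        show ?thesis
        proof (rule carries_affine[where s = 1 and c = "1/4"])
          show "x0 x = 1 * x + 1/4" if "x \<in> {a..b}" for x
            using that b'' ab' by (auto simp: x0_def)
          have "((a'' + 0) / 2 + 1) / 2 = 1 * a + 1/4" "((b'' + 0) / 2 + 1) / 2 = 1 * b + 1/4"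
            by (simp_all add: ab' add_divide_distrib)
          from std_dyadic.half[OF std_dyadic.half[OF half(3), of 0], of 1, unfolded this]
          show "std_dyadic (1 * a + 1/4) (1 * b + 1/4)" by simp
        qed (use b' ab in auto)
      qed
    qed
  qed
qed

lemma x0_inv_carries:
  assumes "std_dyadic a b" "\<not> (a < 3/4 \<and> 3/4 < b)" "a > 0 \<or> b < 1"
  shows "carries (PL2_inv x0) a b"
proof -
  note inv = PL2_inv_inverts[OF support_inD(1)[OF x0_PLu]]
  have eq: "PL2_inv x0 x = z" if "x0 z = x" for x z
    using inv(1)[of z] that by simp
  have pieces1: "PL2_inv x0 x = 1/2 * x + 0" if "0 \<le> x" "x \<le> 1/2" for x
    by (rule eq) (use that in \<open>auto simp: x0_def\<close>)
  have pieces2: "PL2_inv x0 x = 1 * x + (- 1/4)" if "1/2 \<le> x" "x \<le> 3/4" for x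
    by (rule eq) (use that in \<open>cases "x = 3/4"; auto simp: x0_def field_simps\<close>)
  have pieces3: "PL2_inv x0 x = 2 * x + (- 1)" if "3/4 \<le> x" "x \<le> 1" for x
    by (rule eq) (use that in \<open>auto simp: x0_def field_simps\<close>)
  show ?thesis
    using assms(1)
  proof (cases rule: std_dyadic.cases)
    case unit
    then show ?thesis using assms by auto
  next
    case (half a' b' e)
    note b' = std_dyadic_bounds[OF half(3)]
    show ?thesis
    proof (cases "e = 0")
      case True
      show ?thesis
      proof (rule carries_affine[where s = "1/2" and c = 0])
        show "PL2_inv x0 x = 1/2 * x + 0" if "x \<in> {a..b}" for x
          using that b' half True by (intro pieces1) auto
        show "std_dyadic (1/2 * a + 0) (1/2 * b + 0)"
          using std_dyadic.half[OF assms(1), of 0] by simp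
      qed (use b' half in auto)
    next
      case False
      then have e: "e = 1" using half by simp
      from half(3) show ?thesis
      proof (cases rule: std_dyadic.cases)
        case unit
        then show ?thesis using half e assms(2) by auto
      next
        case (half a'' b'' e')
        note ab = \<open>a = (a' + e) / 2\<close> \<open>b = (b' + e) / 2\<close>
        note b'' = std_dyadic_bounds[OF half(3)]
        show ?thesis
        proof (cases "e' = 1")
          case True
          show ?thesis
          proof (rule carries_affine[where s = 2 and c = "- 1"])
            show "PL2_inv x0 x = 2 * x + (- 1)" if "x \<in> {a..b}" for x
            proof (rule pieces3)
              have "a' \<ge> 1/2" "b' \<le> 1" using b'' half(1,2) True by auto
              then show "3/4 \<le> x" "x \<le> 1" using that ab e by auto
            qed
            show "std_dyadic (2 * a + (- 1)) (2 * b + (- 1))"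
              using \<open>std_dyadic a' b'\<close> unfolding ab e by (simp add: field_simps)
          qed (use b' ab in auto)
        next
          case False
          then have e': "e' = 0" using half by simp
          have ab': "a = (a'' + 2) / 4" "b = (b'' + 2) / 4" using ab half e e' by (simp_all add: field_simps)
          show ?thesis
          proof (rule carries_affine[where s = 1 and c = "- 1/4"])
            show "PL2_inv x0 x = 1 * x + (- 1/4)" if "x \<in> {a..b}" for x
              using that b'' ab' by (intro pieces2) auto
            have "((a'' + 1) / 2 + 0) / 2 = 1 * a + (- 1/4)" "((b'' + 1) / 2 + 0) / 2 = 1 * b + (- 1/4)"
              by (simp_all add: ab' add_divide_distrib)
            from std_dyadic.half[OF std_dyadic.half[OF half(3), of 1], of 0, unfolded this]
            show "std_dyadic (1 * a + (- 1/4)) (1 * b + (- 1/4))" by simp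
          qed (use b' ab in auto)
        qed
      qed
    qed
  qed
qed

lemma carries_half:
  assumes "std_dyadic a b" "\<not> (a < c \<and> c < b)" "e = 0 \<or> e = 1" "0 < 2 * c - e" "2 * c - e < 1"
    and g: "g \<in> PLu" "\<And>a b. std_dyadic a b \<Longrightarrow> \<not> (a < 2 * c - e \<and> 2 * c - e < b) \<Longrightarrow> carries g a b"
  shows "carries (\<lambda>y. (g (2 * y - e) + e) / 2) a b"
  using assms(1)
proof (cases rule: std_dyadic.cases)
  case unit
  then show ?thesis using assms by auto
next
  case (half a' b' e')
  show ?thesis
  proof (cases "e' = e")
    case True
    have "carries g a' b'" using half True assms(2) by (intro g(2)) auto
    from carries_rescale[OF this assms(3)] show ?thesis unfolding half(1,2) True .
  next
    case False
    then have "(g (2 * x - e) + e) / 2 = x" if "x \<in> {a..b}" for x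
      using that std_dyadic_bounds[OF half(3)] half assms(3) support_inD(2)[OF g(1), of "2 * x - e"] by auto
    then show ?thesis by (intro carries_id assms(1))
  qed
qed

text \<open>Every dyadic point \<open>c\<close> can be moved to \<open>1/2\<close> by rotations that keep all standard intervals not
  split by \<open>c\<close>. The induction is on the depth of \<open>c\<close> in the binary tree: a product of rotations inside
  the half containing \<open>c\<close> brings \<open>c\<close> to the midpoint of that half, and one rotation at the root,
  \<open>x0\<close> or its inverse, brings that midpoint to \<open>1/2\<close>.\<close>

lemma std_dyadic_recenter:
  assumes "0 < c" "c < 1" "c * 2 ^ m \<in> \<int>"
  shows "\<exists>g\<in>PLu \<inter> PLc_derived. g c = 1/2 \<and>
    (\<forall>a b. std_dyadic a b \<longrightarrow> \<not> (a < c \<and> c < b) \<longrightarrow> carries g a b)"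
  using assms
proof (induction m arbitrary: c)
  case 0
  then show ?case by (auto elim!: Ints_cases)
next
  case (Suc m)
  \<comment> \<open>A recentring element for \<open>2 * c - e\<close>, copied to the half of the unit interval that contains \<open>c\<close>.\<close>
  have in_half: "\<exists>g\<in>PLu \<inter> PLc_derived. g c = (1/2 + e) / 2 \<and>
    (\<forall>a b. std_dyadic a b \<longrightarrow> \<not> (a < c \<and> c < b) \<longrightarrow> carries g a b)"
    if e: "e = 0 \<or> e = 1" "0 < 2 * c - e" "2 * c - e < 1" for e
  proof -
    have "c * 2 ^ Suc m - e * 2 ^ m \<in> \<int>" using Suc.prems(3) e(1) by (intro Ints_diff) auto
    then have "(2 * c - e) * 2 ^ m \<in> \<int>" by (simp add: algebra_simps)
    then obtain g where g: "g \<in> PLu" "g \<in> PLc_derived" "g (2 * c - e) = 1/2"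
      "\<And>a b. std_dyadic a b \<Longrightarrow> \<not> (a < 2 * c - e \<and> 2 * c - e < b) \<Longrightarrow> carries g a b"
      using Suc.IH[OF e(2,3)] by auto
    let ?g = "\<lambda>y. (g (2 * y - e) + e) / 2"
    have D: "?g \<in> PLc_derived" using e(1) by (intro PLc_derived_rescale g(2)) auto
    have "?g y = y" if "y \<notin> {0<..<1}" for y
    proof -
      have "2 * y - e \<notin> {0<..<1}" using that e(1) by auto
      then show ?thesis using support_inD(2)[OF g(1)] by simp
    qed
    then have "?g \<in> PLu" using PLc_derivedD[OF D] by (simp add: support_in_def)
    moreover have "carries ?g a b" if "std_dyadic a b" "\<not> (a < c \<and> c < b)" for a b
      using that e g(1,4) by (rule carries_half)
    ultimately show ?thesis using D g(3) by (intro bexI[of _ ?g]) auto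
  qed
  \<comment> \<open>The rotation \<open>h\<close> at the root follows the element \<open>g\<close> that has moved \<open>c\<close> to the midpoint \<open>d\<close> of a
    half.\<close>
  have finish: ?case
    if g: "g \<in> PLu" "g \<in> PLc_derived" "g c = d"
      "\<And>a b. std_dyadic a b \<Longrightarrow> \<not> (a < c \<and> c < b) \<Longrightarrow> carries g a b"
    and h: "h \<in> PLu" "h \<in> PLc_derived" "h d = 1/2"
      "\<And>a b. std_dyadic a b \<Longrightarrow> \<not> (a < d \<and> d < b) \<Longrightarrow> a > 0 \<or> b < 1 \<Longrightarrow> carries h a b" for g h d
  proof -
    have "carries (h \<circ> g) a b" if ab: "std_dyadic a b" "\<not> (a < c \<and> c < b)" for a b
    proof (rule carries_compose)
      show c: "carries g a b" using g(4) ab .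
      note less = PL2_less_iff[OF support_inD(1)[OF g(1)]]
      have "a > 0 \<or> b < 1" using ab Suc.prems by linarith
      moreover have "g 0 = 0" "g 1 = 1" using support_inD(2)[OF g(1)] by auto
      ultimately have "g a > 0 \<or> g b < 1" using less[of 0 a] less[of b 1] by auto
      moreover have "\<not> (g a < d \<and> d < g b)" using ab(2) less[of a c] less[of c b] g(3) by auto
      ultimately show "carries h (g a) (g b)" using carries_std[OF c] by (intro h(4))
      show "a < b" using std_dyadic_bounds[OF ab(1)] by simp
    qed
    moreover have "h \<circ> g \<in> PLu" using subgroup.m_closed[OF support_in_subgroup h(1) g(1)] by simp
    moreover have "h \<circ> g \<in> PLc_derived" using PLc_derived_compose h(2) g(2) by blast
    moreover have "(h \<circ> g) c = 1/2" using g(3) h(3) by simp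
    ultimately show ?thesis by (intro bexI[of _ "h \<circ> g"] conjI IntI allI impI)
  qed
  consider "c < 1/2" | "c = 1/2" | "c > 1/2" by linarith
  then show ?case
  proof cases
    case 1
    then obtain g where g: "g \<in> PLu" "g \<in> PLc_derived" "g c = 1/4"
      "\<And>a b. std_dyadic a b \<Longrightarrow> \<not> (a < c \<and> c < b) \<Longrightarrow> carries g a b"
      using in_half[of 0] Suc.prems by auto
    show ?thesis
    proof (rule finish[OF g x0_PLu x0_derived _ x0_carries])
      show "x0 (1/4) = 1/2" by (simp add: x0_def)
    qed
  next
    case 2
    have "id \<in> PLu" using subgroup.one_closed[OF support_in_subgroup] by simp
    moreover have "id \<in> PLc_derived" using subgroup.one_closed[OF PLc_derived_subgroup] by simp
    moreover have "carries id a b" if "std_dyadic a b" for a b using that by (intro carries_id) auto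
    moreover have "id c = 1/2" using 2 by simp
    ultimately show ?thesis by (intro bexI[of _ id] conjI IntI allI impI)
  next
    case 3
    then obtain g where g: "g \<in> PLu" "g \<in> PLc_derived" "g c = 3/4"
      "\<And>a b. std_dyadic a b \<Longrightarrow> \<not> (a < c \<and> c < b) \<Longrightarrow> carries g a b"
      using in_half[of 1] Suc.prems by auto
    show ?thesis
    proof (rule finish[OF g _ _ _ x0_inv_carries])
      show "PL2_inv x0 (3/4) = 1/2"
        using PL2_inv_inverts(1)[OF support_inD(1)[OF x0_PLu], of "1/2"] by (simp add: x0_def)
      show "PL2_inv x0 \<in> PLu" using subgroup.m_inv_closed[OF support_in_subgroup x0_PLu] .
      show "PL2_inv x0 \<in> PLc_derived" by (rule PLc_derived_inv[OF x0_derived])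
    qed
  qed
qed

section \<open>The compactly supported group is perfect\<close>

text \<open>Inverse to the rescaling of a carried interval: an affine map between intervals in one half of the
  unit interval is blown up to the whole unit interval.\<close>

lemma carries_unhalve:
  assumes h: "carries h ((a + e) / 2) ((b + e) / 2)" and e: "e = 0 \<or> e = 1"
    and bd: "e \<le> 2 * h ((a + e) / 2)" "2 * h ((b + e) / 2) \<le> e + 1" and ab: "a < b"
  shows "carries (\<lambda>y. 2 * h ((y + e) / 2) - e) a b"
proof -
  let ?p = "h ((a + e) / 2)" and ?q = "h ((b + e) / 2)"
  have std: "std_dyadic (2 * ?p - e) (2 * ?q - e)"
    using carries_std[OF h]
  proof (cases rule: std_dyadic.cases)
    case unit
    then show ?thesis using e bd by auto
  next
    case (half p q e')
    note pq = std_dyadic_bounds[OF half(3)]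
    have "e' = e" using half(1,2,4) bd e pq by (auto simp: field_simps)
    then show ?thesis using half(3) unfolding half(1,2) by (simp add: field_simps)
  qed
  define s where "s = (?q - ?p) / ((b + e) / 2 - (a + e) / 2)"
  have eq: "2 * h ((y + e) / 2) - e = s * y + (2 * ?p - s * a - e)" if "y \<in> {a..b}" for y
  proof -
    have "(y + e) / 2 \<in> {(a + e) / 2..(b + e) / 2}" using that by auto
    then have "h ((y + e) / 2) = ?p + s * ((y + e) / 2 - (a + e) / 2)"
      unfolding s_def by (rule carries_eq[OF h])
    moreover have "(y + e) / 2 - (a + e) / 2 = (y - a) / 2" by (simp add: field_simps)
    ultimately show ?thesis by (simp add: field_simps)
  qed
  have aI: "a \<in> {a..b}" and bI: "b \<in> {a..b}" using ab by auto
  show ?thesis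
  proof (rule carries_affine[OF eq ab])
    show "std_dyadic (s * a + (2 * ?p - s * a - e)) (s * b + (2 * ?p - s * a - e))"
      using std unfolding eq[OF aI] eq[OF bI] .
  qed
qed

text \<open>After composing \<open>f\<close> with an element that recentres at \<open>f (1/2)\<close>, the midpoint is fixed. The result is
  the product of its restrictions to the two halves, and blowing these up yields two elements that
  carry the mesh of twice the width.\<close>

lemma PLu_carrying_mesh_derived:
  assumes "f \<in> PLu" "\<And>i. i < 2 ^ k \<Longrightarrow> carries f (real i / 2 ^ k) ((real i + 1) / 2 ^ k)"
  shows "f \<in> PLc_derived"
  using assms
proof (induction k arbitrary: f)
  case 0
  have "carries f 0 1" using "0.prems"(2)[of 0] by simp
  have f01: "f 0 = 0" "f 1 = 1" using support_inD(2)[OF "0.prems"(1)] by auto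
  have "f y = y" for y
  proof (cases "y \<in> {0..1}")
    case True
    then show ?thesis using carries_eq[OF \<open>carries f 0 1\<close> True] f01 by simp
  next
    case False
    then show ?thesis using support_inD(2)[OF "0.prems"(1), of y] by auto
  qed
  then have "f = id" by auto
  moreover have "id \<in> PLc_derived"
    using subgroup.one_closed[OF PLc_derived_subgroup] by (simp only: PL2_group_simps)
  ultimately show ?case by (simp only:)
next
  case (Suc k)
  have fPL: "f \<in> PL2" using support_inD(1)[OF Suc.prems(1)] .
  note less = PL2_less_iff[OF fPL] and le = PL2_le_iff[OF fPL]
  have f01: "f 0 = 0" "f 1 = 1" using support_inD(2)[OF Suc.prems(1)] by auto
  define c where "c = f (1/2)"
  have c: "0 < c" "c < 1" using less[of 0 "1/2"] less[of "1/2" 1] f01 by (auto simp: c_def)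
  have "c \<in> \<D>"
  proof -
    obtain j where "f (1/2) - 2 powi j * (1/2) \<in> \<D>"
      using PL2_dpl_at[OF fPL, of "1/2"] by (rule dpl_atE) blast
    then show ?thesis using dyadic_add[of _ "2 powi j * (1/2)"] by (fastforce simp: c_def)
  qed
  then obtain m where m: "c * 2 ^ m \<in> \<int>" by (auto simp: dyadic_iff)
  obtain g where g: "g \<in> PLu" "g \<in> PLc_derived" "g c = 1/2"
    "\<And>a b. std_dyadic a b \<Longrightarrow> \<not> (a < c \<and> c < b) \<Longrightarrow> carries g a b"
    using std_dyadic_recenter[OF c m] by blast
  define h where "h = g \<circ> f"
  have hu: "h \<in> PLu" unfolding h_def using subgroup.m_closed[OF support_in_subgroup g(1) Suc.prems(1)] by simp
  note h = support_inD(1)[OF hu]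
  have h_half: "h (1/2) = 1/2" using g(3) by (simp add: h_def c_def)
  have hmesh: "carries h (real i / 2 ^ Suc k) ((real i + 1) / 2 ^ Suc k)" if "i < 2 ^ Suc k" for i
    unfolding h_def
  proof (rule carries_compose[OF Suc.prems(2)[OF that] g(4)])
    show "std_dyadic (f (real i / 2 ^ Suc k)) (f ((real i + 1) / 2 ^ Suc k))"
      by (rule carries_std[OF Suc.prems(2)[OF that]])
    have "\<not> (real i / 2 ^ Suc k < 1/2 \<and> 1/2 < (real i + 1) / 2 ^ Suc k)"
    proof
      assume "real i / 2 ^ Suc k < 1/2 \<and> 1/2 < (real i + 1) / 2 ^ Suc k"
      then have "real i < real (2 ^ k)" "real (2 ^ k) < real (i + 1)" by (simp_all add: field_simps)
      then show False unfolding of_nat_less_iff by linarith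
    qed
    then show "\<not> (f (real i / 2 ^ Suc k) < c \<and> c < f ((real i + 1) / 2 ^ Suc k))"
      unfolding c_def less .
  qed (simp add: divide_strict_right_mono)
  \<comment> \<open>Here \<open>h1\<close> is the part of \<open>h\<close> on the left half (\<open>e = 0\<close>) or on the right half (\<open>e = 1\<close>), and
    \<open>?h\<close> is its blow-up to the unit interval.\<close>
  have D: "h1 \<in> PLc_derived"
    if e: "e = 0 \<or> e = 1" and h1: "h1 \<in> PL2" "\<And>y. y \<in> {e/2..(e+1)/2} \<Longrightarrow> h1 y = h y"
      "\<And>y. y \<notin> {e/2..(e+1)/2} \<Longrightarrow> h1 y = y" for h1 e
  proof -
    let ?h = "\<lambda>y. 2 * h1 ((y + e) / 2) - e"
    have eD: "e \<in> \<D>" "e / 2 \<in> \<D>" using e by auto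
    have "(\<lambda>y. 2 powi 1 * y + (- e)) \<circ> (h1 \<circ> (\<lambda>y. 2 powi (-1) * y + e / 2)) \<in> PL2"
      using eD by (intro PL2_compose PL2_affine h1(1)) auto
    then have "?h \<in> PL2" by (simp add: comp_def add_divide_distrib)
    moreover have "?h y = y" if "y \<notin> {0<..<1}" for y
    proof -
      have "y < 0 \<or> y > 1 \<or> y = 0 \<or> y = 1" using that by force
      then consider "y < 0" | "y > 1" | "y = 0" | "y = 1" by blast
      then have "h1 ((y + e) / 2) = (y + e) / 2"
      proof cases
        case 1
        then show ?thesis by (intro h1(3)) auto
      next
        case 2
        then show ?thesis by (intro h1(3)) auto
      next
        case 3
        then show ?thesis using h1(2)[of "e/2"] e h_half support_inD(2)[OF hu, of 0] by auto
      next
        case 4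
        then show ?thesis using h1(2)[of "(e+1)/2"] e h_half support_inD(2)[OF hu, of 1] by auto
      qed
      then show ?thesis by (simp add: field_simps)
    qed
    ultimately have "?h \<in> PLu" by (simp add: support_in_def)
    moreover have "carries ?h u v"
      if car: "carries h ((u + e) / 2) ((v + e) / 2)" and uv: "0 \<le> u" "u < v" "v \<le> 1" for u v
    proof -
      have eq: "h1 y = h y" if "y \<in> {(u + e) / 2..(v + e) / 2}" for y
        using that uv by (intro h1(2)) auto
      have car1: "carries h1 ((u + e) / 2) ((v + e) / 2)"
        by (rule carries_cong[OF car eq]) (use uv in auto)
      note le1 = PL2_le_iff[OF h1(1)]
      have "h1 (e/2) = e/2" using h1(2)[of "e/2"] e h_half support_inD(2)[OF hu, of 0] by auto
      moreover have "h1 ((e+1)/2) = (e+1)/2" using h1(2)[of "(e+1)/2"] e h_half support_inD(2)[OF hu, of 1] by auto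
      ultimately have "e \<le> 2 * h1 ((u + e) / 2)" "2 * h1 ((v + e) / 2) \<le> e + 1"
        using le1[of "e/2" "(u + e) / 2"] le1[of "(v + e) / 2" "(e+1)/2"] uv by auto
      then show ?thesis using carries_unhalve[OF car1 e] uv(2) by simp
    qed
    moreover have "carries h ((real i / 2 ^ k + e) / 2) (((real i + 1) / 2 ^ k + e) / 2)"
      if i: "i < 2 ^ k" for i
    proof -
      obtain i' where i': "i' < 2 ^ Suc k" "(real i / 2 ^ k + e) / 2 = real i' / 2 ^ Suc k"
        "((real i + 1) / 2 ^ k + e) / 2 = (real i' + 1) / 2 ^ Suc k"
      proof (cases "e = 0")
        case True
        show ?thesis by (rule that[of i]) (use True i in auto)
      next
        case False
        show ?thesis by (rule that[of "i + 2 ^ k"]) (use False e i in \<open>auto simp: field_simps\<close>)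
      qed
      show ?thesis unfolding i'(2,3) by (rule hmesh[OF i'(1)])
    qed
    ultimately have "?h \<in> PLc_derived"
      using std_dyadic_bounds[OF std_dyadic_mesh] by (intro Suc.IH) blast+
    from PLc_derived_rescale[OF this eD(1)] show ?thesis by (simp add: field_simps)
  qed
  let ?l = "\<lambda>y. if y < 1/2 then h y else id y" and ?r = "\<lambda>y. if y < 1/2 then id y else h y"
  have "?l \<in> PL2" using h h_half by (intro PL2_glue PL2_id) auto
  then have l: "?l \<in> PLc_derived"
  proof (rule D[of 0, rotated])
    show "?l y = h y" if "y \<in> {0/2..(0+1)/2}" for y
    proof (cases "y = 1/2")
      case True
      show ?thesis unfolding True h_half by simp
    qed (use that in auto)
    show "?l y = y" if "y \<notin> {0/2..(0+1)/2}" for y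
      using that support_inD(2)[OF hu, of y] by auto
  qed simp
  have "?r \<in> PL2" using h h_half by (intro PL2_glue PL2_id) auto
  then have r: "?r \<in> PLc_derived"
  proof (rule D[of 1, rotated])
    show "?r y = h y" if "y \<in> {1/2..(1+1)/2}" for y
      using that by auto
    show "?r y = y" if "y \<notin> {1/2..(1+1)/2}" for y
      using that support_inD(2)[OF hu, of y] by auto
  qed simp
  have "?l \<circ> ?r = h"
    using PL2_less_iff[OF h, of _ "1/2"] h_half by (auto simp: fun_eq_iff)
  then have hD: "h \<in> PLc_derived" using PLc_derived_compose[OF l r] by simp
  have f: "f = PL2_inv g \<circ> h"
    using PL2_inv_inverts(1)[OF PLc_derivedD[OF g(2)]] by (simp add: h_def fun_eq_iff)
  show ?case unfolding f by (rule PLc_derived_compose[OF PLc_derived_inv[OF g(2)] hD])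
qed

text \<open>Near each point \<open>f\<close> is given by formulas \<open>2 powi s * y + c\<close> with \<open>c\<close> dyadic. Such a formula takes
  standard intervals of length \<open>1 / 2 ^ k\<close> to intervals \<open>[j / 2 ^ n, (j + 1) / 2 ^ n]\<close> with
  \<open>n = k - s\<close>, as soon as \<open>c\<close> is a multiple of \<open>1 / 2 ^ n\<close>. Compactness makes one \<open>k\<close> suffice.\<close>

lemma PLu_carries_mesh:
  assumes "f \<in> PLu"
  shows "\<exists>k. \<forall>i<2 ^ k. carries f (real i / 2 ^ k) ((real i + 1) / 2 ^ k)"
proof -
  define M where "M k i = {real i / 2 ^ k..(real i + 1) / 2 ^ k}" for k i :: nat
  \<comment> \<open>All mesh intervals that merely meet \<open>[a, b]\<close> are considered. An interval straddling a common
    endpoint then causes no trouble when two instances of \<open>P\<close> are joined.\<close>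
  define P where "P a b \<longleftrightarrow> (\<exists>K. \<forall>k\<ge>K. \<forall>i<2 ^ k. M k i \<inter> {a..b} \<noteq> {} \<longrightarrow>
      carries f (real i / 2 ^ k) ((real i + 1) / 2 ^ k))" for a b :: real
  have fPL: "f \<in> PL2" using support_inD(1)[OF assms] .
  have affine: "\<exists>K. \<forall>k\<ge>K. \<forall>i<2 ^ k. (\<forall>y\<in>M k i. f y = 2 powi s * y + c) \<longrightarrow>
      carries f (real i / 2 ^ k) ((real i + 1) / 2 ^ k)" if c: "c \<in> \<D>" for s c
  proof -
    obtain K where K: "\<And>k. k \<ge> K \<Longrightarrow> c * 2 ^ k \<in> \<int>" using dyadic_eventually_Ints[OF c] by auto
    have "carries f (real i / 2 ^ k) ((real i + 1) / 2 ^ k)"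
      if k: "k \<ge> K + nat \<bar>s\<bar>" and i: "i < 2 ^ k" and eq: "\<forall>y\<in>M k i. f y = 2 powi s * y + c" for k i
    proof -
      define n where "n = nat (int k - s)"
      have n: "int n = int k - s" "n \<ge> K" using k by (auto simp: n_def)
      obtain j where j: "c * 2 ^ n = of_int j" using K[OF n(2)] by (rule Ints_cases)
      have s: "(2::real) powi s = 2 ^ k / 2 ^ n"
        using n(1) by (simp flip: power_int_diff power_int_of_nat add: power_int_diff[symmetric])
      have ends: "2 powi s * (real i / 2 ^ k) + c = (real i + of_int j) / 2 ^ n"
        "2 powi s * ((real i + 1) / 2 ^ k) + c = (real i + of_int j + 1) / 2 ^ n"
        using j by (simp_all add: s field_simps)
      have lt: "real i / 2 ^ k < (real i + 1) / 2 ^ k" by (simp add: divide_strict_right_mono)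
      then have f_ends: "f (real i / 2 ^ k) = (real i + of_int j) / 2 ^ n"
        "f ((real i + 1) / 2 ^ k) = (real i + of_int j + 1) / 2 ^ n"
        using eq ends by (auto simp: M_def)
      have b: "0 \<le> real i / 2 ^ k" "(real i + 1) / 2 ^ k \<le> 1"
        using std_dyadic_bounds[OF std_dyadic_mesh[OF i]] by auto
      have "f 0 = 0" "f 1 = 1" using support_inD(2)[OF assms] by auto
      then have "0 \<le> (real i + of_int j) / 2 ^ n" "(real i + of_int j + 1) / 2 ^ n \<le> 1"
        using b PL2_le_iff[OF fPL, of 0 "real i / 2 ^ k"] PL2_le_iff[OF fPL, of "(real i + 1) / 2 ^ k" 1]
        by (auto simp flip: f_ends)
      then have "0 \<le> real_of_int (int i + j)" "real_of_int (int i + j + 1) \<le> real_of_int (2 ^ n)"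
        by (simp_all add: field_simps)
      then have ij: "0 \<le> int i + j" "int i + j + 1 \<le> 2 ^ n"
        unfolding of_int_le_iff of_int_0_le_iff by blast+
      define q where "q = nat (int i + j)"
      have q: "int q = int i + j" using ij(1) by (simp add: q_def)
      have "int q < int (2 ^ n)" using ij(2) q by simp
      then have "q < 2 ^ n" by (simp only: of_nat_less_iff)
      moreover have "real q = real i + of_int j" using q by (metis of_int_add of_int_of_nat_eq)
      ultimately have "std_dyadic ((real i + of_int j) / 2 ^ n) ((real i + of_int j + 1) / 2 ^ n)"
        using std_dyadic_mesh[of q n] by simp
      then have "std_dyadic (2 powi s * (real i / 2 ^ k) + c) (2 powi s * ((real i + 1) / 2 ^ k) + c)"
        unfolding ends .
      then show ?thesis using eq lt
        by (intro carries_affine[where s = "2 powi s" and c = c]) (simp_all add: M_def)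
    qed
    then show ?thesis by blast
  qed
  have "P 0 1"
  proof (rule Bolzano)
    fix a b c assume P: "P a b" "P b c" and le: "a \<le> b" "b \<le> c"
    then obtain K1 K2 where
      K1: "\<forall>k\<ge>K1. \<forall>i<2 ^ k. M k i \<inter> {a..b} \<noteq> {} \<longrightarrow> carries f (real i / 2 ^ k) ((real i + 1) / 2 ^ k)" and
      K2: "\<forall>k\<ge>K2. \<forall>i<2 ^ k. M k i \<inter> {b..c} \<noteq> {} \<longrightarrow> carries f (real i / 2 ^ k) ((real i + 1) / 2 ^ k)"
      unfolding P_def by blast
    have un: "{a..c} = {a..b} \<union> {b..c}" using le by auto
    have "\<forall>k\<ge>max K1 K2. \<forall>i<2 ^ k. M k i \<inter> {a..c} \<noteq> {} \<longrightarrow> carries f (real i / 2 ^ k) ((real i + 1) / 2 ^ k)"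
    proof (intro allI impI)
      fix k i :: nat assume ki: "max K1 K2 \<le> k" "i < 2 ^ k" "M k i \<inter> {a..c} \<noteq> {}"
      have "M k i \<inter> {a..b} \<noteq> {} \<or> M k i \<inter> {b..c} \<noteq> {}" using ki(3) unfolding un by blast
      moreover have "K1 \<le> k" "K2 \<le> k" using ki(1) by auto
      ultimately show "carries f (real i / 2 ^ k) ((real i + 1) / 2 ^ k)" using K1 K2 ki(2) by blast
    qed
    then show "P a c" unfolding P_def by blast
  next
    fix x :: real
    obtain k l where kl: "has_slopes f x l k" "f x - 2 powi k * x \<in> \<D>" "x \<notin> \<D> \<Longrightarrow> k = l"
      using PL2_dpl_at[OF fPL] by (rule dpl_atE) blast
    obtain d where d: "d > 0" "\<And>y. dist y x < d \<Longrightarrow> f y = f x + 2 powi (if y < x then l else k) * (y - x)"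
      using kl(1) unfolding has_slopes_def eventually_nhds_metric by blast
    have l: "f x - 2 powi l * x \<in> \<D>"
    proof (cases "x \<in> \<D>")
      case True
      then have "f x \<in> \<D>" using dyadic_add[OF kl(2), of "2 powi k * x"] by simp
      then show ?thesis using True by auto
    qed (use kl in auto)
    obtain K1 where K1: "\<And>m i. m \<ge> K1 \<Longrightarrow> i < 2 ^ m \<Longrightarrow> (\<And>y. y \<in> M m i \<Longrightarrow> f y = 2 powi k * y + (f x - 2 powi k * x)) \<Longrightarrow>
      carries f (real i / 2 ^ m) ((real i + 1) / 2 ^ m)" using affine[OF kl(2)] by blast
    obtain K2 where K2: "\<And>m i. m \<ge> K2 \<Longrightarrow> i < 2 ^ m \<Longrightarrow> (\<And>y. y \<in> M m i \<Longrightarrow> f y = 2 powi l * y + (f x - 2 powi l * x)) \<Longrightarrow>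
      carries f (real i / 2 ^ m) ((real i + 1) / 2 ^ m)" using affine[OF l] by blast
    obtain K3 where K3: "x \<in> \<D> \<Longrightarrow> m \<ge> K3 \<Longrightarrow> x * 2 ^ m \<in> \<int>" for m
      using dyadic_eventually_Ints by metis
    obtain K4 where K4: "1 / 2 ^ K4 < d / 2"
      using real_arch_pow_inv[of "d / 2" "1/2"] d(1) by (auto simp: power_one_over)
    have "P a b" if ab: "a \<le> x" "x \<le> b" "b - a < d / 2" for a b
    proof -
      have "carries f (real i / 2 ^ m) ((real i + 1) / 2 ^ m)"
        if m: "m \<ge> K1 + K2 + K3 + K4" and i: "i < 2 ^ m" and int: "M m i \<inter> {a..b} \<noteq> {}" for m i
      proof -
        have "1 / 2 ^ m \<le> (1 / 2 ^ K4 :: real)" using m by (intro divide_left_mono power_increasing) auto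
        then have w: "1 / 2 ^ m < d / 2" using K4 by linarith
        have near: "dist y x < d" if "y \<in> M m i" for y
        proof -
          obtain z where z: "z \<in> M m i" "z \<in> {a..b}" using int by blast
          have "\<bar>y - z\<bar> \<le> 1 / 2 ^ m" using that z(1) by (auto simp: M_def add_divide_distrib)
          moreover have "\<bar>z - x\<bar> \<le> b - a" using z(2) ab by (simp add: abs_le_iff)
          ultimately show ?thesis using w ab(3) unfolding dist_real_def by linarith
        qed
        consider "(real i + 1) / 2 ^ m \<le> x" | "x \<le> real i / 2 ^ m" | "real i / 2 ^ m < x" "x < (real i + 1) / 2 ^ m"
          by linarith
        then show ?thesis
        proof cases
          case 1
          have "f y = 2 powi l * y + (f x - 2 powi l * x)" if "y \<in> M m i" for y
            using d(2)[OF near[OF that]] that 1 by (cases "y = x") (auto simp: M_def algebra_simps)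
          then show ?thesis using m i by (intro K2) auto
        next
          case 2
          have "f y = 2 powi k * y + (f x - 2 powi k * x)" if "y \<in> M m i" for y
            using d(2)[OF near[OF that]] that 2 by (auto simp: M_def algebra_simps)
          then show ?thesis using m i by (intro K1) auto
        next
          \<comment> \<open>An interval of a fine mesh with \<open>x\<close> in its interior: then \<open>x\<close> is not dyadic, and one formula is
            valid on both sides.\<close>
          case 3
          have "x * 2 ^ m \<notin> \<int>"
          proof
            assume "x * 2 ^ m \<in> \<int>"
            then obtain j where j: "x * 2 ^ m = of_int j" by (rule Ints_cases)
            have "real_of_int (int i) < of_int j" "of_int j < real_of_int (int i + 1)"
              using 3 by (simp_all add: field_simps flip: j)
            then show False unfolding of_int_less_iff by linarith
          qed
          moreover have "K3 \<le> m" using m by simp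
          ultimately have kl_eq: "k = l" using K3[of m] kl(3) by blast
          have "f y = 2 powi k * y + (f x - 2 powi k * x)" if "y \<in> M m i" for y
            using d(2)[OF near[OF that]] unfolding kl_eq if_cancel by (simp add: algebra_simps)
          then show ?thesis using m i by (intro K1) auto
        qed
      qed
      then show ?thesis unfolding P_def by blast
    qed
    then show "\<exists>d>0. \<forall>a b. a \<le> x \<and> x \<le> b \<and> b - a < d \<longrightarrow> P a b"
      using d(1) by (intro exI[of _ "d/2"]) auto
  qed simp
  then obtain K where K: "\<And>i. i < 2 ^ K \<Longrightarrow> M K i \<inter> {0..1} \<noteq> {} \<Longrightarrow> carries f (real i / 2 ^ K) ((real i + 1) / 2 ^ K)"
    unfolding P_def by blast
  have "carries f (real i / 2 ^ K) ((real i + 1) / 2 ^ K)" if i: "i < 2 ^ K" for i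
  proof (rule K[OF i])
    have "real i / 2 ^ K \<in> M K i \<inter> {0..1}"
      using std_dyadic_bounds[OF std_dyadic_mesh[OF i]] by (auto simp: M_def)
    then show "M K i \<inter> {0..1} \<noteq> {}" by blast
  qed
  then show ?thesis by blast
qed

text \<open>A compactly supported element is conjugate, by a scaling and a translation, to one supported in the
  unit interval.\<close>

theorem PLc_perfect: "PLc_derived = PLc"
proof
  show "PLc_derived \<subseteq> PLc" by (rule PLc_derived_subset)
  show "PLc \<subseteq> PLc_derived"
  proof
    fix f assume f: "f \<in> PLc"
    then obtain c d where cd: "c \<le> d" "f \<in> support_in {c..d}" by (rule compact_support_inE)
    obtain j :: nat where j: "\<bar>c\<bar> + \<bar>d\<bar> < 2 ^ j" using real_arch_pow[of 2 "\<bar>c\<bar> + \<bar>d\<bar>"] by auto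
    \<comment> \<open>This maps the interval from \<open>- (2 ^ j)\<close> to \<open>2 ^ j\<close> onto the unit interval.\<close>
    define g where "g = (\<lambda>y. 2 powi (- int (Suc j)) * y + 1/2 :: real)"
    have g: "g \<in> PL2" unfolding g_def by (rule PL2_affine) simp
    have g_eq: "g z = z / 2 ^ j / 2 + 1/2" for z
      unfolding g_def power_int_minus power_int_of_nat by (simp add: field_simps)
    let ?f = "g \<circ> f \<circ> PL2_inv g"
    have "?f \<in> PL2" using PLc_conj[OF f g] by (rule PLcD)
    moreover have "?f y = y" if "y \<notin> {0<..<1}" for y
    proof -
      define z where "z = PL2_inv g y"
      have y: "g z = y" using PL2_inv_inverts(2)[OF g, of y] by (simp add: z_def)
      have "z \<notin> {c..d}"
      proof
        assume "z \<in> {c..d}"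
        then have "\<bar>z\<bar> < 2 ^ j" using j by auto
        then have "\<bar>z / 2 ^ j\<bar> < 1" by (simp add: abs_divide)
        moreover have "0 < w / 2 + 1/2 \<and> w / 2 + 1/2 < 1" if "\<bar>w\<bar> < 1" for w :: real
          using that by linarith
        ultimately have "0 < y \<and> y < 1" unfolding y[symmetric] g_eq by blast
        then show False using that by auto
      qed
      then have "f z = z" using support_inD(2)[OF cd(2)] by simp
      then show ?thesis using y by (simp add: z_def)
    qed
    ultimately have "?f \<in> PLu" by (simp add: support_in_def)
    then have "?f \<in> PLc_derived" using PLu_carries_mesh PLu_carrying_mesh_derived by blast
    from PLc_derived_conj[OF this PL2_inv_inverts(3)[OF g]]
    have "PL2_inv g \<circ> ?f \<circ> PL2_inv (PL2_inv g) \<in> PLc_derived" .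
    moreover have "PL2_inv g \<circ> ?f \<circ> PL2_inv (PL2_inv g) = f"
      using PL2.inv_inv[of g] g PL2_inv_inverts(1)[OF g] by (simp add: fun_eq_iff)
    ultimately show "f \<in> PLc_derived" by (simp only:)
  qed
qed

section \<open>Compactly supported groups on different intervals are isomorphic\<close>

text \<open>An auxiliary sequence \<open>s\<close> approaches both ends harmonically; a dyadic number is chosen between any
  two consecutive terms.\<close>

lemma dyadic_bi_infinite_sequence:
  assumes "(a::real) < b"
  obtains d :: "int \<Rightarrow> real" where "strict_mono d" "\<And>n. d n \<in> \<D>" "\<And>n. a < d n" "\<And>n. d n < b"
    "\<And>y. a < y \<Longrightarrow> \<exists>n. d n < y" "\<And>y. y < b \<Longrightarrow> \<exists>n. y < d n"
proof -
  define s where "s n = (if n \<ge> 0 then b - (b - a) / (of_int n + 2) else a + (b - a) / (2 - of_int n))"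
    for n :: int
  have ba: "b - a > 0" using assms by simp
  have frac: "0 < (b - a) / q \<and> (b - a) / q < b - a" if q: "q > 1" for q
  proof
    show "0 < (b - a) / q" by (rule divide_pos_pos[OF ba]) (use q in linarith)
    show "(b - a) / q < b - a" using divide_strict_left_mono[OF q ba] q by simp
  qed
  have s: "a < s n \<and> s n < b" for n
  proof (cases "n \<ge> 0")
    case True
    then have "of_int n + 2 > (1::real)" by simp
    from frac[OF this] show ?thesis using True unfolding s_def by (simp only: if_True) linarith
  next
    case False
    then have "2 - of_int n > (1::real)" by simp
    from frac[OF this] show ?thesis using False unfolding s_def by (simp only: if_False) linarith
  qed
  have s_step: "s n < s (n + 1)" for n
  proof -
    consider "n \<ge> 0" | "n = -1" | "n < -1" by linarith
    then show ?thesis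
    proof cases
      case 1
      have "(b - a) / (of_int (n + 1) + 2) < (b - a) / (of_int n + 2)"
        using ba 1 by (intro divide_strict_left_mono) auto
      moreover have "s n = b - (b - a) / (of_int n + 2)"
          "s (n + 1) = b - (b - a) / (of_int (n + 1) + 2)"
        using 1 by (simp_all add: s_def)
      ultimately show ?thesis by linarith
    next
      case 2
      then show ?thesis using ba by (simp add: s_def field_simps)
    next
      case 3
      have "(b - a) / (2 - of_int n) < (b - a) / (2 - of_int (n + 1))"
        using ba 3 by (intro divide_strict_left_mono) (auto intro!: mult_pos_pos)
      moreover have "s n = a + (b - a) / (2 - of_int n)"
          "s (n + 1) = a + (b - a) / (2 - of_int (n + 1))"
        using 3 by (simp_all add: s_def)
      ultimately show ?thesis by linarith
    qed
  qed
  have "\<exists>q. q \<in> \<D> \<and> s n < q \<and> q < s (n + 1)" for n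
    by (rule dyadic_dense[OF s_step[of n]]) blast
  then have "\<exists>d. \<forall>n. d n \<in> \<D> \<and> s n < d n \<and> d n < s (n + 1)" by (intro choice allI)
  then obtain d where d: "\<And>n. d n \<in> \<D>" "\<And>n. s n < d n" "\<And>n. d n < s (n + 1)" by blast
  show thesis
  proof (rule that)
    have step: "d n < d (n + 1)" for n using d(2)[of "n + 1"] d(3)[of n] by linarith
    have "d m < d (m + int (Suc k))" for m k
    proof (induction k)
      case 0
      then show ?case using step[of m] by simp
    next
      case (Suc k)
      then show ?case using step[of "m + int (Suc k)"] by (simp add: algebra_simps)
    qed
    then show "strict_mono d"
      by (intro strict_monoI) (auto simp: zless_iff_Suc_zadd)
    show "d n \<in> \<D>" "a < d n" "d n < b" for n using d[of n] s[of n] s[of "n + 1"] by auto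
    show "\<exists>n. d n < y" if "a < y" for y
    proof -
      obtain m :: nat where m: "(b - a) / (y - a) < m" using reals_Archimedean2 by blast
      have "(b - a) / (real m + 3) < y - a"
        using that ba m by (simp add: field_simps)
      then have "s (- int m - 1) < y" by (simp add: s_def add_ac)
      moreover have "d (- int m - 2) < s (- int m - 1)" 
      proof -
        have "- int m - 2 + 1 = - int m - 1" by simp
        then show ?thesis using d(3)[of "- int m - 2"] by (simp only:)
      qed
      ultimately show ?thesis by (meson less_trans)
    qed
    show "\<exists>n. y < d n" if "y < b" for y
    proof -
      obtain m :: nat where m: "(b - a) / (b - y) < m" using reals_Archimedean2 by blast
      have "(b - a) / (real m + 2) < b - y"
        using that ba m by (simp add: field_simps)
      then have "y < s (int m)" by (simp add: s_def)
      then show ?thesis using d(2)[of "int m"] by (meson less_trans)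
    qed
  qed
qed

text \<open>Interpolation maps \<open>[n, n + 1]\<close> onto \<open>[d n, d (n + 1)]\<close> for every integer \<open>n\<close>, and the pieces fit
  together. Although the chart has infinitely many break points, only finitely many meet a given
  compact set.\<close>

lemma dyadic_chart:
  assumes "(a::real) < b"
  obtains \<theta> where "strict_mono \<theta>" "range \<theta> = {a<..<b}" "\<And>x. dpl_at \<theta> x"
proof -
  obtain d :: "int \<Rightarrow> real" where d: "strict_mono d" "\<And>n. d n \<in> \<D>" "\<And>n. a < d n" "\<And>n. d n < b"
    "\<And>y. a < y \<Longrightarrow> \<exists>n. d n < y" "\<And>y. y < b \<Longrightarrow> \<exists>n. y < d n"
    using dyadic_bi_infinite_sequence[OF assms] by metis
  have "\<exists>g\<in>PL2. g (of_int n) = d n \<and> g (of_int (n + 1)) = d (n + 1)" for n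
    using d(1,2) by (intro PL2_interpolation) (auto simp: strict_mono_less)
  then obtain g where g: "\<And>n. g n \<in> PL2" "\<And>n. g n (of_int n) = d n" "\<And>n. g n (of_int (n + 1)) = d (n + 1)"
    by metis
  define \<theta> where "\<theta> x = g \<lfloor>x\<rfloor> x" for x
  have bounds: "d \<lfloor>x\<rfloor> \<le> \<theta> x" "\<theta> x < d (\<lfloor>x\<rfloor> + 1)" for x
    using PL2_le_iff[OF g(1), of "\<lfloor>x\<rfloor>" "of_int \<lfloor>x\<rfloor>" x] PL2_less_iff[OF g(1), of "\<lfloor>x\<rfloor>" x "of_int (\<lfloor>x\<rfloor> + 1)"]
      g(2)[of "\<lfloor>x\<rfloor>"] g(3)[of "\<lfloor>x\<rfloor>"] by (auto simp: \<theta>_def)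
  show thesis
  proof (rule that)
    show "strict_mono \<theta>"
    proof (rule strict_monoI)
      fix x y :: real assume xy: "x < y"
      show "\<theta> x < \<theta> y"
      proof (cases "\<lfloor>x\<rfloor> = \<lfloor>y\<rfloor>")
        case True
        then show ?thesis using xy PL2_less_iff[OF g(1)] by (simp add: \<theta>_def)
      next
        case False
        then have "\<lfloor>x\<rfloor> + 1 \<le> \<lfloor>y\<rfloor>" using xy floor_mono[of x y] by linarith
        then have "d (\<lfloor>x\<rfloor> + 1) \<le> d \<lfloor>y\<rfloor>" using d(1) by (simp add: strict_mono_less_eq)
        then show ?thesis using bounds[of x] bounds[of y] by linarith
      qed
    qed
    show "range \<theta> = {a<..<b}"
    proof
      have "a < \<theta> x" "\<theta> x < b" for x
        using d(3)[of "\<lfloor>x\<rfloor>"] d(4)[of "\<lfloor>x\<rfloor> + 1"] bounds[of x] by linarith+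
      then show "range \<theta> \<subseteq> {a<..<b}" by auto
      show "{a<..<b} \<subseteq> range \<theta>"
      proof
        fix y assume "y \<in> {a<..<b}"
        then obtain m n where m: "d m < y" and n: "y < d n" using d(5)[of y] d(6)[of y] by auto
        define P where "P k \<longleftrightarrow> d (m + int k) \<le> y" for k :: nat
        have "P 0" using m by (simp add: P_def)
        have mn: "m < n" using m n d(1) by (meson less_trans strict_mono_less)
        have "\<not> P (nat (n - m))" using n mn by (simp add: P_def)
        have "\<exists>k. P k \<and> \<not> P (Suc k)"
        proof (rule ccontr)
          assume "\<nexists>k. P k \<and> \<not> P (Suc k)"
          then have "P k" for k using \<open>P 0\<close> by (induction k) auto
          then show False using \<open>\<not> P (nat (n - m))\<close> by blast
        qed
        then obtain k where k: "P k" "\<not> P (Suc k)" by blast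
        define i where "i = m + int k"
        have i: "d i \<le> y" "y < d (i + 1)" using k by (auto simp: P_def i_def algebra_simps)
        obtain x where x: "g i x = y" using PL2_surj[OF g(1)[of i]] by (metis surjD)
        have "of_int i \<le> x" "x < of_int (i + 1)"
          using i g(2)[of i] g(3)[of i] PL2_le_iff[OF g(1)[of i], of "of_int i" x]
            PL2_less_iff[OF g(1)[of i], of x "of_int (i + 1)"] x by auto
        then have "\<lfloor>x\<rfloor> = i" by (simp add: floor_eq_iff)
        then have "\<theta> x = y" using x by (simp add: \<theta>_def)
        then show "y \<in> range \<theta>" by blast
      qed
    qed
    show "dpl_at \<theta> x" for x
    proof (cases "x \<in> \<int>")
      case True
      then obtain n where n: "x = of_int n" by (rule Ints_cases)
      have "x \<in> {of_int (n - 1)<..<of_int (n + 1)}" by (simp add: n)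
      then have "\<forall>\<^sub>F y in nhds x. y \<in> {of_int (n - 1)<..<of_int (n + 1)}"
        by (rule eventually_nhds_in_open[OF open_greaterThanLessThan])
      then have "\<forall>\<^sub>F y in nhds x. (if y < x then g (n - 1) y else g n y) = \<theta> y"
      proof eventually_elim
        case (elim y)
        have "\<lfloor>y\<rfloor> = (if y < x then n - 1 else n)"
          using elim by (auto simp: n floor_eq_iff)
        then show ?case by (simp add: \<theta>_def)
      qed
      moreover have "dpl_at (\<lambda>y. if y < x then g (n - 1) y else g n y) x"
        using g(3)[of "n - 1"] g(2)[of n] True
        by (intro dpl_at_glue PL2_dpl_at g(1) dyadic_Ints) (auto simp: n)
      ultimately show ?thesis by (rule dpl_at_cong)
    next
      case False
      then have "of_int \<lfloor>x\<rfloor> \<noteq> x" by (metis Ints_of_int)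
      then have "x \<in> {of_int \<lfloor>x\<rfloor><..<of_int (\<lfloor>x\<rfloor> + 1)}"
        using of_int_floor_le[of x] floor_correct[of x] by (auto simp: less_le)
      then have "\<forall>\<^sub>F y in nhds x. y \<in> {of_int \<lfloor>x\<rfloor><..<of_int (\<lfloor>x\<rfloor> + 1)}"
        by (rule eventually_nhds_in_open[OF open_greaterThanLessThan])
      then have "\<forall>\<^sub>F y in nhds x. g \<lfloor>x\<rfloor> y = \<theta> y"
      proof eventually_elim
        case (elim y)
        then have "\<lfloor>y\<rfloor> = \<lfloor>x\<rfloor>" by (auto simp: floor_eq_iff)
        then show ?case by (simp add: \<theta>_def)
      qed
      then show ?thesis using PL2_dpl_at[OF g(1)] by (rule dpl_at_cong)
    qed
  qed
qed

definition transport :: "(real \<Rightarrow> real) \<Rightarrow> (real \<Rightarrow> real) \<Rightarrow> real \<Rightarrow> real" where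
  "transport \<theta> f y = (if y \<in> range \<theta> then \<theta> (f (inv_into UNIV \<theta> y)) else y)"

locale chart =
  fixes \<theta> :: "real \<Rightarrow> real" and a b :: real
  assumes ab: "a < b" and mono: "strict_mono \<theta>" and range: "range \<theta> = {a<..<b}"
    and dpl: "dpl_at \<theta> x"
begin

abbreviation \<eta> :: "real \<Rightarrow> real" where "\<eta> \<equiv> inv_into UNIV \<theta>"

lemma \<eta>_\<theta> [simp]: "\<eta> (\<theta> x) = x"
  using mono by (simp add: strict_mono_imp_inj_on)

lemma \<theta>_\<eta> [simp]: "a < y \<Longrightarrow> y < b \<Longrightarrow> \<theta> (\<eta> y) = y"
  using range by (intro f_inv_into_f) auto

lemma \<theta>_bounds [simp]: "a < \<theta> x" "\<theta> x < b"
  using range by auto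

lemma \<theta>_between: assumes "\<theta> c \<le> y" "y \<le> \<theta> d" shows "y \<in> {a<..<b}"
  using less_le_trans[OF \<theta>_bounds(1) assms(1)] le_less_trans[OF assms(2) \<theta>_bounds(2)] by simp

lemma \<theta>_cases: assumes "a < y" "y < b" obtains x where "y = \<theta> x"
  using assms \<theta>_\<eta> by metis

lemma dpl_at_\<eta>: "dpl_at \<eta> (\<theta> x)"
proof (rule dpl_at_inverse[OF mono dpl \<eta>_\<theta>])
  have "\<theta> x \<in> {a<..<b}" by simp
  then have "\<forall>\<^sub>F w in nhds (\<theta> x). w \<in> {a<..<b}"
    by (rule eventually_nhds_in_open[OF open_greaterThanLessThan])
  then show "\<forall>\<^sub>F w in nhds (\<theta> x). \<theta> (\<eta> w) = w" by eventually_elim simp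
qed

lemma transport_\<theta> [simp]: "transport \<theta> f (\<theta> x) = \<theta> (f x)"
  by (simp add: transport_def)

lemma transport_outside: "y \<notin> {a<..<b} \<Longrightarrow> transport \<theta> f y = y"
  by (simp add: transport_def range del: greaterThanLessThan_iff)

text \<open>Outside the image of the compact support of \<open>f\<close> the transported map is the identity. This takes
  care of the endpoints of the interval, where the chart has no germ.\<close>

lemma transport_in:
  assumes "f \<in> PLc" shows "transport \<theta> f \<in> compact_support_in {a<..<b}"
proof -
  obtain c d where cd: "c \<le> d" "f \<in> support_in {c..d}" using assms by (rule compact_support_inE)
  note f = support_inD[OF cd(2)]
  let ?T = "transport \<theta> f"
  have fixed: "?T y = y" if "y \<notin> {\<theta> c..\<theta> d}" for y
  proof (cases "y \<in> {a<..<b}")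
    case True
    then obtain x where x: "y = \<theta> x" using \<theta>_cases by auto
    then have "x \<notin> {c..d}" using that mono by (auto simp: strict_mono_less_eq)
    then show ?thesis using x f(2) by simp
  qed (rule transport_outside)
  have inside: "?T y \<in> {a<..<b} \<longleftrightarrow> y \<in> {a<..<b}" for y
  proof (cases "y \<in> {a<..<b}")
    case True
    then obtain x where x: "y = \<theta> x" using \<theta>_cases by auto
    then show ?thesis by simp
  qed (simp add: transport_outside)
  have "strict_mono ?T"
  proof (rule strict_monoI)
    fix y z :: real assume yz: "y < z"
    show "?T y < ?T z"
    proof (cases "y \<in> {a<..<b} \<and> z \<in> {a<..<b}")
      case True
      then obtain v w where "y = \<theta> v" "z = \<theta> w" using \<theta>_cases by (metis greaterThanLessThan_iff)
      then show ?thesis using yz mono PL2_less_iff[OF f(1)] by (simp add: strict_mono_less)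
    next
      case False
      then consider "y \<notin> {a<..<b}" "z \<notin> {a<..<b}" | "y \<in> {a<..<b}" "b \<le> z" | "y \<le> a" "z \<in> {a<..<b}"
        using yz by force
      then show ?thesis
        using yz inside[of y] inside[of z] by cases (auto simp: transport_outside)
    qed
  qed
  moreover have "\<exists>x. y = ?T x" for y
  proof (cases "y \<in> {a<..<b}")
    case True
    then obtain x where x: "y = \<theta> x" using \<theta>_cases by auto
    have "y = ?T (\<theta> (PL2_inv f x))" using PL2_inv_inverts(2)[OF f(1)] by (simp add: x)
    then show ?thesis by blast
  next
    case False
    then show ?thesis using transport_outside by metis
  qed
  then have "surj ?T" unfolding surj_def by blast
  moreover have "dpl_at ?T y" for y
  proof (cases "y \<in> {\<theta> c..\<theta> d}")
    case True
    then have "y \<in> {a<..<b}" using \<theta>_between[of c y d] by simp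
    then obtain x where x: "y = \<theta> x" using \<theta>_cases by auto
    have "\<forall>\<^sub>F z in nhds y. z \<in> {a<..<b}"
      using \<open>y \<in> {a<..<b}\<close> by (rule eventually_nhds_in_open[OF open_greaterThanLessThan])
    then have "\<forall>\<^sub>F z in nhds y. (\<theta> \<circ> (f \<circ> \<eta>)) z = ?T z"
      by eventually_elim (simp add: transport_def range)
    moreover have "dpl_at (\<theta> \<circ> (f \<circ> \<eta>)) y"
      using dpl_at_\<eta>[of x] PL2_dpl_at[OF f(1)] dpl by (intro dpl_at_compose) (simp_all add: x)
    ultimately show ?thesis by (rule dpl_at_cong)
  next
    case False
    have "\<forall>\<^sub>F z in nhds y. z \<in> - {\<theta> c..\<theta> d}"
      using False by (intro eventually_nhds_in_open open_Compl) auto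
    then have "\<forall>\<^sub>F z in nhds y. id z = ?T z" by eventually_elim (simp add: fixed)
    then show ?thesis using PL2_dpl_at[OF PL2_id] by (rule dpl_at_cong)
  qed
  ultimately have "?T \<in> PL2" by (rule PL2_I)
  then have "?T \<in> support_in {\<theta> c..\<theta> d}" using fixed by (simp add: support_in_def)
  moreover have "\<theta> c \<le> \<theta> d" using cd(1) mono by (simp add: strict_mono_less_eq)
  moreover have "{\<theta> c..\<theta> d} \<subseteq> {a<..<b}" using \<theta>_between by auto
  ultimately show ?thesis by (intro compact_support_inI)
qed

lemma transport_surj:
  assumes "g \<in> compact_support_in {a<..<b}" shows "\<exists>f\<in>PLc. transport \<theta> f = g"
proof -
  obtain c d where cd: "c \<le> d" "{c..d} \<subseteq> {a<..<b}" "g \<in> support_in {c..d}"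
    using assms by (rule compact_support_inE)
  note g = support_inD[OF cd(3)]
  note gPL = g(1)
  have "c \<in> {c..d}" "d \<in> {c..d}" using cd(1) by auto
  then have "c \<in> {a<..<b}" "d \<in> {a<..<b}" using cd(2) by blast+
  then obtain c' d' where c': "c = \<theta> c'" and d': "d = \<theta> d'" using \<theta>_cases by (metis greaterThanLessThan_iff)
  have g_in: "g (\<theta> x) \<in> {a<..<b}" for x
  proof -
    have "g \<in> support_in {a<..<b}" using cd(2,3) support_in_mono by blast
    from support_in_maps[OF this] show ?thesis by simp
  qed
  define f where "f x = \<eta> (g (\<theta> x))" for x
  have f: "\<theta> (f x) = g (\<theta> x)" for x using g_in[of x] by (simp add: f_def)
  have "strict_mono f"
  proof (rule strict_monoI)
    fix x y :: real assume "x < y"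
    then have "\<theta> (f x) < \<theta> (f y)" unfolding f using mono PL2_less_iff[OF gPL] by (simp add: strict_mono_less)
    then show "f x < f y" using mono by (simp add: strict_mono_less)
  qed
  moreover have "\<exists>x. y = f x" for y
  proof -
    have "\<theta> y = g (PL2_inv g (\<theta> y))" using PL2_inv_inverts(2)[OF gPL] by simp
    moreover have "PL2_inv g (\<theta> y) \<in> {a<..<b}"
    proof -
      have "PL2_inv g \<in> support_in {a<..<b}"
        using subgroup.m_inv_closed[OF support_in_subgroup] cd(2,3) support_in_mono by blast
      from support_in_maps[OF this] show ?thesis by simp
    qed
    ultimately obtain x where "\<theta> y = g (\<theta> x)" using \<theta>_cases by (metis greaterThanLessThan_iff)
    then have "\<theta> y = \<theta> (f x)" by (simp add: f)
    then show ?thesis using mono by (auto simp: strict_mono_eq)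
  qed
  then have "surj f" unfolding surj_def by blast
  moreover have "dpl_at f x" for x
  proof -
    obtain z where z: "g (\<theta> x) = \<theta> z" using g_in[of x] \<theta>_cases by (metis greaterThanLessThan_iff)
    have "dpl_at (\<eta> \<circ> (g \<circ> \<theta>)) x"
      using dpl_at_\<eta>[of z] PL2_dpl_at[OF gPL] dpl by (intro dpl_at_compose) (simp_all add: z)
    moreover have "\<eta> \<circ> (g \<circ> \<theta>) = f" by (auto simp: f_def)
    ultimately show ?thesis by simp
  qed
  ultimately have "f \<in> PL2" by (rule PL2_I)
  moreover have "f x = x" if "x \<notin> {c'..d'}" for x
  proof -
    have "\<theta> x \<notin> {c..d}" using that mono by (auto simp: c' d' strict_mono_less_eq)
    then show ?thesis using g(2) by (simp add: f_def)
  qed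
  ultimately have "f \<in> support_in {c'..d'}" by (simp add: support_in_def)
  moreover have "c' \<le> d'" using cd(1) mono by (simp add: c' d' strict_mono_less_eq)
  ultimately have "f \<in> PLc" by (intro compact_support_inI) auto
  moreover have "transport \<theta> f y = g y" for y
  proof (cases "y \<in> {a<..<b}")
    case True
    then obtain x where "y = \<theta> x" using \<theta>_cases by auto
    then show ?thesis by (simp add: f)
  next
    case False
    then have "y \<notin> {c..d}" using cd(2) by blast
    then show ?thesis using g(2)[of y] transport_outside[OF False] by simp
  qed
  ultimately show ?thesis by blast
qed

lemma transport_iso:
  "transport \<theta> \<in> iso (PL2_group\<lparr>carrier := PLc\<rparr>) (PL2_group\<lparr>carrier := compact_support_in {a<..<b}\<rparr>)"
proof (rule isoI)
  show "transport \<theta> \<in> hom (PL2_group\<lparr>carrier := PLc\<rparr>) (PL2_group\<lparr>carrier := compact_support_in {a<..<b}\<rparr>)"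
  proof (rule homI)
    fix f g
    show "transport \<theta> (f \<otimes>\<^bsub>PL2_group\<lparr>carrier := PLc\<rparr>\<^esub> g) =
        transport \<theta> f \<otimes>\<^bsub>PL2_group\<lparr>carrier := compact_support_in {a<..<b}\<rparr>\<^esub> transport \<theta> g"
      by (auto simp: fun_eq_iff transport_def)
  qed (simp add: transport_in)
  have "inj (transport \<theta>)"
  proof (rule injI)
    fix f g assume "transport \<theta> f = transport \<theta> g"
    then have "\<theta> (f x) = \<theta> (g x)" for x using transport_\<theta> by metis
    then show "f = g" using mono by (auto simp: strict_mono_eq)
  qed
  then show "bij_betw (transport \<theta>) (carrier (PL2_group\<lparr>carrier := PLc\<rparr>))
      (carrier (PL2_group\<lparr>carrier := compact_support_in {a<..<b}\<rparr>))"
    using transport_in transport_surj inj_on_subset[of "transport \<theta>" UNIV PLc]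
    unfolding bij_betw_def by auto
qed

end

lemma compact_support_iso_PLc:
  assumes "a < b"
  shows "PL2_group\<lparr>carrier := PLc\<rparr> \<cong> PL2_group\<lparr>carrier := compact_support_in {a<..<b}\<rparr>"
proof -
  obtain \<theta> where "strict_mono \<theta>" "range \<theta> = {a<..<b}" "\<And>x. dpl_at \<theta> x"
    using dyadic_chart[OF assms] by blast
  then interpret chart \<theta> a b using assms by unfold_locales
  show ?thesis using transport_iso by (auto simp: is_iso_def)
qed

lemma compact_support_open_interval_subgroup:
  "a < b \<Longrightarrow> subgroup (compact_support_in {a<..<b}) PL2_group"
  by (rule compact_support_in_subgroup) auto

lemma compact_support_perfect:
  assumes "a < b"
  shows "derived PL2_group (compact_support_in {a<..<b}) = compact_support_in {a<..<b}"
proof -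
  let ?P = "PL2_group\<lparr>carrier := PLc\<rparr>" and ?K = "PL2_group\<lparr>carrier := compact_support_in {a<..<b}\<rparr>"
  obtain h where h: "h \<in> iso ?P ?K"
    using compact_support_iso_PLc[OF assms] by (auto simp: is_iso_def)
  note sub = compact_support_open_interval_subgroup[OF assms]
  interpret h: group_hom ?P ?K h
    using h PL2.subgroup_imp_group[OF PLc_subgroup] PL2.subgroup_imp_group[OF sub]
    by (simp add: group_hom_def group_hom_axioms_def iso_def)
  have img: "h ` PLc = compact_support_in {a<..<b}" using h by (auto simp: iso_def bij_betw_def)
  have "derived ?K (h ` PLc) = h ` derived ?P PLc" by (rule h.derived_img) simp
  also have "derived ?P PLc = PLc"
    using PL2.derived_consistent[OF order_refl PLc_subgroup] PLc_perfect by simp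
  finally show ?thesis unfolding img using PL2.derived_consistent[OF order_refl sub] by simp
qed

section \<open>One-sided slopes\<close>

text \<open>Only the values to the right of \<open>x\<close> enter, so this serves both for the uniqueness of the right
  slope and for comparing maps that agree on one side of \<open>x\<close>.\<close>

lemma has_slopes_right_unique:
  assumes "has_slopes f x l k" "has_slopes g x l' k'" "\<forall>\<^sub>F y in nhds x. x \<le> y \<longrightarrow> f y = g y"
  shows "k = k'"
proof -
  have fx: "f x = g x" using eventually_nhds_x_imp_x[OF assms(3)] by simp
  have "\<forall>\<^sub>F y in nhds x. x < y \<longrightarrow> 2 powi k * (y - x) = 2 powi k' * (y - x)"
    using assms unfolding has_slopes_def by eventually_elim (auto simp: fx)
  then obtain d where "d > 0" and d: "\<And>y. dist y x < d \<Longrightarrow> x < y \<longrightarrow> 2 powi k * (y - x) = 2 powi k' * (y - x)"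
    unfolding eventually_nhds_metric by blast
  then have "(2::real) powi k = 2 powi k'" using d[of "x + d/2"] by (simp add: dist_real_def)
  then show ?thesis
    using power_int_strict_increasing[of k k' "2::real"] power_int_strict_increasing[of k' k "2::real"]
    by (cases k k' rule: linorder_cases) auto
qed

lemma has_slopes_left_unique:
  assumes "has_slopes f x l k" "has_slopes g x l' k'" "\<forall>\<^sub>F y in nhds x. y \<le> x \<longrightarrow> f y = g y"
  shows "l = l'"
proof -
  have fx: "f x = g x" using eventually_nhds_x_imp_x[OF assms(3)] by simp
  have "\<forall>\<^sub>F y in nhds x. y < x \<longrightarrow> 2 powi l * (y - x) = 2 powi l' * (y - x)"
    using assms unfolding has_slopes_def by eventually_elim (auto simp: fx)
  then obtain d where "d > 0" and d: "\<And>y. dist y x < d \<Longrightarrow> y < x \<longrightarrow> 2 powi l * (y - x) = 2 powi l' * (y - x)"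
    unfolding eventually_nhds_metric by blast
  then have "(2::real) powi l = 2 powi l'" using d[of "x - d/2"] by (simp add: dist_real_def)
  then show ?thesis
    using power_int_strict_increasing[of l l' "2::real"] power_int_strict_increasing[of l' l "2::real"]
    by (cases l l' rule: linorder_cases) auto
qed

definition lslope :: "(real \<Rightarrow> real) \<Rightarrow> real \<Rightarrow> int" where
  "lslope f x = (THE l. \<exists>k. has_slopes f x l k)"

definition rslope :: "(real \<Rightarrow> real) \<Rightarrow> real \<Rightarrow> int" where
  "rslope f x = (THE k. \<exists>l. has_slopes f x l k)"

lemma slopes_eqI:
  assumes "has_slopes f x l k" shows "lslope f x = l" "rslope f x = k"
  unfolding lslope_def rslope_def using assms
  by (auto intro!: the_equality elim: has_slopes_left_unique has_slopes_right_unique)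

lemma PL2_has_slopes: "f \<in> PL2 \<Longrightarrow> has_slopes f x (lslope f x) (rslope f x)"
  using PL2_dpl_at[of f x] slopes_eqI by (auto elim!: dpl_atE)

lemma slopes_compose:
  assumes "f \<in> PL2" "g \<in> PL2"
  shows "lslope (f \<circ> g) x = lslope f (g x) + lslope g x" "rslope (f \<circ> g) x = rslope f (g x) + rslope g x"
  using slopes_eqI[OF has_slopes_compose[OF PL2_has_slopes PL2_has_slopes]] assms by simp_all

lemma slopes_cong:
  assumes "f \<in> PL2" "g \<in> PL2"
  shows lslope_cong: "\<forall>\<^sub>F y in nhds x. y \<le> x \<longrightarrow> f y = g y \<Longrightarrow> lslope f x = lslope g x"
    and rslope_cong: "\<forall>\<^sub>F y in nhds x. x \<le> y \<longrightarrow> f y = g y \<Longrightarrow> rslope f x = rslope g x"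
  using has_slopes_left_unique has_slopes_right_unique PL2_has_slopes assms by blast+

lemma has_slopes_id: "has_slopes id x 0 0"
  by (simp add: has_slopes_def)

lemma slopes_id [simp]: "lslope id x = 0" "rslope id x = 0"
  using slopes_eqI[OF has_slopes_id] by auto

lemma slopes_near_id:
  assumes "\<forall>\<^sub>F y in nhds x. f y = y" shows "lslope f x = 0" "rslope f x = 0"
proof -
  have "\<forall>\<^sub>F y in nhds x. id y = f y" using assms by eventually_elim simp
  then have "has_slopes f x 0 0" using has_slopes_id by (rule has_slopes_cong)
  from slopes_eqI[OF this] show "lslope f x = 0" "rslope f x = 0" .
qed

text \<open>At a fixed point the germ is determined by the two slopes.\<close>

lemma near_id_iff:
  assumes "f \<in> PL2"
  shows "(\<forall>\<^sub>F y in nhds x. f y = y) \<longleftrightarrow> f x = x \<and> lslope f x = 0 \<and> rslope f x = 0"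
proof
  assume ev: "\<forall>\<^sub>F y in nhds x. f y = y"
  show "f x = x \<and> lslope f x = 0 \<and> rslope f x = 0"
    by (intro conjI slopes_near_id[OF ev] eventually_nhds_x_imp_x[OF ev])
next
  assume "f x = x \<and> lslope f x = 0 \<and> rslope f x = 0"
  then show "\<forall>\<^sub>F y in nhds x. f y = y"
    using PL2_has_slopes[OF assms, of x] by (simp add: has_slopes_def)
qed

section \<open>The commutator subgroup of Thompson's group\<close>

lemma compact_support_near_end:
  assumes "f \<in> compact_support_in {a<..<b}" "x \<le> a \<or> b \<le> x"
  shows "\<forall>\<^sub>F y in nhds x. f y = y"
proof -
  obtain c d where cd: "c \<le> d" "{c..d} \<subseteq> {a<..<b}" "f \<in> support_in {c..d}"
    using assms(1) by (rule compact_support_inE)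
  have "x \<in> - {c..d}" using cd(2) assms(2) by auto
  then have "\<forall>\<^sub>F y in nhds x. y \<in> - {c..d}" by (intro eventually_nhds_in_open open_Compl) auto
  then show ?thesis using support_inD(2)[OF cd(3)] by (auto elim: eventually_mono)
qed

lemma compact_support_iff_near_ends:
  assumes "a < b" "f \<in> support_in {a<..<b}"
    and "\<forall>\<^sub>F y in nhds a. f y = y" "\<forall>\<^sub>F y in nhds b. f y = y"
  shows "f \<in> compact_support_in {a<..<b}"
proof -
  obtain d1 where d1: "d1 > 0" "\<And>y. dist y a < d1 \<Longrightarrow> f y = y"
    using assms(3) unfolding eventually_nhds_metric by blast
  obtain d2 where d2: "d2 > 0" "\<And>y. dist y b < d2 \<Longrightarrow> f y = y"
    using assms(4) unfolding eventually_nhds_metric by blast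
  define e where "e = min (min d1 d2) (b - a) / 2"
  have e: "0 < e" "e < d1" "e < d2" "2 * e \<le> b - a" using d1(1) d2(1) assms(1) by (auto simp: e_def)
  have "f y = y" if "y \<notin> {a + e..b - e}" for y
  proof -
    have "y \<le> a \<or> b \<le> y \<or> (a < y \<and> y < a + e) \<or> (b - e < y \<and> y < b)" using that by force
    then consider "y \<le> a" | "b \<le> y" | "a < y" "y < a + e" | "b - e < y" "y < b" by blast
    then show ?thesis
    proof cases
      case 3
      then show ?thesis using e by (intro d1(2)) (auto simp: dist_real_def)
    next
      case 4
      then show ?thesis using e by (intro d2(2)) (auto simp: dist_real_def)
    qed (use support_inD(2)[OF assms(2), of y] in auto)
  qed
  then have "f \<in> support_in {a + e..b - e}" using support_inD(1)[OF assms(2)] by (simp add: support_in_def)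
  then show ?thesis using e by (intro compact_support_inI[of "a + e" "b - e"]) auto
qed

lemma slopes_inv_fixed:
  assumes "f \<in> PL2" "f x = x"
  shows "lslope (PL2_inv f) x = - lslope f x" "rslope (PL2_inv f) x = - rslope f x"
proof -
  have "f \<circ> PL2_inv f = id" using PL2_inv_inverts[OF assms(1)] by (simp add: fun_eq_iff)
  moreover have "PL2_inv f x = x" using PL2_inv_inverts(1)[OF assms(1), of x] assms(2) by simp
  ultimately show "lslope (PL2_inv f) x = - lslope f x" "rslope (PL2_inv f) x = - rslope f x"
    using slopes_compose[OF assms(1) PL2_inv_inverts(3)[OF assms(1)], of x] by simp_all
qed

text \<open>At 0 and 1, which are fixed by all elements, slopes multiply under composition. So commutators have
  trivial germs there, which means compact support in \<open>(0, 1)\<close>. The converse inclusion is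
  perfectness.\<close>

theorem derived_PLu: "derived PL2_group PLu = compact_support_in {0<..<1}"
proof
  have sub: "compact_support_in {0<..<1::real} \<subseteq> PLu"
    using support_in_mono unfolding compact_support_in_def by auto
  show "compact_support_in {0<..<1} \<subseteq> derived PL2_group PLu"
    using PL2.mono_derived[OF sub] compact_support_perfect[of 0 1] by simp
  have "h1 \<circ> h2 \<circ> PL2_inv h1 \<circ> PL2_inv h2 \<in> compact_support_in {0<..<1}"
    if h: "h1 \<in> PLu" "h2 \<in> PLu" for h1 h2
  proof -
    note h1 = support_inD[OF h(1)] and h2 = support_inD[OF h(2)]
    note inv = PL2_inv_inverts[OF h1(1)] PL2_inv_inverts[OF h2(1)]
    let ?c = "h1 \<circ> h2 \<circ> PL2_inv h1 \<circ> PL2_inv h2"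
    have c: "?c \<in> PLu"
      using h subgroup.m_closed[OF support_in_subgroup] subgroup.m_inv_closed[OF support_in_subgroup] by simp
    have "\<forall>\<^sub>F y in nhds x. ?c y = y" if "x = 0 \<or> x = 1" for x
    proof -
      have fx: "h1 x = x" "h2 x = x" using h1(2) h2(2) that by auto
      then have "PL2_inv h1 x = x" "PL2_inv h2 x = x" using inv(1)[of x] inv(4)[of x] by simp_all
      moreover have "?c x = x" using support_inD(2)[OF c] that by auto
      ultimately show ?thesis
        unfolding near_id_iff[OF support_inD(1)[OF c]]
        using fx slopes_inv_fixed[OF h1(1) fx(1)] slopes_inv_fixed[OF h2(1) fx(2)] h1(1) h2(1) inv(3,6)
        by (simp add: slopes_compose PL2_compose del: o_apply)
    qed
    then show ?thesis using c by (intro compact_support_iff_near_ends) auto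
  qed
  then show "derived PL2_group PLu \<subseteq> compact_support_in {0<..<1}"
    unfolding derived_def
    by (intro PL2.generate_subgroup_incl compact_support_open_interval_subgroup) auto
qed

section \<open>Bumps with prescribed slopes\<close>

text \<open>The affine map \<open>h\<close> with slope \<open>2 powi d\<close> and fixed point \<open>x\<close> belongs to \<open>PL2\<close> because
  its intercept is dyadic; it is cut off to a compactly supported map close to \<open>x\<close>.\<close>

lemma PL2_bump:
  assumes "x - 2 powi d * x \<in> \<D>" "e > 0"
  obtains f where "f \<in> support_in {x - e<..<x + e}" "f x = x" "has_slopes f x d d"
proof -
  define h where "h y = 2 powi d * y + (x - 2 powi d * x)" for y
  have h: "h \<in> PL2" unfolding h_def[abs_def] using assms(1) by (rule PL2_affine)
  \<comment> \<open>With \<open>\<delta> + 2 powi d * \<delta> = e\<close>, both \<open>y\<close> and \<open>h y\<close> are within \<open>e\<close> of \<open>x\<close> if \<open>y\<close> is within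
    \<open>\<delta>\<close>.\<close>
  define \<delta> where "\<delta> = e / (1 + 2 powi d)"
  have pos: "0 < (2::real) powi d" by simp
  have pos1: "0 < 1 + (2::real) powi d" using pos by linarith
  have "\<delta> * (1 + 2 powi d) = e" using pos1 by (simp add: \<delta>_def)
  then have \<delta>: "\<delta> > 0" "\<delta> + 2 powi d * \<delta> = e"
    using divide_pos_pos[OF assms(2) pos1] by (simp_all add: \<delta>_def[symmetric] algebra_simps)
  have small: "\<bar>h y - x\<bar> < e" "\<bar>y - x\<bar> < e" if "\<bar>y - x\<bar> < \<delta>" for y
  proof -
    have m: "2 powi d * \<bar>y - x\<bar> < 2 powi d * \<delta>" using that pos by (intro mult_strict_left_mono)
    have "0 < 2 powi d * \<delta>" using pos \<delta>(1) by simp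
    then show "\<bar>y - x\<bar> < e" using that \<delta>(2) by linarith
    have "h y - x = 2 powi d * (y - x)" by (simp add: h_def algebra_simps)
    then have "\<bar>h y - x\<bar> = 2 powi d * \<bar>y - x\<bar>" by (simp add: abs_mult)
    then show "\<bar>h y - x\<bar> < e" using m \<delta> by linarith
  qed
  obtain p where p: "p \<in> \<D>" "x - \<delta> < p" "p < x" using dyadic_dense[of "x - \<delta>" x] \<delta> by auto
  obtain q where q: "q \<in> \<D>" "x < q" "q < x + \<delta>" using dyadic_dense[of x "x + \<delta>"] \<delta> by auto
  have "x - e < min p (h p)" using small[of p] p by (auto simp: abs_less_iff)
  then obtain a where a: "a \<in> \<D>" "x - e < a" "a < min p (h p)" by (rule dyadic_dense)
  have "max q (h q) < x + e" using small[of q] q by (auto simp: abs_less_iff)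
  then obtain b where b: "b \<in> \<D>" "max q (h q) < b" "b < x + e" by (rule dyadic_dense)
  obtain f where f: "f \<in> PL2" "\<And>y. y \<in> {p..q} \<Longrightarrow> f y = h y" "\<And>y. y \<notin> {a<..<b} \<Longrightarrow> f y = y"
    by (rule PL2_compact_extension[OF h, of a p q b]) (use p q a b in auto)
  have fx: "f x = x" using f(2)[of x] p q by (simp add: h_def)
  show thesis
  proof (rule that[of f])
    show "f x = x" by (rule fx)
    show "f \<in> support_in {x - e<..<x + e}" using f(1,3) a b by (auto simp: support_in_def)
    have "\<forall>\<^sub>F y in nhds x. y \<in> {p<..<q}"
      using p q by (intro eventually_nhds_in_open) auto
    then show "has_slopes f x d d" unfolding has_slopes_def
    proof eventually_elim
      case (elim y)
      then have "f y = h y" by (intro f(2)) auto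
      then show ?case by (simp add: fx h_def algebra_simps)
    qed
  qed
qed

lemma PL2_right_bump:
  assumes "x \<in> \<D>" "e > 0"
  obtains f where "f \<in> support_in {x<..<x + e}" "has_slopes f x 0 1"
proof -
  have x: "x - 2 powi 1 * x \<in> \<D>" using assms(1) by simp
  obtain f where f: "f \<in> support_in {x - e<..<x + e}" "f x = x" "has_slopes f x 1 1"
    by (rule PL2_bump[OF x assms(2)])
  let ?g = "\<lambda>y. if y < x then id y else f y"
  have "?g \<in> PL2" using f support_inD(1)[OF f(1)] assms(1) by (intro PL2_glue PL2_id) auto
  moreover have "?g y = y" if "y \<notin> {x<..<x + e}" for y
    using that f(2) support_inD(2)[OF f(1), of y] by (cases "y = x") auto
  moreover have "has_slopes ?g x 0 1" using f(2) by (intro has_slopes_glue[OF has_slopes_id f(3)]) simp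
  ultimately show thesis by (intro that[of ?g]) (auto simp: support_in_def)
qed

lemma PL2_left_bump:
  assumes "x \<in> \<D>" "e > 0"
  obtains f where "f \<in> support_in {x - e<..<x}" "has_slopes f x 1 0"
proof -
  have x: "x - 2 powi 1 * x \<in> \<D>" using assms(1) by simp
  obtain f where f: "f \<in> support_in {x - e<..<x + e}" "f x = x" "has_slopes f x 1 1"
    by (rule PL2_bump[OF x assms(2)])
  let ?g = "\<lambda>y. if y < x then f y else id y"
  have "?g \<in> PL2" using f support_inD(1)[OF f(1)] assms(1) by (intro PL2_glue PL2_id) auto
  moreover have "?g y = y" if "y \<notin> {x - e<..<x}" for y
    using that support_inD(2)[OF f(1), of y] by auto
  moreover have "has_slopes ?g x 1 0" using f(2) by (intro has_slopes_glue[OF f(3) has_slopes_id]) simp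
  ultimately show thesis by (intro that[of ?g]) (auto simp: support_in_def)
qed

section \<open>Patching homeomorphisms with disjoint supports\<close>

text \<open>The product of commuting homeomorphisms with disjoint supports, defined pointwise. The choice of
  \<open>i\<close> is unique when the sets \<open>W i\<close> are disjoint.\<close>

definition patch :: "'i set \<Rightarrow> ('i \<Rightarrow> real set) \<Rightarrow> ('i \<Rightarrow> real \<Rightarrow> real) \<Rightarrow> real \<Rightarrow> real" where
  "patch I W f x = (if \<exists>i\<in>I. x \<in> W i then f (SOME i. i \<in> I \<and> x \<in> W i) x else x)"

lemma patch_in:
  assumes "disjoint_family_on W I" "i \<in> I" "x \<in> W i"
  shows "patch I W f x = f i x"
proof -
  have "(SOME i. i \<in> I \<and> x \<in> W i) = i"
  proof (rule some_equality)
    show "j = i" if "j \<in> I \<and> x \<in> W j" for j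
      using that assms unfolding disjoint_family_on_def by blast
  qed (use assms in auto)
  then show ?thesis using assms(2,3) by (auto simp: patch_def)
qed

lemma patch_outside: "(\<And>i. i \<in> I \<Longrightarrow> x \<notin> W i) \<Longrightarrow> patch I W f x = x"
  by (auto simp: patch_def)

lemma patch_cong: assumes "\<And>i. i \<in> I \<Longrightarrow> f i = g i" shows "patch I W f = patch I W g"
proof
  fix x
  show "patch I W f x = patch I W g x"
  proof (cases "\<exists>i\<in>I. x \<in> W i")
    case True
    then have "(SOME i. i \<in> I \<and> x \<in> W i) \<in> I" by (metis (mono_tags, lifting) someI_ex)
    then show ?thesis using assms by (simp add: patch_def)
  qed (simp add: patch_def)
qed

lemma patch_compose:
  assumes "disjoint_family_on W I" "\<And>i. i \<in> I \<Longrightarrow> g i \<in> support_in (W i)"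
  shows "patch I W f \<circ> patch I W g = patch I W (\<lambda>i. f i \<circ> g i)"
proof
  fix x
  show "(patch I W f \<circ> patch I W g) x = patch I W (\<lambda>i. f i \<circ> g i) x"
  proof (cases "\<exists>i\<in>I. x \<in> W i")
    case True
    then obtain i where i: "i \<in> I" "x \<in> W i" by blast
    then have "g i x \<in> W i" using support_in_maps[OF assms(2)[OF i(1)]] by simp
    then show ?thesis using patch_in[OF assms(1) i(1)] i(2) by simp
  qed (simp add: patch_outside)
qed

text \<open>A patch is a composition of its pieces in any order, so it lies in every subgroup that contains
  them.\<close>

lemma patch_in_subgroup:
  assumes "finite I" "disjoint_family_on W I" "\<And>i. i \<in> I \<Longrightarrow> f i \<in> support_in (W i)"
    and S: "subgroup S PL2_group" "\<And>i. i \<in> I \<Longrightarrow> f i \<in> S"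
  shows "patch I W f \<in> S"
  using assms(1-3) S(2)
proof (induction I rule: finite_induct)
  case empty
  have "patch {} W f = id" by (auto simp: patch_def)
  then show ?case using subgroup.one_closed[OF S(1)] by (simp only: PL2_group_simps)
next
  case (insert i I)
  have dis: "disjoint_family_on W I" using insert.prems(1) by (rule disjoint_family_on_mono[rotated]) auto
  have fi: "f i \<in> support_in (W i)" using insert.prems(2) by simp
  have "patch (insert i I) W f = f i \<circ> patch I W f"
  proof
    fix x
    show "patch (insert i I) W f x = (f i \<circ> patch I W f) x"
    proof (cases "\<exists>j\<in>I. x \<in> W j")
      case True
      then obtain j where j: "j \<in> I" "x \<in> W j" by blast
      then have "f j x \<in> W j" using support_in_maps[OF insert.prems(2)[of j]] by simp
      moreover have "W i \<inter> W j = {}"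
        using insert.prems(1) insert.hyps(2) j(1) unfolding disjoint_family_on_def by force
      ultimately have "f i (f j x) = f j x" by (intro support_inD(2)[OF fi]) blast
      moreover have "patch (insert i I) W f x = f j x" "patch I W f x = f j x"
        using patch_in[OF insert.prems(1) _ j(2)] patch_in[OF dis j] j(1) by simp_all
      ultimately show ?thesis by simp
    next
      case False
      then have "patch I W f x = x" by (intro patch_outside) blast
      moreover have "patch (insert i I) W f x = f i x"
      proof (cases "x \<in> W i")
        case True
        then show ?thesis by (rule patch_in[OF insert.prems(1) insertI1])
      next
        case out: False
        then have "patch (insert i I) W f x = x" using False by (intro patch_outside) blast
        then show ?thesis using support_inD(2)[OF fi out] by simp
      qed
      ultimately show ?thesis by simp
    qed
  qed
  moreover have "patch I W f \<in> S" using insert.prems dis by (intro insert.IH) auto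
  ultimately show ?case using subgroup.m_closed[OF S(1), of "f i"] insert.prems(3)[of i]
    by (simp only: PL2_group_simps insertI1)
qed

section \<open>Thompson's group as a group of homeomorphisms of the line\<close>

abbreviation to_unit :: "(real \<Rightarrow> real) \<Rightarrow> real \<Rightarrow> real" where
  "to_unit f \<equiv> restrict f {0..1}"

lemma PLu_maps_unit: assumes "f \<in> PLu" shows "f ` {0..1} = {0..1}"
proof -
  note f = support_inD(1)[OF assms]
  have ends: "f 0 = 0" "f 1 = 1" using support_inD(2)[OF assms] by auto
  have mem: "f x \<in> {0..1} \<longleftrightarrow> x \<in> {0..1}" for x
    using PL2_le_iff[OF f, of 0 x] PL2_le_iff[OF f, of x 1] ends by simp
  show ?thesis
  proof
    show "f ` {0..1} \<subseteq> {0..1}" using mem by blast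
    show "{0..1} \<subseteq> f ` {0..1}"
    proof
      fix y :: real assume y: "y \<in> {0..1}"
      obtain x where x: "f x = y" using PL2_surj[OF f] by (metis surjD)
      then have "x \<in> {0..1}" using mem[of x] y by simp
      then show "y \<in> f ` {0..1}" using x by blast
    qed
  qed
qed

lemma std_dyadic_length: "std_dyadic a b \<Longrightarrow> \<exists>l::nat. b - a = 1 / 2 ^ l"
proof (induction rule: std_dyadic.induct)
  case unit
  show ?case by (rule exI[of _ 0]) simp
next
  case (half a b e)
  then obtain l :: nat where "b - a = 1 / 2 ^ l" by blast
  then have "(b + e) / 2 - (a + e) / 2 = 1 / 2 ^ Suc l" by (simp add: field_simps)
  then show ?case by blast
qed

text \<open>The points \<open>i / 2 ^ k\<close> of a carried mesh form a subdivision. The slope on each interval is the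
  quotient of the lengths of two standard intervals, hence a power of 2.\<close>

lemma PLu_piecewise_linear:
  assumes "f \<in> PLu" shows "dyadic_piecewise_linear (to_unit f)"
proof -
  obtain k where k: "\<And>i. i < 2 ^ k \<Longrightarrow> carries f (real i / 2 ^ k) ((real i + 1) / 2 ^ k)"
    using PLu_carries_mesh[OF assms] by blast
  define B :: "real set" where "B = (\<lambda>i. real i / 2 ^ k) ` {..2 ^ k}"
  have B01: "b \<in> {0..1} \<inter> \<D>" if "b \<in> B" for b
  proof -
    obtain i where i: "i \<le> 2 ^ k" "b = real i / 2 ^ k" using \<open>b \<in> B\<close> by (auto simp: B_def)
    have "real i \<le> real (2 ^ k)" using i(1) by (simp only: of_nat_le_iff)
    then have "b \<le> 1" by (simp add: i(2))
    then show ?thesis by (auto simp: i(2))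
  qed
  have "0 \<in> B" unfolding B_def by (rule image_eqI[of _ _ 0]) auto
  moreover have "1 \<in> B" unfolding B_def by (rule image_eqI[of _ _ "2 ^ k"]) auto
  moreover have "\<exists>(j :: int) (c :: real). \<forall>x\<in>{a..b}. to_unit f x = 2 powi j * x + c"
    if ab: "a \<in> B" "b \<in> B" "a < b" "{a<..<b} \<inter> B = {}" for a b
  proof -
    obtain i where i: "a = real i / 2 ^ k" using ab(1) by (auto simp: B_def)
    obtain m where m: "m \<le> 2 ^ k" "b = real m / 2 ^ k" using ab(2) by (auto simp: B_def)
    have "i < m" using ab(3) by (simp add: i m(2) divide_less_cancel)
    then have i': "i < 2 ^ k" using m(1) by simp
    have "real (Suc i) / 2 ^ k \<in> B" unfolding B_def using i' by (intro imageI) simp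
    moreover have "a < real (Suc i) / 2 ^ k" by (simp add: i divide_strict_right_mono)
    ultimately have "\<not> real (Suc i) / 2 ^ k < b" using ab(4) by auto
    then have "m \<le> Suc i" by (simp add: m(2) divide_less_cancel)
    then have b: "b = (real i + 1) / 2 ^ k" using \<open>i < m\<close> m(2) by (simp add: le_Suc_eq)
    have car: "carries f a b" using k[OF i'] by (simp add: i b)
    obtain l :: nat where l: "f b - f a = 1 / 2 ^ l" using std_dyadic_length[OF carries_std[OF car]] by blast
    have "b - a = 1 / 2 ^ k" by (simp add: i b add_divide_distrib)
    then have slope: "(f b - f a) / (b - a) = 2 powi (int k - int l)"
      by (simp add: l power_int_diff)
    have lin: "f x = 2 powi (int k - int l) * x + (f a - 2 powi (int k - int l) * a)" if "x \<in> {a..b}" for x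
      using carries_eq[OF car that] unfolding slope by (simp add: right_diff_distrib)
    have "to_unit f x = f x" if "x \<in> {a..b}" for x
      using that B01[OF ab(1)] B01[OF ab(2)] by simp
    then show ?thesis using lin by metis
  qed
  moreover have "finite B" by (simp add: B_def)
  ultimately show ?thesis
    unfolding dyadic_piecewise_linear_def using B01 by (intro exI[of _ B]) auto
qed

lemma to_unit_in_thompson_F:
  assumes "f \<in> PLu" shows "to_unit f \<in> carrier thompson_F"
proof -
  note f = support_inD(1)[OF assms]
  have "\<exists>g. homeomorphism {0..1} {0..1} (to_unit f) g"
  proof (rule homeomorphism_compact)
    have "continuous_on {0..1} f" using PL2_isCont[OF f] by (simp add: continuous_at_imp_continuous_on)
    then show "continuous_on {0..1} (to_unit f)" by (rule continuous_on_cong[THEN iffD1, rotated -1]) auto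
    show "to_unit f ` {0..1} = {0..1}" using PLu_maps_unit[OF assms] by simp
    show "inj_on (to_unit f) {0..1}" using PL2_inj[OF f] by (auto simp: inj_on_def)
  qed simp
  moreover have "strict_mono_on {0..1} (to_unit f)"
    using PL2_less_iff[OF f] by (auto intro!: strict_mono_onI)
  ultimately show ?thesis using PLu_piecewise_linear[OF assms] by (simp add: thompson_F_def)
qed

text \<open>The definition of \<open>F\<close> requires only the break points and slopes to be dyadic. That the values at
  the break points are dyadic follows by working upwards from \<open>\<phi> 0 = 0\<close>, and with them all intercepts.\<close>

lemma thompson_F_extends:
  assumes "\<phi> \<in> carrier thompson_F" shows "\<exists>f\<in>PLu. to_unit f = \<phi>"
proof -
  from assms obtain \<psi> where ext: "\<phi> \<in> extensional {0..1}" and hom: "homeomorphism {0..1} {0..1} \<phi> \<psi>"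
    and mono: "strict_mono_on {0..1} \<phi>" and pl: "dyadic_piecewise_linear \<phi>"
    by (auto simp: thompson_F_def)
  define f where "f x = (if x \<in> {0..1} then \<phi> x else x)" for x
  have img: "\<phi> ` {0..1} = {0..1}" using hom by (rule homeomorphism_image1)
  have \<phi>_less: "\<phi> x < \<phi> y" if "x \<in> {0..1}" "y \<in> {0..1}" "x < y" for x y
    using mono that by (rule strict_mono_onD)
  have bounds: "\<phi> x \<in> {0..1}" if "x \<in> {0..1}" for x using img that by blast
  have \<phi>0: "\<phi> 0 = 0"
  proof -
    have "0 \<in> \<phi> ` {0..1}" unfolding img by simp
    then obtain x where x: "x \<in> {0..1}" "0 = \<phi> x" by (rule imageE)
    show ?thesis
    proof (cases "x = 0")
      case False
      then have "\<phi> 0 < 0" using \<phi>_less[of 0 x] x by simp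
      then show ?thesis using bounds[of 0] by simp
    qed (use x in simp)
  qed
  have \<phi>1: "\<phi> 1 = 1"
  proof -
    have "1 \<in> \<phi> ` {0..1}" unfolding img by simp
    then obtain x where x: "x \<in> {0..1}" "1 = \<phi> x" by (rule imageE)
    show ?thesis
    proof (cases "x = 1")
      case False
      then have "1 < \<phi> 1" using \<phi>_less[of x 1] x by simp
      then show ?thesis using bounds[of 1] by simp
    qed (use x in simp)
  qed
  obtain B where "finite B" "{0, 1} \<subseteq> B" "B \<subseteq> {0..1} \<inter> \<D>" and lin:
    "\<forall>a\<in>B. \<forall>b\<in>B. a < b \<and> {a<..<b} \<inter> B = {} \<longrightarrow>
       (\<exists>(k :: int) (c :: real). \<forall>x\<in>{a..b}. \<phi> x = 2 powi k * x + c)"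
    using pl unfolding dyadic_piecewise_linear_def by (elim exE conjE) (rule that)
  then have B: "finite B" "0 \<in> B" "1 \<in> B" "B \<subseteq> {0..1}" "B \<subseteq> \<D>" by auto
  have affine: "\<exists>(k :: int) c. \<forall>x\<in>{a..b}. \<phi> x = 2 powi k * x + c"
    if "a \<in> B" "b \<in> B" "a < b" "{a<..<b} \<inter> B = {}" for a b
    using lin[rule_format, OF that(1,2)] that(3,4) by blast
  have pred: "\<exists>a\<in>B. a < x \<and> {a<..<x} \<inter> B = {}" if "0 < x" for x
  proof -
    let ?S = "{b \<in> B. b < x}"
    have S: "finite ?S" "?S \<noteq> {}" using B(1,2) that by auto
    define m where "m = Max ?S"
    have "m \<in> ?S" unfolding m_def by (rule Max_in[OF S])
    moreover have "b \<le> m" if "b \<in> B" "b < x" for b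
      unfolding m_def using that by (intro Max_ge[OF S(1)]) simp
    ultimately show ?thesis by (intro bexI[of _ m]) (auto simp: not_less[symmetric])
  qed
  have succ: "\<exists>b\<in>B. x < b \<and> {x<..<b} \<inter> B = {}" if "x < 1" for x
  proof -
    let ?S = "{b \<in> B. x < b}"
    have S: "finite ?S" "?S \<noteq> {}" using B(1,3) that by auto
    define m where "m = Min ?S"
    have "m \<in> ?S" unfolding m_def by (rule Min_in[OF S])
    moreover have "m \<le> b" if "b \<in> B" "x < b" for b
      unfolding m_def using that by (intro Min_le[OF S(1)]) simp
    ultimately show ?thesis by (intro bexI[of _ m]) (auto simp: not_less[symmetric])
  qed
  have dy: "\<phi> b \<in> \<D>" if "b \<in> B" for b
  proof (rule ccontr)
    assume "\<phi> b \<notin> \<D>"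
    let ?S = "{b \<in> B. \<phi> b \<notin> \<D>}"
    have S: "finite ?S" "?S \<noteq> {}" using B(1) that \<open>\<phi> b \<notin> \<D>\<close> by auto
    define m where "m = Min ?S"
    have "m \<in> ?S" unfolding m_def by (rule Min_in[OF S])
    then have m: "m \<in> B" "\<phi> m \<notin> \<D>" by simp_all
    have m_le: "m \<le> b" if "b \<in> B" "\<phi> b \<notin> \<D>" for b
      unfolding m_def using that by (intro Min_le[OF S(1)]) simp
    have "m \<noteq> 0" using m(2) \<phi>0 by auto
    then have "0 < m" using m(1) B(4) by force
    then obtain a where a: "a \<in> B" "a < m" "{a<..<m} \<inter> B = {}" using pred by blast
    then have "\<phi> a \<in> \<D>" using m_le[of a] by linarith
    obtain k :: int and c where kc: "\<forall>x\<in>{a..m}. \<phi> x = 2 powi k * x + c" using affine[OF a(1) m(1) a(2,3)] by blast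
    then have "\<phi> m = \<phi> a + 2 powi k * (m - a)" using a(2) by (simp add: algebra_simps)
    moreover have "m - a \<in> \<D>" using B(5) m(1) a(1) by auto
    ultimately show False using \<open>\<phi> a \<in> \<D>\<close> m(2) by auto
  qed
  have f0: "f x = x" if "x \<le> 0 \<or> 1 \<le> x" for x using that \<phi>0 \<phi>1 by (auto simp: f_def)
  have right: "\<exists>(k :: int) c. \<forall>\<^sub>F y in nhds x. x \<le> y \<longrightarrow> f y = 2 powi k * y + c" if x: "x \<in> B" for x
  proof (cases "x < 1")
    case True
    then obtain b where b: "b \<in> B" "x < b" "{x<..<b} \<inter> B = {}" using succ by blast
    obtain k :: int and c where kc: "\<forall>x\<in>{x..b}. \<phi> x = 2 powi k * x + c"
      using affine[OF x b(1-3)] by blast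
    have "\<forall>\<^sub>F y in nhds x. y \<in> {..<b}" using b(2) by (intro eventually_nhds_in_open) auto
    then have "\<forall>\<^sub>F y in nhds x. x \<le> y \<longrightarrow> f y = 2 powi k * y + c"
    proof eventually_elim
      case (elim y)
      then show ?case using kc x B(4) b(1) by (auto simp: f_def)
    qed
    then show ?thesis by blast
  next
    case False
    then have "\<forall>\<^sub>F y in nhds x. x \<le> y \<longrightarrow> f y = 2 powi 0 * y + 0" by (simp add: f0)
    then show ?thesis by blast
  qed
  have left: "\<exists>(k :: int) c. \<forall>\<^sub>F y in nhds x. y \<le> x \<longrightarrow> f y = 2 powi k * y + c" if x: "x \<in> B" for x
  proof (cases "0 < x")
    case True
    then obtain a where a: "a \<in> B" "a < x" "{a<..<x} \<inter> B = {}" using pred by blast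
    obtain k :: int and c where kc: "\<forall>x\<in>{a..x}. \<phi> x = 2 powi k * x + c"
      using affine[OF a(1) x a(2,3)] by blast
    have "\<forall>\<^sub>F y in nhds x. y \<in> {a<..}" using a(2) by (intro eventually_nhds_in_open) auto
    then have "\<forall>\<^sub>F y in nhds x. y \<le> x \<longrightarrow> f y = 2 powi k * y + c"
    proof eventually_elim
      case (elim y)
      then show ?case using kc x B(4) a(1) by (auto simp: f_def)
    qed
    then show ?thesis by blast
  next
    case False
    then have "\<forall>\<^sub>F y in nhds x. y \<le> x \<longrightarrow> f y = 2 powi 0 * y + 0" by (simp add: f0)
    then show ?thesis by blast
  qed
  have "dpl_at f x" for x
  proof -
    consider "x \<in> B" | "x \<in> {0..1}" "x \<notin> B" | "x \<in> - {0..1}" by blast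
    then show ?thesis
    proof cases
      case 1
      obtain k :: int and c where kc: "\<forall>\<^sub>F y in nhds x. x \<le> y \<longrightarrow> f y = 2 powi k * y + c"
        using right[OF 1] by blast
      obtain l :: int and d where ld: "\<forall>\<^sub>F y in nhds x. y \<le> x \<longrightarrow> f y = 2 powi l * y + d"
        using left[OF 1] by blast
      have fx: "f x = 2 powi k * x + c" "f x = 2 powi l * x + d"
        using eventually_nhds_x_imp_x[OF kc] eventually_nhds_x_imp_x[OF ld] by auto
      have sl: "has_slopes f x l k"
        unfolding has_slopes_def using kc ld
      proof eventually_elim
        case (elim y)
        then show ?case using fx by (cases "y < x") (simp_all add: algebra_simps)
      qed
      have "x \<in> \<D>" "f x \<in> \<D>" using 1 B(4,5) dy by (auto simp: f_def)
      then show ?thesis by (intro dpl_atI[OF sl]) auto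
    next
      case 2
      then have x: "0 < x" "x < 1" using B(2,3) by (auto simp: less_le)
      obtain a where a: "a \<in> B" "a < x" "{a<..<x} \<inter> B = {}" using pred x by blast
      obtain b where b: "b \<in> B" "x < b" "{x<..<b} \<inter> B = {}" using succ x by blast
      have "{a<..<b} \<subseteq> {a<..<x} \<union> {x} \<union> {x<..<b}" by auto
      then have "{a<..<b} \<inter> B = {}" using a(3) b(3) 2(2) by blast
      then obtain k :: int and c where kc: "\<forall>x\<in>{a..b}. \<phi> x = 2 powi k * x + c"
        using affine[OF a(1) b(1)] a(2) b(2) by auto
      have "a \<in> \<D>" using B(5) a(1) by blast
      then have "\<phi> a - 2 powi k * a \<in> \<D>" by (intro dyadic_diff dy[OF a(1)]) simp
      then have c: "c \<in> \<D>" using kc a(2) b(2) by simp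
      have "\<forall>\<^sub>F y in nhds x. y \<in> {a<..<b}" using a(2) b(2) by (intro eventually_nhds_in_open) auto
      then have "\<forall>\<^sub>F y in nhds x. 2 powi k * y + c = f y"
      proof eventually_elim
        case (elim y)
        moreover have "y \<in> {0..1}" using elim a(1) b(1) B(4) by force
        ultimately show ?case using kc by (simp add: f_def)
      qed
      then show ?thesis using dpl_at_affine[OF c] by (rule dpl_at_cong)
    next
      case 3
      then have "\<forall>\<^sub>F y in nhds x. y \<in> - {0..1}" by (intro eventually_nhds_in_open open_Compl) auto
      then have "\<forall>\<^sub>F y in nhds x. id y = f y" by eventually_elim (auto simp: f_def)
      then show ?thesis using PL2_dpl_at[OF PL2_id] by (rule dpl_at_cong)
    qed
  qed
  moreover have "strict_mono f"
  proof (rule strict_monoI)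
    fix x y :: real assume xy: "x < y"
    consider "x \<in> {0..1}" "y \<in> {0..1}" | "x < 0" "y \<in> {0..1}" | "x \<in> {0..1}" "1 < y"
      | "x \<notin> {0..1}" "y \<notin> {0..1}" using xy by fastforce
    then show "f x < f y"
    proof cases
      case 1
      then show ?thesis using \<phi>_less[OF 1 xy] by (simp add: f_def)
    next
      case 2
      then show ?thesis using bounds[OF 2(2)] by (simp add: f_def)
    next
      case 3
      then show ?thesis using bounds[OF 3(1)] by (simp add: f_def)
    next
      case 4
      then show ?thesis using xy by (auto simp: f_def)
    qed
  qed
  moreover have "\<exists>x. y = f x" for y
  proof (cases "y \<in> {0..1}")
    case True
    then obtain x where "x \<in> {0..1}" "y = \<phi> x" using img by blast
    then show ?thesis by (intro exI[of _ x]) (simp add: f_def)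
  next
    case False
    then show ?thesis by (intro exI[of _ y]) (auto simp: f_def)
  qed
  then have "surj f" unfolding surj_def by blast
  ultimately have "f \<in> PL2" by (intro PL2_I)
  moreover have "f x = x" if "x \<notin> {0<..<1}" for x using that by (intro f0) auto
  ultimately have "f \<in> PLu" by (simp add: support_in_def)
  moreover have "to_unit f = \<phi>" using ext by (auto simp: f_def extensional_def fun_eq_iff)
  ultimately show ?thesis by blast
qed

lemma to_unit_inj: "inj_on to_unit PLu"
proof (rule inj_onI)
  fix f g assume fg: "f \<in> PLu" "g \<in> PLu" "to_unit f = to_unit g"
  show "f = g"
  proof
    fix x
    show "f x = g x"
    proof (cases "x \<in> {0..1}")
      case True
      then show ?thesis using fun_cong[OF fg(3), of x] by simp
    next
      case False
      then show ?thesis using support_inD(2)[OF fg(1), of x] support_inD(2)[OF fg(2), of x] by auto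
    qed
  qed
qed

lemma thompson_F_carrier: "carrier thompson_F = to_unit ` PLu"
  using to_unit_in_thompson_F thompson_F_extends by blast

lemma to_unit_Bij: assumes "f \<in> PLu" shows "to_unit f \<in> Bij {0..1}"
  using PLu_maps_unit[OF assms] PL2_inj[OF support_inD(1)[OF assms]]
  by (auto simp: Bij_def bij_betw_def inj_on_def)

lemma to_unit_compose:
  assumes "f \<in> PLu" "g \<in> PLu"
  shows "to_unit (f \<circ> g) = to_unit f \<otimes>\<^bsub>thompson_F\<^esub> to_unit g"
proof -
  have "g x \<in> {0..1}" if "x \<in> {0..1}" for x using PLu_maps_unit[OF assms(2)] that by blast
  then show ?thesis
    using to_unit_Bij[OF assms(1)] to_unit_Bij[OF assms(2)]
    by (auto simp: thompson_F_def BijGroup_def compose_def fun_eq_iff)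
qed

lemma to_unit_subgroup:
  assumes S: "subgroup S PL2_group" "S \<subseteq> PLu"
  shows "group (thompson_F\<lparr>carrier := to_unit ` S\<rparr>)"
    and "to_unit \<in> iso (PL2_group\<lparr>carrier := S\<rparr>) (thompson_F\<lparr>carrier := to_unit ` S\<rparr>)"
proof -
  let ?B = "BijGroup {0..1::real}"
  have mult: "x \<otimes>\<^bsub>thompson_F\<^esub> y = x \<otimes>\<^bsub>?B\<^esub> y" for x y by (simp add: thompson_F_def)
  interpret to_unit: group_hom "PL2_group\<lparr>carrier := S\<rparr>" ?B to_unit
  proof -
    have "to_unit \<in> hom (PL2_group\<lparr>carrier := S\<rparr>) ?B"
    proof (rule homI)
      show "to_unit f \<in> carrier ?B" if "f \<in> carrier (PL2_group\<lparr>carrier := S\<rparr>)" for f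
        using to_unit_Bij that S(2) by (auto simp: BijGroup_def)
      show "to_unit (f \<otimes>\<^bsub>PL2_group\<lparr>carrier := S\<rparr>\<^esub> g) = to_unit f \<otimes>\<^bsub>?B\<^esub> to_unit g"
        if "f \<in> carrier (PL2_group\<lparr>carrier := S\<rparr>)" "g \<in> carrier (PL2_group\<lparr>carrier := S\<rparr>)" for f g
        using to_unit_compose[of f g] that S(2) by (auto simp: mult)
    qed
    then show "group_hom (PL2_group\<lparr>carrier := S\<rparr>) ?B to_unit"
      using PL2.subgroup_imp_group[OF S(1)] group_BijGroup by (simp add: group_hom_def group_hom_axioms_def)
  qed
  have "subgroup (to_unit ` S) ?B" using to_unit.img_is_subgroup by simp
  then have "group (?B\<lparr>carrier := to_unit ` S\<rparr>)" by (rule group.subgroup_imp_group[OF group_BijGroup])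
  then show "group (thompson_F\<lparr>carrier := to_unit ` S\<rparr>)" by (simp add: thompson_F_def)
  show "to_unit \<in> iso (PL2_group\<lparr>carrier := S\<rparr>) (thompson_F\<lparr>carrier := to_unit ` S\<rparr>)"
  proof (rule isoI)
    show "to_unit \<in> hom (PL2_group\<lparr>carrier := S\<rparr>) (thompson_F\<lparr>carrier := to_unit ` S\<rparr>)"
      using to_unit_compose S(2) by (intro homI) auto
    show "bij_betw to_unit (carrier (PL2_group\<lparr>carrier := S\<rparr>)) (carrier (thompson_F\<lparr>carrier := to_unit ` S\<rparr>))"
      using inj_on_subset[OF to_unit_inj S(2)] by (simp add: bij_betw_def)
  qed
qed

lemma compact_support_subset_PLu: "compact_support_in {0<..<1::real} \<subseteq> PLu"
  using support_in_mono unfolding compact_support_in_def by auto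

lemma derived_F_eq: "derived_F = thompson_F\<lparr>carrier := to_unit ` compact_support_in {0<..<1}\<rparr>"
proof -
  let ?P = "PL2_group\<lparr>carrier := PLu\<rparr>"
  have F: "thompson_F\<lparr>carrier := to_unit ` PLu\<rparr> = thompson_F" by (simp flip: thompson_F_carrier)
  note sub = to_unit_subgroup[OF support_in_subgroup order_refl, unfolded F]
  interpret to_unit: group_hom ?P thompson_F to_unit
    using sub PL2.subgroup_imp_group[OF support_in_subgroup]
    by (simp add: group_hom_def group_hom_axioms_def iso_def)
  have "derived thompson_F (carrier thompson_F) = to_unit ` derived ?P PLu"
    unfolding thompson_F_carrier by (rule to_unit.derived_img) simp
  also have "derived ?P PLu = compact_support_in {0<..<1}"
    using PL2.derived_consistent[OF order_refl support_in_subgroup] derived_PLu by simp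
  finally show ?thesis by (simp only: derived_F_def)
qed

lemma derived_F_group: "group derived_F"
  unfolding derived_F_eq
  by (intro to_unit_subgroup compact_support_subset_PLu compact_support_open_interval_subgroup) simp

lemma derived_F_iso_compact_support:
  assumes "a < b"
  shows "derived_F \<cong> PL2_group\<lparr>carrier := compact_support_in {a<..<b}\<rparr>"
proof -
  let ?K = "\<lambda>a b. PL2_group\<lparr>carrier := compact_support_in {a<..<b :: real}\<rparr>"
  have sub: "subgroup (compact_support_in {0<..<1::real}) PL2_group"
    by (intro compact_support_open_interval_subgroup) simp
  have "?K 0 1 \<cong> derived_F"
    using to_unit_subgroup(2)[OF sub compact_support_subset_PLu] unfolding derived_F_eq is_iso_def by blast
  then have 1: "derived_F \<cong> ?K 0 1" by (rule group.iso_sym[OF PL2.subgroup_imp_group[OF sub]])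
  have "PL2_group\<lparr>carrier := PLc\<rparr> \<cong> ?K 0 1" by (rule compact_support_iso_PLc) simp
  then have 2: "?K 0 1 \<cong> PL2_group\<lparr>carrier := PLc\<rparr>"
    by (rule group.iso_sym[OF PL2.subgroup_imp_group[OF PLc_subgroup]])
  show ?thesis
    by (rule iso_trans[OF 1 iso_trans[OF 2 compact_support_iso_PLc[OF assms]]])
qed

section \<open>Slopes at a fixed point\<close>

text \<open>For rational \<open>x\<close>, the least \<open>k > 0\<close> such that the affine map with slope \<open>2\<^sup>k\<close> and fixed point \<open>x\<close>
  has a dyadic intercept. If the denominator of \<open>x\<close> has odd part \<open>q\<close>, this is the order of 2
  modulo \<open>q\<close>.\<close>

definition period :: "real \<Rightarrow> nat" where
  "period x = (LEAST k. k > 0 \<and> x - 2 powi int k * x \<in> \<D>)"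

text \<open>Write \<open>x = p / q\<close>. Two of the residues of \<open>2 ^ k * p\<close> modulo \<open>q\<close> coincide, say for \<open>k = i\<close> and
  \<open>k = j\<close>; then \<open>(2 ^ j - 2 ^ i) * x\<close> is an integer.\<close>

lemma rational_period_exists:
  assumes "x \<in> \<rat>" shows "\<exists>k>0. x - 2 powi int k * x \<in> \<D>"
proof -
  obtain p q :: int where q: "q > 0" and x: "x = of_int p / of_int q"
    using assms by (auto elim!: Rats_cases')
  let ?f = "\<lambda>k::nat. (2 ^ k * p) mod q"
  have "range ?f \<subseteq> {0..<q}" using q by auto
  then have "finite (range ?f)" by (rule finite_subset) simp
  then have "\<not> inj ?f" using finite_imageD by blast
  then obtain i j where ij: "i < j" "?f i = ?f j"
    unfolding inj_def by (metis linorder_neqE_nat)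
  then have "q dvd 2 ^ j * p - 2 ^ i * p" by (metis mod_eq_dvd_iff)
  then obtain m where m: "2 ^ j * p - 2 ^ i * p = q * m" by (elim dvdE)
  have "real_of_int (2 ^ j * p - 2 ^ i * p) = of_int q * of_int m" by (simp only: m of_int_mult)
  then have "(2 ^ j - 2 ^ i) * x = of_int m" using q by (simp add: x field_simps)
  moreover have "(2::real) ^ j = 2 ^ (j - i) * 2 ^ i" using ij(1) by (simp flip: power_add)
  ultimately have "(x - 2 ^ (j - i) * x) * 2 ^ i = - of_int m" by (simp add: algebra_simps)
  then have "(x - 2 ^ (j - i) * x) * 2 ^ i \<in> \<int>" by simp
  then have "x - 2 powi int (j - i) * x \<in> \<D>" unfolding dyadic_iff by auto
  then show ?thesis using ij(1) by (intro exI[of _ "j - i"]) simp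
qed

text \<open>The exponents \<open>k\<close> for which \<open>x - 2 powi k * x\<close> is dyadic form a subgroup of the integers, generated
  by its least positive element.\<close>

lemma period:
  assumes "x \<in> \<rat>"
  shows "period x > 0" "x - 2 powi int (period x) * x \<in> \<D>"
    and "x - 2 powi k * x \<in> \<D> \<Longrightarrow> int (period x) dvd k"
proof -
  let ?P = "\<lambda>k. x - 2 powi k * x \<in> \<D>"
  have "period x > 0 \<and> ?P (int (period x))"
    unfolding period_def by (rule LeastI_ex[OF rational_period_exists[OF assms]])
  then show pos: "period x > 0" and per: "?P (int (period x))" by auto
  have add: "?P (a + b)" if "?P a" "?P b" for a b :: int
  proof -
    have "(x - 2 powi a * x) + 2 powi a * (x - 2 powi b * x) \<in> \<D>" using that by (intro dyadic_add) simp_all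
    then show ?thesis by (simp add: power_int_add algebra_simps)
  qed
  have neg: "?P (- a)" if "?P a" for a :: int
  proof -
    have "- (2 powi (- a) * (x - 2 powi a * x)) \<in> \<D>" using that by (simp only: dyadic_uminus dyadic_powi_mult_iff)
    then show ?thesis by (simp add: power_int_minus algebra_simps)
  qed
  have mult_nat: "?P (int (period x) * int t)" for t
  proof (induction t)
    case (Suc t)
    from add[OF per Suc.IH] show ?case by (simp add: distrib_left)
  qed simp
  have mult: "?P (int (period x) * t)" for t
    using mult_nat[of "nat t"] neg[OF mult_nat[of "nat (- t)"]] by (cases "t \<ge> 0") auto
  show "int (period x) dvd k" if k: "?P k"
  proof -
    define m where "m = k mod int (period x)"
    have m: "0 \<le> m" "m < int (period x)" using pos by (auto simp: m_def)
    have "m = k + - (int (period x) * (k div int (period x)))"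
      by (simp add: m_def minus_mult_div_eq_mod)
    then have "?P m" using add[OF k neg[OF mult]] by simp
    moreover have "\<not> (nat m > 0 \<and> ?P (int (nat m)))"
      using m unfolding period_def by (intro not_less_Least) (simp add: nat_less_iff)
    ultimately have "m = 0" using m(1) by auto
    then show ?thesis by (simp add: m_def dvd_eq_mod_eq_0)
  qed
qed

lemma period_dyadic: assumes "x \<in> \<D>" shows "period x = 1"
proof -
  have "int (period x) dvd 1" using assms by (intro period(3) dyadic_Rats) auto
  then show ?thesis by simp
qed

lemma fixed_point_slopes:
  assumes "f \<in> PL2" "f x = x"
  shows "x - 2 powi rslope f x * x \<in> \<D>" "x \<notin> \<D> \<Longrightarrow> lslope f x = rslope f x"
proof -
  obtain k l where kl: "has_slopes f x l k" "f x - 2 powi k * x \<in> \<D>" "x \<notin> \<D> \<Longrightarrow> k = l"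
    using PL2_dpl_at[OF assms(1), of x] by (rule dpl_atE) blast
  then show "x - 2 powi rslope f x * x \<in> \<D>" "x \<notin> \<D> \<Longrightarrow> lslope f x = rslope f x"
    using slopes_eqI[OF kl(1)] assms(2) by auto
qed

lemma irrational_fixed_point_slope:
  assumes "f \<in> PL2" "f x = x" "x \<notin> \<rat>"
  shows "lslope f x = 0" "rslope f x = 0"
proof -
  have nd: "x \<notin> \<D>" using assms(3) dyadic_Rats by blast
  have "rslope f x = 0"
  proof (rule ccontr)
    assume k: "rslope f x \<noteq> 0"
    let ?c = "1 - 2 powi rslope f x :: real"
    have "(2::real) powi rslope f x \<noteq> 1"
      using k power_int_strict_increasing[of 0 "rslope f x" "2::real"]
        power_int_strict_increasing[of "rslope f x" 0 "2::real"] by (cases "rslope f x > 0") auto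
    then have c: "?c \<noteq> 0" by simp
    have "?c * x \<in> \<D>" using fixed_point_slopes(1)[OF assms(1,2)] by (simp add: algebra_simps)
    then have "?c * x \<in> \<rat>" by (rule dyadic_Rats)
    moreover have "?c \<in> \<rat>" by (intro Rats_diff Rats_1 dyadic_Rats dyadic_powi)
    ultimately have "?c * x / ?c \<in> \<rat>" by (rule Rats_divide)
    then show False using c assms(3) by simp
  qed
  then show "lslope f x = 0" "rslope f x = 0" using fixed_point_slopes(2)[OF assms(1,2) nd] by auto
qed

section \<open>Finite sets of points and the gaps between them\<close>

text \<open>The ends \<open>a\<close> and \<open>b\<close> need not be dyadic, so \<open>f\<close> is cut at nearby dyadic points \<open>p\<close> and \<open>q\<close>, where
  it still is the identity.\<close>

lemma restrict_to_interval:
  assumes "a < b" "f \<in> PL2" "\<forall>\<^sub>F y in nhds a. f y = y" "\<forall>\<^sub>F y in nhds b. f y = y"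
  shows "\<exists>g\<in>compact_support_in {a<..<b}. \<forall>y\<in>{a<..<b}. g y = f y"
proof -
  obtain d1 where d1: "d1 > 0" "\<And>y. dist y a < d1 \<Longrightarrow> f y = y"
    using assms(3) unfolding eventually_nhds_metric by blast
  obtain d2 where d2: "d2 > 0" "\<And>y. dist y b < d2 \<Longrightarrow> f y = y"
    using assms(4) unfolding eventually_nhds_metric by blast
  define m where "m = (a + b) / 2"
  have m: "a < m" "m < b" using assms(1) by (auto simp: m_def)
  have "a < min (a + d1) m" using d1(1) m by simp
  then obtain p where p: "p \<in> \<D>" "a < p" "p < min (a + d1) m" by (rule dyadic_dense)
  have "max (b - d2) m < b" using d2(1) m by simp
  then obtain q where q: "q \<in> \<D>" "max (b - d2) m < q" "q < b" by (rule dyadic_dense)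
  have fa: "f y = y" if "a \<le> y" "y \<le> p" for y using that p by (intro d1(2)) (auto simp: dist_real_def)
  have fb: "f y = y" if "q \<le> y" "y \<le> b" for y using that q by (intro d2(2)) (auto simp: dist_real_def)
  let ?h = "\<lambda>y. if y < q then f y else id y"
  let ?g = "\<lambda>y. if y < p then id y else ?h y"
  have h: "?h \<in> PL2" using fb[of q] q by (intro PL2_glue assms(2) PL2_id) auto
  have g: "?g \<in> PL2" using fa[of p] p q by (intro PL2_glue PL2_id h) auto
  have "?g \<in> support_in {p..q}" using g by (auto simp: support_in_def)
  then have "?g \<in> compact_support_in {a<..<b}" using p q by (intro compact_support_inI[of p q]) auto
  moreover have "?g y = f y" if "y \<in> {a<..<b}" for y using that fa[of y] fb[of y] by auto
  ultimately show ?thesis by (intro bexI[of _ ?g] ballI)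
qed

lemma finite_set_separated:
  fixes V :: "real set" assumes "finite V"
  obtains e where "e > 0" "\<And>u v. u \<in> V \<Longrightarrow> v \<in> V \<Longrightarrow> u < v \<Longrightarrow> u + e \<le> v - e"
proof -
  define D where "D = {(u, v). u \<in> V \<and> v \<in> V \<and> u < v}"
  \<comment> \<open>The element 1 keeps \<open>S\<close> nonempty when \<open>V\<close> has fewer than two points.\<close>
  define S where "S = insert 1 ((\<lambda>(u, v). v - u) ` D)"
  have "D \<subseteq> V \<times> V" by (auto simp: D_def)
  then have "finite D" by (rule finite_subset) (use assms in simp)
  then have fin: "finite S" by (simp add: S_def)
  define e where "e = Min S / 2"
  have "\<forall>s\<in>S. s > 0" by (auto simp: S_def D_def)
  moreover have "S \<noteq> {}" by (simp add: S_def)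
  ultimately have "e > 0" using fin by (simp add: e_def)
  moreover have "u + e \<le> v - e" if "u \<in> V" "v \<in> V" "u < v" for u v
  proof -
    have "(u, v) \<in> D" using that by (simp add: D_def)
    then have "v - u \<in> S" unfolding S_def by (intro insertI2 image_eqI[of _ _ "(u, v)"]) simp_all
    then have "Min S \<le> v - u" using fin by (intro Min_le)
    then show ?thesis by (simp add: e_def)
  qed
  ultimately show thesis by (rule that)
qed

lemma finite_set_enumeration:
  fixes V :: "real set"
  assumes "finite V" "card V = Suc n"
  obtains x where "strict_mono_on {..n} x" "V = x ` {..n}"
proof -
  let ?l = "sorted_list_of_set V"
  have len: "length ?l = Suc n" using assms by simp
  have "strict_mono_on {..n} (\<lambda>i. ?l ! i)"
  proof (rule strict_mono_onI)
    fix i j assume "i \<in> {..n}" "j \<in> {..n}" "i < j"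
    then show "?l ! i < ?l ! j"
      using sorted_wrt_nth_less[OF strict_sorted_list_of_set[of V], of i j] len by simp
  qed
  moreover have "V = (\<lambda>i. ?l ! i) ` {..n}"
  proof -
    have "set ?l = V" using assms(1) by simp
    then show ?thesis using len by (auto simp: set_conv_nth less_Suc_eq_le)
  qed
  ultimately show thesis by (rule that)
qed

section \<open>Split extensions are semidirect products\<close>

text \<open>The quotient acts on the kernel by conjugation with the section: \<open>\<nu> (\<phi> q n) = s q (\<nu> n) (s q)\<^sup>-\<^sup>1\<close>. An
  element \<open>g\<close> decomposes as \<open>(g (s (\<pi> g))\<^sup>-\<^sup>1) (s (\<pi> g))\<close>.\<close>

lemma split_extension_is_semidirect_product:
  assumes G: "group G" and N: "group N" and Q: "group Q"
    and \<pi>: "\<pi> \<in> hom G Q" and s: "s \<in> hom Q G" and split: "\<And>q. q \<in> carrier Q \<Longrightarrow> \<pi> (s q) = q"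
    and \<nu>: "\<nu> \<in> hom N G" "inj_on \<nu> (carrier N)" "\<nu> ` carrier N = kernel G Q \<pi>"
  shows "is_semidirect_product G N Q"
proof -
  interpret G: group G by (rule G)
  interpret N: group N by (rule N)
  interpret Q: group Q by (rule Q)
  interpret \<pi>: group_hom G Q \<pi> using \<pi> by unfold_locales
  interpret s: group_hom Q G s using s by unfold_locales
  interpret \<nu>: group_hom N G \<nu> using \<nu>(1) by unfold_locales
  have cancel: "inv\<^bsub>G\<^esub> x \<otimes>\<^bsub>G\<^esub> (x \<otimes>\<^bsub>G\<^esub> y) = y" if "x \<in> carrier G" "y \<in> carrier G" for x y
    using that by (simp flip: G.m_assoc)
  define \<mu> where "\<mu> = inv_into (carrier N) \<nu>"
  have \<mu>: "\<mu> k \<in> carrier N" "\<nu> (\<mu> k) = k" if "k \<in> carrier G" "\<pi> k = \<one>\<^bsub>Q\<^esub>" for k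
  proof -
    have "k \<in> \<nu> ` carrier N" using that \<nu>(3) by (simp add: kernel_def)
    then show "\<mu> k \<in> carrier N" "\<nu> (\<mu> k) = k"
      unfolding \<mu>_def by (rule inv_into_into, rule f_inv_into_f)
  qed
  have \<pi>\<nu>: "\<pi> (\<nu> n) = \<one>\<^bsub>Q\<^esub>" if "n \<in> carrier N" for n
  proof -
    have "\<nu> n \<in> kernel G Q \<pi>" using that \<nu>(3) by blast
    then show ?thesis by (simp add: kernel_def)
  qed
  have \<nu>_eq: "n = n'" if "\<nu> n = \<nu> n'" "n \<in> carrier N" "n' \<in> carrier N" for n n'
    using inj_onD[OF \<nu>(2)] that by blast
  define \<phi> where "\<phi> = (\<lambda>q\<in>carrier Q. \<lambda>n\<in>carrier N. \<mu> (s q \<otimes>\<^bsub>G\<^esub> \<nu> n \<otimes>\<^bsub>G\<^esub> inv\<^bsub>G\<^esub> s q))"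
  have \<phi>: "\<phi> q n \<in> carrier N" "\<nu> (\<phi> q n) = s q \<otimes>\<^bsub>G\<^esub> \<nu> n \<otimes>\<^bsub>G\<^esub> inv\<^bsub>G\<^esub> s q"
    if "q \<in> carrier Q" "n \<in> carrier N" for q n
  proof -
    have "\<pi> (s q \<otimes>\<^bsub>G\<^esub> \<nu> n \<otimes>\<^bsub>G\<^esub> inv\<^bsub>G\<^esub> s q) = \<one>\<^bsub>Q\<^esub>"
      using that by (simp add: split \<pi>\<nu>)
    then show "\<phi> q n \<in> carrier N" "\<nu> (\<phi> q n) = s q \<otimes>\<^bsub>G\<^esub> \<nu> n \<otimes>\<^bsub>G\<^esub> inv\<^bsub>G\<^esub> s q"
      using that \<mu>[of "s q \<otimes>\<^bsub>G\<^esub> \<nu> n \<otimes>\<^bsub>G\<^esub> inv\<^bsub>G\<^esub> s q"] by (simp_all add: \<phi>_def)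
  qed
  have \<phi>_mult: "\<phi> (q \<otimes>\<^bsub>Q\<^esub> q') n = \<phi> q (\<phi> q' n)"
    if "q \<in> carrier Q" "q' \<in> carrier Q" "n \<in> carrier N" for q q' n
    by (rule \<nu>_eq) (use that in \<open>simp_all add: \<phi> G.m_assoc G.inv_mult_group\<close>)
  have \<phi>_one: "\<phi> \<one>\<^bsub>Q\<^esub> n = n" if "n \<in> carrier N" for n
    by (rule \<nu>_eq) (use that in \<open>simp_all add: \<phi>\<close>)
  have \<phi>_hom: "\<phi> q (n \<otimes>\<^bsub>N\<^esub> n') = \<phi> q n \<otimes>\<^bsub>N\<^esub> \<phi> q n'"
    if "q \<in> carrier Q" "n \<in> carrier N" "n' \<in> carrier N" for q n n'
    by (rule \<nu>_eq) (use that in \<open>simp_all add: \<phi> G.m_assoc cancel\<close>)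
  have aut: "\<phi> q \<in> auto N" if q: "q \<in> carrier Q" for q
  proof -
    have "\<phi> q \<in> hom N N" using q by (intro homI) (auto simp: \<phi> \<phi>_hom)
    moreover have "bij_betw (\<phi> q) (carrier N) (carrier N)"
    proof (rule bij_betwI[where g = "\<phi> (inv\<^bsub>Q\<^esub> q)"])
      show "\<phi> (inv\<^bsub>Q\<^esub> q) (\<phi> q n) = n" "\<phi> q (\<phi> (inv\<^bsub>Q\<^esub> q) n) = n" if "n \<in> carrier N" for n
        using q that by (simp_all flip: \<phi>_mult add: \<phi>_one)
    qed (use q in \<open>auto simp: \<phi>\<close>)
    moreover have "\<phi> q \<in> extensional (carrier N)" using q by (simp add: \<phi>_def)
    ultimately show ?thesis by (simp add: auto_def Bij_def)
  qed
  have "\<phi> \<in> hom Q (AutoGroup N)"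
  proof (rule homI)
    fix q q' assume q: "q \<in> carrier Q" "q' \<in> carrier Q"
    have "\<phi> (q \<otimes>\<^bsub>Q\<^esub> q') = compose (carrier N) (\<phi> q) (\<phi> q')"
    proof
      fix n
      show "\<phi> (q \<otimes>\<^bsub>Q\<^esub> q') n = compose (carrier N) (\<phi> q) (\<phi> q') n"
        using q \<phi>_mult by (cases "n \<in> carrier N") (auto simp: compose_def \<phi>_def)
    qed
    then show "\<phi> (q \<otimes>\<^bsub>Q\<^esub> q') = \<phi> q \<otimes>\<^bsub>AutoGroup N\<^esub> \<phi> q'"
      using aut q by (simp add: AutoGroup_def BijGroup_def auto_def)
  qed (simp add: AutoGroup_def aut)
  moreover have "G \<cong> semidirect_product N Q \<phi>"
  proof -
    let ?f = "\<lambda>g. (\<mu> (g \<otimes>\<^bsub>G\<^esub> inv\<^bsub>G\<^esub> s (\<pi> g)), \<pi> g)"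
    have k: "\<mu> (g \<otimes>\<^bsub>G\<^esub> inv\<^bsub>G\<^esub> s (\<pi> g)) \<in> carrier N"
        "\<nu> (\<mu> (g \<otimes>\<^bsub>G\<^esub> inv\<^bsub>G\<^esub> s (\<pi> g))) = g \<otimes>\<^bsub>G\<^esub> inv\<^bsub>G\<^esub> s (\<pi> g)" if "g \<in> carrier G" for g
      using that by (auto intro!: \<mu> simp: split)
    have "?f \<in> hom G (semidirect_product N Q \<phi>)"
    proof (rule homI)
      fix x y assume xy: "x \<in> carrier G" "y \<in> carrier G"
      have "\<mu> (x \<otimes>\<^bsub>G\<^esub> y \<otimes>\<^bsub>G\<^esub> inv\<^bsub>G\<^esub> s (\<pi> (x \<otimes>\<^bsub>G\<^esub> y))) =
          \<mu> (x \<otimes>\<^bsub>G\<^esub> inv\<^bsub>G\<^esub> s (\<pi> x)) \<otimes>\<^bsub>N\<^esub> \<phi> (\<pi> x) (\<mu> (y \<otimes>\<^bsub>G\<^esub> inv\<^bsub>G\<^esub> s (\<pi> y)))"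
      proof (rule \<nu>_eq)
        show "\<nu> (\<mu> (x \<otimes>\<^bsub>G\<^esub> y \<otimes>\<^bsub>G\<^esub> inv\<^bsub>G\<^esub> s (\<pi> (x \<otimes>\<^bsub>G\<^esub> y)))) =
          \<nu> (\<mu> (x \<otimes>\<^bsub>G\<^esub> inv\<^bsub>G\<^esub> s (\<pi> x)) \<otimes>\<^bsub>N\<^esub> \<phi> (\<pi> x) (\<mu> (y \<otimes>\<^bsub>G\<^esub> inv\<^bsub>G\<^esub> s (\<pi> y))))"
          using xy k \<phi> k(2)[of "x \<otimes>\<^bsub>G\<^esub> y"]
          by (simp add: G.m_assoc G.inv_mult_group cancel)
      qed (use xy k k(1)[of "x \<otimes>\<^bsub>G\<^esub> y"] \<phi> in simp_all)
      then show "?f (x \<otimes>\<^bsub>G\<^esub> y) = ?f x \<otimes>\<^bsub>semidirect_product N Q \<phi>\<^esub> ?f y"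
        using xy by (simp add: semidirect_product_def)
    qed (simp add: semidirect_product_def k)
    moreover have "bij_betw ?f (carrier G) (carrier (semidirect_product N Q \<phi>))"
    proof (rule bij_betwI[where g = "\<lambda>(n, q). \<nu> n \<otimes>\<^bsub>G\<^esub> s q"])
      show "(case ?f g of (n, q) \<Rightarrow> \<nu> n \<otimes>\<^bsub>G\<^esub> s q) = g" if "g \<in> carrier G" for g
        using that k by (simp add: G.m_assoc)
      show "?f (case p of (n, q) \<Rightarrow> \<nu> n \<otimes>\<^bsub>G\<^esub> s q) = p" if p': "p \<in> carrier (semidirect_product N Q \<phi>)" for p
      proof -
        obtain n q where p: "p = (n, q)" "n \<in> carrier N" "q \<in> carrier Q"
          using p' by (auto simp: semidirect_product_def)
        have "\<mu> (\<nu> n) = n" using p(2) \<nu>(2) by (simp add: \<mu>_def)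
        then show ?thesis using p by (simp add: \<pi>\<nu> split G.m_assoc)
      qed
    qed (auto simp: semidirect_product_def k)
    ultimately show ?thesis by (auto simp: is_iso_def iso_def)
  qed
  ultimately show ?thesis unfolding is_semidirect_product_def by blast
qed

section \<open>Ranks of abelian groups\<close>

text \<open>Elimination of the last coordinate without division: with a pivot vector \<open>v t\<close>, the remaining vectors
  are replaced by \<open>v t n * v s - v s n * v t\<close>.\<close>

lemma int_vectors_dependent:
  fixes v :: "'a \<Rightarrow> nat \<Rightarrow> int"
  assumes "finite S" "card S > n"
  shows "\<exists>c. (\<forall>i<n. (\<Sum>s\<in>S. c s * v s i) = 0) \<and> (\<exists>s\<in>S. c s \<noteq> 0)"
  using assms
proof (induction n arbitrary: S v)
  case 0
  then have "S \<noteq> {}" by auto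
  then show ?case by (intro exI[of _ "\<lambda>_. 1"]) auto
next
  case (Suc n)
  show ?case
  proof (cases "\<exists>t\<in>S. v t n \<noteq> 0")
    case False
    obtain c where "\<forall>i<n. (\<Sum>s\<in>S. c s * v s i) = 0" "\<exists>s\<in>S. c s \<noteq> 0"
      using Suc.IH[of S v] Suc.prems by auto
    then show ?thesis using False by (intro exI[of _ c]) (auto simp: less_Suc_eq)
  next
    case True
    then obtain t where t: "t \<in> S" "v t n \<noteq> 0" by blast
    let ?T = "S - {t}"
    define w where "w s i = v t n * v s i - v s n * v t i" for s i
    have "card ?T > n" using Suc.prems t by simp
    then obtain m where m: "\<forall>i<n. (\<Sum>s\<in>?T. m s * w s i) = 0" and nz: "\<exists>s\<in>?T. m s \<noteq> 0"
      using Suc.IH[of ?T w] Suc.prems by auto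
    define c where "c s = (if s = t then - (\<Sum>s\<in>?T. m s * v s n) else m s * v t n)" for s
    have "(\<Sum>s\<in>S. c s * v s i) = (\<Sum>s\<in>?T. m s * w s i)" for i
    proof -
      have "(\<Sum>s\<in>S. c s * v s i) = c t * v t i + (\<Sum>s\<in>?T. c s * v s i)"
        using Suc.prems t(1) by (simp add: sum.remove)
      also have "(\<Sum>s\<in>?T. c s * v s i) = (\<Sum>s\<in>?T. m s * v t n * v s i)"
        by (rule sum.cong) (auto simp: c_def)
      also have "c t * v t i = (\<Sum>s\<in>?T. - (m s * v s n * v t i))"
        by (simp add: c_def sum_distrib_right sum_negf)
      finally show ?thesis by (simp add: w_def algebra_simps flip: sum.distrib)
    qed
    moreover have "(\<Sum>s\<in>?T. m s * w s n) = 0" by (simp add: w_def algebra_simps)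
    ultimately have "\<forall>i<Suc n. (\<Sum>s\<in>S. c s * v s i) = 0" using m by (auto simp: less_Suc_eq)
    moreover have "\<exists>s\<in>S. c s \<noteq> 0" using nz t by (auto simp: c_def)
    ultimately show ?thesis by blast
  qed
qed

text \<open>The coordinates embed \<open>A\<close> into \<open>\<int>\<^sup>n\<close>, and the elements \<open>e j\<close> go to the standard basis.\<close>

lemma coordinates_abelian_rank:
  assumes A: "comm_group A"
    and \<kappa>: "\<And>i. i < n \<Longrightarrow> \<kappa> i \<in> hom A integer_group"
    and inj: "\<And>x. x \<in> carrier A \<Longrightarrow> (\<And>i. i < n \<Longrightarrow> \<kappa> i x = 0) \<Longrightarrow> x = \<one>\<^bsub>A\<^esub>"
    and e: "\<And>j. j < n \<Longrightarrow> e j \<in> carrier A" "\<And>i j. i < n \<Longrightarrow> j < n \<Longrightarrow> \<kappa> i (e j) = (if i = j then 1 else 0)"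
  shows "abelian_rank A = enat n"
proof -
  interpret A: comm_group A by (rule A)
  have hom: "group_hom A integer_group (\<kappa> i)" if "i < n" for i
    using \<kappa>[OF that] A.is_group group_integer_group by (simp add: group_hom_def group_hom_axioms_def)
  have prod: "\<kappa> i (\<Otimes>\<^bsub>A\<^esub>s\<in>S. s [^]\<^bsub>A\<^esub> c s) = (\<Sum>s\<in>S. c s * \<kappa> i s)"
    if "i < n" "finite S" "S \<subseteq> carrier A" for i S and c :: "'a \<Rightarrow> int"
    using that(2,3)
  proof (induction S rule: finite_induct)
    case empty
    then show ?case using group_hom.hom_one[OF hom[OF that(1)]] by simp
  next
    case (insert x S)
    have "(\<Otimes>\<^bsub>A\<^esub>s\<in>insert x S. s [^]\<^bsub>A\<^esub> c s) = x [^]\<^bsub>A\<^esub> c x \<otimes>\<^bsub>A\<^esub> (\<Otimes>\<^bsub>A\<^esub>s\<in>S. s [^]\<^bsub>A\<^esub> c s)"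
      using insert by (intro A.finprod_insert) auto
    moreover have "(\<Otimes>\<^bsub>A\<^esub>s\<in>S. s [^]\<^bsub>A\<^esub> c s) \<in> carrier A" using insert by (intro A.finprod_closed) auto
    moreover have "\<kappa> i (x [^]\<^bsub>A\<^esub> c x) = c x * \<kappa> i x"
      using group_hom.hom_int_pow[OF hom[OF that(1)], of x "c x"] insert.prems by simp
    ultimately show ?case
      using insert group_hom.hom_mult[OF hom[OF that(1)]] by simp
  qed
  show ?thesis
  proof (rule antisym)
    show "abelian_rank A \<le> enat n"
      unfolding abelian_rank_def
    proof (rule SUP_least)
      fix S assume "S \<in> {S. int_independent A S}"
      then have S: "finite S" "S \<subseteq> carrier A"
        "\<And>c :: 'a \<Rightarrow> int. (\<Otimes>\<^bsub>A\<^esub>s\<in>S. s [^]\<^bsub>A\<^esub> c s) = \<one>\<^bsub>A\<^esub> \<Longrightarrow> \<forall>s\<in>S. c s = 0"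
        by (auto simp: int_independent_def)
      show "enat (card S) \<le> enat n"
      proof (rule ccontr)
        assume "\<not> enat (card S) \<le> enat n"
        then have "card S > n" by simp
        then obtain c where c: "\<forall>i<n. (\<Sum>s\<in>S. c s * \<kappa> i s) = 0" "\<exists>s\<in>S. c s \<noteq> 0"
          using int_vectors_dependent[OF S(1), of n "\<lambda>s i. \<kappa> i s"] by blast
        have "(\<Otimes>\<^bsub>A\<^esub>s\<in>S. s [^]\<^bsub>A\<^esub> c s) = \<one>\<^bsub>A\<^esub>"
        proof (rule inj)
          show "(\<Otimes>\<^bsub>A\<^esub>s\<in>S. s [^]\<^bsub>A\<^esub> c s) \<in> carrier A" using S(2) by (intro A.finprod_closed) auto
        qed (use c(1) prod[OF _ S(1,2)] in simp)
        then show False using S(3) c(2) by blast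
      qed
    qed
    let ?S = "e ` {..<n}"
    have "inj_on e {..<n}"
    proof (rule inj_onI)
      fix i j assume "i \<in> {..<n}" "j \<in> {..<n}" "e i = e j"
      then show "i = j" using e(2)[of i i] e(2)[of i j] by (auto split: if_splits)
    qed
    then have card: "card ?S = n" by (simp add: card_image)
    have "int_independent A ?S"
      unfolding int_independent_def
    proof (intro conjI allI impI ballI)
      show S: "finite ?S" "?S \<subseteq> carrier A" using e(1) by auto
      fix c :: "'a \<Rightarrow> int" and s
      assume one: "(\<Otimes>\<^bsub>A\<^esub>s\<in>?S. s [^]\<^bsub>A\<^esub> c s) = \<one>\<^bsub>A\<^esub>" and "s \<in> ?S"
      then obtain i where i: "i < n" "s = e i" by auto
      have "0 = (\<Sum>s\<in>?S. c s * \<kappa> i s)"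
        using prod[OF i(1) S, of c] group_hom.hom_one[OF hom[OF i(1)]] by (simp add: one)
      also have "\<dots> = (\<Sum>s\<in>?S. if s = e i then c s else 0)"
      proof (rule sum.cong)
        fix s assume "s \<in> ?S"
        then obtain j where j: "j < n" "s = e j" by auto
        show "c s * \<kappa> i s = (if s = e i then c s else 0)"
          using e(2)[OF i(1) j(1)] e(2)[OF i(1) i(1)] j(2) by auto
      qed simp
      also have "\<dots> = c (e i)" using i(1) by simp
      finally show "c s = 0" using i(2) by simp
    qed
    then show "enat n \<le> abelian_rank A"
      unfolding abelian_rank_def using card by (metis SUP_upper mem_Collect_eq)
  qed
qed

section \<open>The first homology group\<close>

text \<open>Sending \<open>g\<close> to the class of \<open>[g]\<close> defines a homomorphism \<open>\<psi>\<close> from \<open>G\<close> to the first homology, by the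
  boundary formula \<open>\<partial>[g|h] = [h] - [gh] + [g]\<close>. It is onto and kills commutators. The coordinates \<open>\<kappa>\<close>
  extend additively to chains and vanish on boundaries, so they descend to homology. If all
  coordinates of \<open>\<psi> g\<close> vanish, then \<open>g\<close> is a product of commutators, and \<open>\<psi> g\<close> is trivial.\<close>

lemma rank_first_homology:
  assumes G: "group G"
    and \<kappa>: "\<And>i. i < n \<Longrightarrow> \<kappa> i \<in> hom G integer_group"
    and ker: "\<And>x. x \<in> carrier G \<Longrightarrow> (\<And>i. i < n \<Longrightarrow> \<kappa> i x = 0) \<Longrightarrow> x \<in> derived G (carrier G)"
    and e: "\<And>j. j < n \<Longrightarrow> e j \<in> carrier G" "\<And>i j. i < n \<Longrightarrow> j < n \<Longrightarrow> \<kappa> i (e j) = (if i = j then 1 else 0)"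
  shows "abelian_rank (integral_homology 1 G) = enat n"
proof -
  interpret G: group G by (rule G)
  define L where "L = {gs. length gs = 1 \<and> set gs \<subseteq> carrier G}"
  have L: "gs \<in> L \<longleftrightarrow> (\<exists>g\<in>carrier G. gs = [g])" for gs
    by (auto simp: L_def length_Suc_conv)
  define C where "C = free_Abelian_group L"
  interpret C: comm_group C unfolding C_def by (rule abelian_free_Abelian_group)
  have C_simps: "c \<in> carrier C \<longleftrightarrow> Poly_Mapping.keys c \<subseteq> L" "c \<otimes>\<^bsub>C\<^esub> d = c + d" "\<one>\<^bsub>C\<^esub> = 0" for c d
    by (simp_all add: C_def)
  have gen: "frag_of [g] \<in> carrier C" if "g \<in> carrier G" for g
    using that by (simp add: C_simps L)
  define B where "B = bar_boundary G ` carrier (bar_chains G 2)"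
  \<comment> \<open>The two faces of \<open>[g]\<close> are both the empty tuple and cancel.\<close>
  have cycle: "bar_boundary G c = 0" if "c \<in> carrier C" for c
    unfolding bar_boundary_def
  proof (rule frag_extend_eq_0)
    fix gs assume "gs \<in> Poly_Mapping.keys c"
    then have "gs \<in> L" using that unfolding C_simps by blast
    then obtain g where "gs = [g]" by (auto simp: L)
    then show "bar_boundary_basis G gs = 0" by (simp add: bar_boundary_basis_def)
  qed
  have d2: "bar_boundary G (frag_of [g, h]) = frag_of [h] + frag_of [g] - frag_of [g \<otimes>\<^bsub>G\<^esub> h]" for g h
    by (simp add: bar_boundary_def bar_boundary_basis_def)
  have chains2: "bar_chains G 2 = free_Abelian_group {gs. length gs = 2 \<and> set gs \<subseteq> carrier G}"
    by (simp add: bar_chains_def)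
  have B_induct: "P b" if "b \<in> B" "P 0" "\<And>x y. P x \<Longrightarrow> P y \<Longrightarrow> P (x - y)"
    "\<And>g h. g \<in> carrier G \<Longrightarrow> h \<in> carrier G \<Longrightarrow> P (frag_of [h] + frag_of [g] - frag_of [g \<otimes>\<^bsub>G\<^esub> h])" for P b
  proof -
    obtain c where c: "b = bar_boundary G c" "Poly_Mapping.keys c \<subseteq> {gs. length gs = 2 \<and> set gs \<subseteq> carrier G}"
      using \<open>b \<in> B\<close> by (auto simp: B_def chains2)
    have "P (bar_boundary G c)"
      using c(2)
    proof (rule free_Abelian_group_induct)
      show "P (bar_boundary G 0)" using that(2) by (simp add: bar_boundary_def)
      show "P (bar_boundary G (x - y))" if "P (bar_boundary G x)" "P (bar_boundary G y)" for x y
        using \<open>\<And>x y. P x \<Longrightarrow> P y \<Longrightarrow> P (x - y)\<close>[OF that] by (simp add: bar_boundary_def frag_extend_diff)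
      fix gs assume "gs \<in> {gs. length gs = 2 \<and> set gs \<subseteq> carrier G}"
      then obtain g h where "gs = [g, h]" "g \<in> carrier G" "h \<in> carrier G"
        by (auto simp: numeral_2_eq_2 length_Suc_conv)
      then show "P (bar_boundary G (frag_of gs))" using that(4) by (simp add: d2)
    qed
    then show ?thesis by (simp add: c(1))
  qed
  have B_diff: "x - y \<in> B" if xy: "x \<in> B" "y \<in> B" for x y
  proof -
    obtain c d where "x = bar_boundary G c" "y = bar_boundary G d"
      "c \<in> carrier (bar_chains G 2)" "d \<in> carrier (bar_chains G 2)"
      using xy by (auto simp: B_def)
    moreover have "c - d \<in> carrier (bar_chains G 2)"
      using calculation(3,4) keys_diff[of c d] by (auto simp: chains2)
    ultimately show ?thesis unfolding B_def
      by (intro image_eqI[of _ _ "c - d"]) (simp_all add: bar_boundary_def frag_extend_diff)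
  qed
  have B_gen: "frag_of [h] + frag_of [g] - frag_of [g \<otimes>\<^bsub>G\<^esub> h] \<in> B"
    if "g \<in> carrier G" "h \<in> carrier G" for g h
    unfolding B_def using that by (intro image_eqI[of _ _ "frag_of [g, h]"]) (simp_all add: d2 chains2)
  \<comment> \<open>The difference of a generating boundary with itself.\<close>
  have B_zero: "0 \<in> B" using B_diff[OF B_gen B_gen] G.one_closed by fastforce
  have B_C: "b \<in> carrier C" if "b \<in> B" for b
    using that
  proof (rule B_induct)
    show "x - y \<in> carrier C" if "x \<in> carrier C" "y \<in> carrier C" for x y
      using that keys_diff[of x y] by (auto simp: C_simps)
    fix g h assume gh: "g \<in> carrier G" "h \<in> carrier G"
    have "Poly_Mapping.keys (frag_of [h] + frag_of [g] - frag_of [g \<otimes>\<^bsub>G\<^esub> h]) \<subseteq> {[h], [g], [g \<otimes>\<^bsub>G\<^esub> h]}"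
      using keys_diff[of "frag_of [h] + frag_of [g]" "frag_of [g \<otimes>\<^bsub>G\<^esub> h]"] keys_add[of "frag_of [h]" "frag_of [g]"]
      by auto
    then show "frag_of [h] + frag_of [g] - frag_of [g \<otimes>\<^bsub>G\<^esub> h] \<in> carrier C"
      using gh by (auto simp: C_simps L)
  qed (simp add: C_simps)
  have C_inv: "inv\<^bsub>C\<^esub> c = - c" if "c \<in> carrier C" for c
    using that by (simp add: C_def)
  have B_sub: "subgroup B C"
  proof (rule C.subgroupI)
    show "inv\<^bsub>C\<^esub> b \<in> B" if "b \<in> B" for b
      using B_diff[OF B_zero that] C_inv[OF B_C[OF that]] by simp
    show "x \<otimes>\<^bsub>C\<^esub> y \<in> B" if "x \<in> B" "y \<in> B" for x y
      using B_diff[OF that(1) B_diff[OF B_zero that(2)]] by (simp add: C_simps)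
  qed (use B_C B_zero in auto)
  then have B_normal: "B \<lhd> C" by (rule C.normal_iff_subgroup[THEN iffD2])
  interpret B: normal B C by (rule B_normal)
  define H where "H = C Mod B"
  have homology: "integral_homology 1 G = H"
  proof -
    have eq: "bar_chains G 1 = C" by (simp add: bar_chains_def C_def L_def)
    have "{c \<in> carrier C. bar_boundary G c = 0} = carrier C" using cycle by auto
    moreover have "C\<lparr>carrier := carrier C\<rparr> = C" by simp
    ultimately show ?thesis unfolding integral_homology_def eq H_def B_def
      by (simp add: numeral_2_eq_2)
  qed
  interpret H: comm_group H unfolding H_def using B_sub by (rule C.abelian_FactGroup)
  define p where "p c = B #>\<^bsub>C\<^esub> c" for c
  have p_hom: "p \<in> hom C H" unfolding p_def[abs_def] H_def by (rule B.r_coset_hom_Mod)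
  then interpret p: group_hom C H p by unfold_locales
  have p_carrier: "carrier H = p ` carrier C" by (simp add: H_def p_def carrier_FactGroup image_def)
  have p_B: "p b = \<one>\<^bsub>H\<^esub>" if "b \<in> B" for b
    using C.coset_join2[OF B_C[OF that] B_sub that] by (simp add: p_def H_def)
  define \<psi> where "\<psi> g = p (frag_of [g])" for g
  have \<psi>_mult: "\<psi> (g \<otimes>\<^bsub>G\<^esub> h) = \<psi> g \<otimes>\<^bsub>H\<^esub> \<psi> h" if gh: "g \<in> carrier G" "h \<in> carrier G" for g h
  proof -
    let ?b = "frag_of [h] + frag_of [g] - frag_of [g \<otimes>\<^bsub>G\<^esub> h]"
    have "frag_of [g] \<otimes>\<^bsub>C\<^esub> frag_of [h] = ?b \<otimes>\<^bsub>C\<^esub> frag_of [g \<otimes>\<^bsub>G\<^esub> h]" by (simp add: C_simps)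
    then have "\<psi> g \<otimes>\<^bsub>H\<^esub> \<psi> h = p (?b \<otimes>\<^bsub>C\<^esub> frag_of [g \<otimes>\<^bsub>G\<^esub> h])"
      unfolding \<psi>_def using gen gh by (metis p.hom_mult)
    also have "\<dots> = p ?b \<otimes>\<^bsub>H\<^esub> \<psi> (g \<otimes>\<^bsub>G\<^esub> h)"
      unfolding \<psi>_def using gen gh B_C[OF B_gen[OF gh]] by (intro p.hom_mult) auto
    also have "\<dots> = \<psi> (g \<otimes>\<^bsub>G\<^esub> h)"
      using p_B[OF B_gen[OF gh]] gen gh by (simp add: \<psi>_def)
    finally show ?thesis ..
  qed
  have "\<psi> \<in> hom G H" using gen by (intro homI \<psi>_mult) (auto simp: \<psi>_def)
  then interpret \<psi>: group_hom G H \<psi> by unfold_locales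
  have \<psi>_derived: "\<psi> g = \<one>\<^bsub>H\<^esub>" if "g \<in> derived G (carrier G)" for g
  proof -
    have "\<psi> ` derived G (carrier G) = derived H (\<psi> ` carrier G)" by (rule \<psi>.derived_img[symmetric]) simp
    also have "\<dots> = {\<one>\<^bsub>H\<^esub>}" by (rule H.derived_eq_singleton) auto
    finally show ?thesis using that by blast
  qed
  have \<psi>_surj: "\<exists>g\<in>carrier G. p c = \<psi> g" if "c \<in> carrier C" for c
  proof -
    have "Poly_Mapping.keys c \<subseteq> L" using that by (simp add: C_simps)
    then show ?thesis
    proof (rule free_Abelian_group_induct)
      have "p 0 = \<psi> \<one>\<^bsub>G\<^esub>" using p.hom_one \<psi>.hom_one by (simp add: C_simps)
      then show "\<exists>g\<in>carrier G. p 0 = \<psi> g" by blast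
    next
      fix x y assume xy: "Poly_Mapping.keys x \<subseteq> L" "Poly_Mapping.keys y \<subseteq> L"
        "\<exists>g\<in>carrier G. p x = \<psi> g" "\<exists>g\<in>carrier G. p y = \<psi> g"
      then obtain g h where gh: "g \<in> carrier G" "p x = \<psi> g" "h \<in> carrier G" "p y = \<psi> h" by blast
      have C: "x \<in> carrier C" "y \<in> carrier C" using xy by (simp_all add: C_simps)
      have "x - y = x \<otimes>\<^bsub>C\<^esub> inv\<^bsub>C\<^esub> y" using C_inv[OF C(2)] by (simp add: C_simps)
      then have "p (x - y) = \<psi> (g \<otimes>\<^bsub>G\<^esub> inv\<^bsub>G\<^esub> h)" using C gh by simp
      then show "\<exists>g\<in>carrier G. p (x - y) = \<psi> g" using gh by blast
    qed (auto simp: L \<psi>_def)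
  qed
  have coord: "\<exists>l\<in>hom H integer_group. \<forall>g\<in>carrier G. l (\<psi> g) = \<kappa> i g" if i: "i < n" for i
  proof -
    interpret l: group_hom G integer_group "\<kappa> i"
      using \<kappa>[OF i] group_integer_group by (simp add: group_hom_def group_hom_axioms_def G)
    interpret Z: comm_group integer_group by (rule abelian_integer_group)
    obtain h where h: "h \<in> hom C integer_group" "\<And>x. x \<in> L \<Longrightarrow> h (frag_of x) = \<kappa> i (hd x)"
      unfolding C_def by (rule Z.free_Abelian_group_universal[of "\<lambda>x. \<kappa> i (hd x)" L]) auto
    interpret h: group_hom C integer_group h using h(1) by unfold_locales
    have h_gen: "h (frag_of [g]) = \<kappa> i g" if "g \<in> carrier G" for g using h(2)[of "[g]"] that by (simp add: L)
    have h_add: "h (x + y) = h x + h y" if "x \<in> carrier C" "y \<in> carrier C" for x y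
      using h.hom_mult[OF that] by (simp add: C_simps)
    have h_diff: "h (x - y) = h x - h y" if "x \<in> carrier C" "x - y \<in> carrier C" "y \<in> carrier C" for x y
      using h_add[OF that(2,3)] by simp
    have h_B: "b \<in> carrier C \<and> h b = 0" if "b \<in> B" for b
      using that
    proof (rule B_induct)
      show "0 \<in> carrier C \<and> h 0 = 0" using h.hom_one by (simp add: C_simps)
      show "x - y \<in> carrier C \<and> h (x - y) = 0" if "x \<in> carrier C \<and> h x = 0" "y \<in> carrier C \<and> h y = 0" for x y
      proof -
        have "x - y \<in> carrier C" using that keys_diff[of x y] by (auto simp: C_simps)
        then show ?thesis using h_diff[of x y] that by simp
      qed
      fix g k assume gk: "g \<in> carrier G" "k \<in> carrier G"
      let ?b = "frag_of [k] + frag_of [g] - frag_of [g \<otimes>\<^bsub>G\<^esub> k]"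
      have b: "?b \<in> carrier C" by (rule B_C[OF B_gen[OF gk]])
      have "frag_of [k] + frag_of [g] \<in> carrier C" using C.m_closed[OF gen gen] gk by (simp add: C_simps)
      then have "h ?b = h (frag_of [k]) + h (frag_of [g]) - h (frag_of [g \<otimes>\<^bsub>G\<^esub> k])"
        using b gen gk by (simp add: h_diff h_add)
      also have "\<dots> = 0" using gk l.hom_mult[OF gk] by (simp add: h_gen)
      finally show "?b \<in> carrier C \<and> h ?b = 0" using b by blast
    qed
    obtain l where l: "l \<in> hom (C Mod B) integer_group" "\<And>x. x \<in> carrier C \<Longrightarrow> l (B #>\<^bsub>C\<^esub> x) = h x"
    proof (rule FactGroup_universal[OF h(1) B_normal])
      fix x y assume xy: "x \<in> carrier C" "y \<in> carrier C" "B #>\<^bsub>C\<^esub> x = B #>\<^bsub>C\<^esub> y"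
      then have "x \<in> B #>\<^bsub>C\<^esub> y" using C.rcos_self[OF xy(1) B_sub] by simp
      then obtain b where b: "b \<in> B" "x = b + y" by (auto simp: r_coset_def C_simps)
      then show "h x = h y" using h_B[OF b(1)] xy(2) by (simp add: h_add)
    qed blast
    show ?thesis
    proof (rule bexI)
      show "\<forall>g\<in>carrier G. l (\<psi> g) = \<kappa> i g"
        using l(2) gen h_gen by (simp add: \<psi>_def p_def)
      show "l \<in> hom H integer_group" using l(1) by (simp add: H_def)
    qed
  qed
  then obtain l where l: "\<And>i. i < n \<Longrightarrow> l i \<in> hom H integer_group"
    "\<And>i g. i < n \<Longrightarrow> g \<in> carrier G \<Longrightarrow> l i (\<psi> g) = \<kappa> i g" by metis
  have "abelian_rank H = enat n"
  proof (rule coordinates_abelian_rank[where \<kappa> = l and e = "\<lambda>j. \<psi> (e j)"])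
    fix x assume x: "x \<in> carrier H" "\<And>i. i < n \<Longrightarrow> l i x = 0"
    then obtain c where "c \<in> carrier C" "x = p c" unfolding p_carrier by blast
    then obtain g where g: "g \<in> carrier G" "x = \<psi> g" using \<psi>_surj[of c] by blast
    then have "g \<in> derived G (carrier G)" using x(2) l(2) by (intro ker) auto
    then show "x = \<one>\<^bsub>H\<^esub>" using g(2) \<psi>_derived by simp
  qed (use l e H.is_group H.comm_group_axioms in auto)
  then show ?thesis by (simp only: homology)
qed

section \<open>The group fixing a finite set\<close>

locale fixed_points =
  fixes U :: "real set"
  assumes finU: "finite U" and U01: "U \<subseteq> {0<..<1}"
begin

definition H :: "(real \<Rightarrow> real) set" where
  "H = {f \<in> PLu. \<forall>x\<in>U. f x = x}"

definition V :: "real set" where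
  "V = insert 0 (insert 1 U)"

text \<open>The one-sided germs, written as a point together with \<open>True\<close> for right and \<open>False\<close> for left, at
  which the slope of an element fixing \<open>U\<close> can be prescribed. At rational points that are not dyadic
  the two slopes agree, and the right one is recorded; at irrational points both are 1.\<close>

definition slots :: "(real \<times> bool) set" where
  "slots = insert 0 (U \<inter> \<rat>) \<times> {True} \<union> insert 1 (U \<inter> \<D>) \<times> {False}"

definition slope :: "real \<times> bool \<Rightarrow> (real \<Rightarrow> real) \<Rightarrow> int" where
  "slope s f = (if snd s then rslope f (fst s) else lslope f (fst s))"

text \<open>Division by the period makes every integer occur as a coordinate.\<close>

definition coord :: "real \<times> bool \<Rightarrow> (real \<Rightarrow> real) \<Rightarrow> int" where
  "coord s f = slope s f div int (period (fst s))"

abbreviation H_group :: "(real \<Rightarrow> real) monoid" where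
  "H_group \<equiv> PL2_group\<lparr>carrier := H\<rparr>"

lemma H_iff: "f \<in> H \<longleftrightarrow> f \<in> PLu \<and> (\<forall>x\<in>U. f x = x)"
  by (simp add: H_def)

lemma H_PLu: "H \<subseteq> PLu"
  by (auto simp: H_def)

lemma H_PL2: "f \<in> H \<Longrightarrow> f \<in> PL2"
  using H_PLu support_inD(1) by blast

lemma H_fixes: assumes "f \<in> H" "v \<in> V" shows "f v = v"
  using assms support_inD(2)[of f "{0<..<1}" v] by (auto simp: H_def V_def)

lemma finV: "finite V"
  using finU by (simp add: V_def)

lemma V01: "v \<in> V \<Longrightarrow> 0 \<le> v \<and> v \<le> 1"
  using U01 by (auto simp: V_def)

lemma slots_V: "s \<in> slots \<Longrightarrow> fst s \<in> V"
  by (auto simp: slots_def V_def)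

lemma slots_Rats: "s \<in> slots \<Longrightarrow> fst s \<in> \<rat>"
  by (auto simp: slots_def dyadic_Rats)

lemma H_subgroup: "subgroup H PL2_group"
proof (rule PL2.subgroupI)
  have "id \<in> PLu" using subgroup.one_closed[OF support_in_subgroup] by simp
  then have "id \<in> H" by (simp add: H_def)
  then show "H \<noteq> {}" by blast
  show "H \<subseteq> carrier PL2_group" using H_PL2 by auto
  show "PL2_inv f \<in> H" if f: "f \<in> H" for f
  proof -
    have "PL2_inv f \<in> PLu"
      using subgroup.m_inv_closed[OF support_in_subgroup] f by (simp add: H_iff)
    moreover have "PL2_inv f x = x" if "x \<in> U" for x
      using PL2_inv_inverts(1)[OF H_PL2[OF f], of x] f that by (simp add: H_iff)
    ultimately show ?thesis by (simp add: H_iff)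
  qed
  show "f \<otimes>\<^bsub>PL2_group\<^esub> g \<in> H" if "f \<in> H" "g \<in> H" for f g
    using that subgroup.m_closed[OF support_in_subgroup, of f "{0<..<1}" g] by (simp add: H_iff)
qed

lemma H_group: "group H_group"
  by (rule PL2.subgroup_imp_group[OF H_subgroup])

text \<open>At a dyadic point the period is 1; this covers all left-hand slots.\<close>

lemma period_dvd_slope: assumes "s \<in> slots" "f \<in> H" shows "int (period (fst s)) dvd slope s f"
proof (cases "snd s")
  case True
  then show ?thesis
    using period(3)[OF slots_Rats[OF assms(1)] fixed_point_slopes(1)[OF H_PL2[OF assms(2)] H_fixes[OF assms(2) slots_V[OF assms(1)]]]]
    by (simp add: slope_def)
next
  case False
  then have "fst s \<in> \<D>" using assms(1) by (auto simp: slots_def)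
  then show ?thesis by (simp add: period_dyadic)
qed

lemma slope_compose: "s \<in> slots \<Longrightarrow> f \<in> H \<Longrightarrow> g \<in> H \<Longrightarrow> slope s (f \<circ> g) = slope s f + slope s g"
  using slopes_compose[OF H_PL2 H_PL2, of f g "fst s"] H_fixes[OF _ slots_V, of g s] by (simp add: slope_def)

lemma coord_hom: assumes "s \<in> slots" shows "coord s \<in> hom H_group integer_group"
proof (rule homI)
  fix f g assume "f \<in> carrier H_group" "g \<in> carrier H_group"
  then have fg: "f \<in> H" "g \<in> H" by simp_all
  show "coord s (f \<otimes>\<^bsub>H_group\<^esub> g) = coord s f \<otimes>\<^bsub>integer_group\<^esub> coord s g"
    using slope_compose[OF assms fg] period_dvd_slope[OF assms fg(1)]
    by (simp add: coord_def div_plus_div_distrib_dvd_left integer_group_def del: o_apply)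
qed (simp add: integer_group_def)

text \<open>Outside the unit interval \<open>f\<close> is the identity, which accounts for the left slope at 0 and the right
  slope at 1. All other slopes at points of \<open>V\<close> are recorded by a slot, agree with one that is, or are
  trivial because the point is irrational.\<close>

lemma coords_zero_imp_near_id:
  assumes f: "f \<in> H" and zero: "\<And>s. s \<in> slots \<Longrightarrow> coord s f = 0" and v: "v \<in> V"
  shows "\<forall>\<^sub>F y in nhds v. f y = y"
proof -
  note fP = H_PL2[OF f]
  have slope0: "slope s f = 0" if "s \<in> slots" for s
    using zero[OF that] period_dvd_slope[OF that f] dvd_div_mult_self[of "int (period (fst s))" "slope s f"]
    by (simp add: coord_def)
  note supp = support_inD(2)[OF subsetD[OF H_PLu f]]
  have "lslope f v = 0 \<and> rslope f v = 0"
  proof -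
    consider "v = 0" | "v = 1" | "v \<in> U" "v \<in> \<D>" | "v \<in> U" "v \<in> \<rat>" "v \<notin> \<D>" | "v \<in> U" "v \<notin> \<rat>"
      using v by (auto simp: V_def)
    then show ?thesis
    proof cases
      case 1
      have "rslope f 0 = 0" using slope0[of "(0, True)"] by (simp add: slots_def slope_def)
      moreover have "\<forall>y. y \<le> 0 \<longrightarrow> f y = id y" using supp by simp
      then have "lslope f 0 = lslope id 0"
        by (intro lslope_cong fP PL2_id always_eventually)
      ultimately show ?thesis using 1 by simp
    next
      case 2
      have "lslope f 1 = 0" using slope0[of "(1, False)"] by (simp add: slots_def slope_def)
      moreover have "\<forall>y. 1 \<le> y \<longrightarrow> f y = id y" using supp by simp
      then have "rslope f 1 = rslope id 1"
        by (intro rslope_cong fP PL2_id always_eventually)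
      ultimately show ?thesis using 2 by simp
    next
      case 3
      then show ?thesis using slope0[of "(v, True)"] slope0[of "(v, False)"] dyadic_Rats[of v]
        by (simp add: slots_def slope_def)
    next
      case 4
      then have "rslope f v = 0" using slope0[of "(v, True)"] by (simp add: slots_def slope_def)
      then show ?thesis using fixed_point_slopes(2)[OF fP H_fixes[OF f v] 4(3)] by simp
    next
      case 5
      then show ?thesis using irrational_fixed_point_slope[OF fP H_fixes[OF f v]] by simp
    qed
  qed
  then show ?thesis using near_id_iff[OF fP] H_fixes[OF f v] by simp
qed

lemma near_id_imp_coord_zero:
  assumes "\<forall>\<^sub>F y in nhds (fst s). f y = y" shows "coord s f = 0"
  using slopes_near_id[OF assms] by (simp add: coord_def slope_def)

text \<open>Each slot \<open>s\<close> gets a bump \<open>g s\<close> of coordinate 1, and \<open>\<sigma> q\<close> is the patch of the powers of the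
  bumps with exponents \<open>q s\<close>. It is additive in \<open>q\<close> since bumps with disjoint supports commute. Next to
  the slot \<open>s\<close> only the bump \<open>g s\<close> moves points.\<close>

lemma sections_exist:
  obtains \<sigma> :: "((real \<times> bool) \<Rightarrow> int) \<Rightarrow> real \<Rightarrow> real" where
    "\<And>q. \<sigma> q \<in> H" "\<And>q q'. \<sigma> (\<lambda>s. q s + q' s) = \<sigma> q \<circ> \<sigma> q'" "\<And>q s. s \<in> slots \<Longrightarrow> coord s (\<sigma> q) = q s"
proof -
  obtain e where e: "e > 0" "\<And>u v. u \<in> V \<Longrightarrow> v \<in> V \<Longrightarrow> u < v \<Longrightarrow> u + e \<le> v - e"
    using finite_set_separated[OF finV] by blast
  \<comment> \<open>At a dyadic point the left and the right slot need separate supports; at any other point there is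
    only one slot, and its bump acts on both sides.\<close>
  define W where "W s = (if fst s \<in> \<D> then if snd s then {fst s<..<fst s + e} else {fst s - e<..<fst s}
    else {fst s - e<..<fst s + e})" for s
  have W_near: "W s \<subseteq> {fst s - e<..<fst s + e}" for s using e(1) by (auto simp: W_def)
  have disj_pts: "{u - e<..<u + e} \<inter> {v - e<..<v + e} = {}" if "u \<in> V" "v \<in> V" "u \<noteq> v" for u v
    using e(2)[of u v] e(2)[of v u] that by (cases u v rule: linorder_cases) auto
  have disj: "disjoint_family_on W slots"
    unfolding disjoint_family_on_def
  proof (intro ballI impI)
    fix s t assume st: "s \<in> slots" "t \<in> slots" "s \<noteq> t"
    show "W s \<inter> W t = {}"
    proof (cases "fst s = fst t")
      case True
      then have "snd s \<noteq> snd t" using st(3) by (auto simp: prod_eq_iff)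
      moreover have "fst s \<in> \<D>" using st True \<open>snd s \<noteq> snd t\<close> by (auto simp: slots_def)
      ultimately show ?thesis using True by (auto simp: W_def)
    next
      case False
      then show ?thesis
        using disj_pts[OF slots_V[OF st(1)] slots_V[OF st(2)]] W_near[of s] W_near[of t] by blast
    qed
  qed
  have V_W: "v = fst s" if "v \<in> V" "s \<in> slots" "v \<in> W s" for v s
  proof (rule ccontr)
    assume "v \<noteq> fst s"
    then have "{v - e<..<v + e} \<inter> {fst s - e<..<fst s + e} = {}"
      by (intro disj_pts that slots_V)
    moreover have "v \<in> {v - e<..<v + e}" using e(1) by simp
    moreover have "v \<in> {fst s - e<..<fst s + e}" using W_near that(3) by blast
    ultimately show False by blast
  qed
  have W01: "W s \<subseteq> {0<..<1}" if s: "s \<in> slots" for s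
  proof -
    have V: "0 \<in> V" "1 \<in> V" "fst s \<in> V" using slots_V[OF s] by (auto simp: V_def)
    consider "fst s = 0" "snd s" | "fst s = 1" "\<not> snd s" | "fst s \<in> U" using s by (auto simp: slots_def)
    then show ?thesis
    proof cases
      case 1
      then show ?thesis using e(2)[OF V(1,2)] e(1) by (auto simp: W_def)
    next
      case 2
      then show ?thesis using e(2)[OF V(1,2)] e(1) by (auto simp: W_def)
    next
      case 3
      then have "0 < fst s" "fst s < 1" using U01 by auto
      then have "0 + e \<le> fst s - e" "fst s + e \<le> 1 - e" using e(2)[OF V(1,3)] e(2)[OF V(3,2)] by auto
      then show ?thesis using W_near[of s] e(1) by (auto dest!: subsetD)
    qed
  qed
  have "\<exists>g. g \<in> support_in (W s) \<and> g (fst s) = fst s \<and> slope s g = int (period (fst s))" if s: "s \<in> slots" for s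
  proof (cases "fst s \<in> \<D>")
    case True
    show ?thesis
    proof (cases "snd s")
      case t: True
      obtain g where g: "g \<in> support_in {fst s<..<fst s + e}" "has_slopes g (fst s) 0 1"
        by (rule PL2_right_bump[OF True e(1)])
      then show ?thesis using True t slopes_eqI[OF g(2)] support_inD(2)[OF g(1), of "fst s"]
        by (intro exI[of _ g]) (simp add: W_def slope_def period_dyadic)
    next
      case f: False
      obtain g where g: "g \<in> support_in {fst s - e<..<fst s}" "has_slopes g (fst s) 1 0"
        by (rule PL2_left_bump[OF True e(1)])
      then show ?thesis using True f slopes_eqI[OF g(2)] support_inD(2)[OF g(1), of "fst s"]
        by (intro exI[of _ g]) (simp add: W_def slope_def period_dyadic)
    qed
  next
    case False
    obtain g where g: "g \<in> support_in {fst s - e<..<fst s + e}" "g (fst s) = fst s"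
      "has_slopes g (fst s) (int (period (fst s))) (int (period (fst s)))"
      by (rule PL2_bump[OF period(2)[OF slots_Rats[OF s]] e(1)])
    then show ?thesis using False slopes_eqI[OF g(3)]
      by (intro exI[of _ g]) (simp add: W_def slope_def)
  qed
  then obtain g where g: "\<And>s. s \<in> slots \<Longrightarrow> g s \<in> support_in (W s)"
    "\<And>s. s \<in> slots \<Longrightarrow> g s (fst s) = fst s" "\<And>s. s \<in> slots \<Longrightarrow> slope s (g s) = int (period (fst s))"
    by metis
  have gH: "g s \<in> H" if s: "s \<in> slots" for s
  proof -
    have "g s \<in> PLu" using g(1)[OF s] W01[OF s] support_in_mono by blast
    moreover have "g s x = x" if "x \<in> U" for x
      using V_W[of x s] that s g(2)[OF s] support_inD(2)[OF g(1)[OF s], of x] by (auto simp: V_def)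
    ultimately show ?thesis by (simp add: H_iff)
  qed
  define p where "p q s = g s [^]\<^bsub>PL2_group\<^esub> (q s :: int)" for q s
  have p_supp: "p q s \<in> support_in (W s)" if "s \<in> slots" for q s
    unfolding p_def using PL2.subgroup_int_pow_closed[OF support_in_subgroup g(1)[OF that]] .
  have pH: "p q s \<in> H" if "s \<in> slots" for q s
    unfolding p_def using PL2.subgroup_int_pow_closed[OF H_subgroup gH[OF that]] .
  have fin: "finite slots" using finU by (simp add: slots_def)
  define \<sigma> where "\<sigma> q = patch slots W (p q)" for q
  have \<sigma>H: "\<sigma> q \<in> H" for q
    unfolding \<sigma>_def by (rule patch_in_subgroup[OF fin disj p_supp H_subgroup pH])
  show thesis
  proof (rule that[of \<sigma>])
    show "\<sigma> q \<in> H" for q by (rule \<sigma>H)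
    show "\<sigma> (\<lambda>s. q s + q' s) = \<sigma> q \<circ> \<sigma> q'" for q q'
    proof -
      have "p (\<lambda>s. q s + q' s) s = p q s \<circ> p q' s" if "s \<in> slots" for s
        using PL2.int_pow_mult[of "g s" "q s" "q' s"] H_PL2[OF gH[OF that]] by (simp add: p_def)
      then have "\<sigma> (\<lambda>s. q s + q' s) = patch slots W (\<lambda>s. p q s \<circ> p q' s)"
        unfolding \<sigma>_def by (rule patch_cong)
      also have "\<dots> = \<sigma> q \<circ> \<sigma> q'" unfolding \<sigma>_def by (rule patch_compose[OF disj p_supp, symmetric])
      finally show ?thesis .
    qed
    show "coord s (\<sigma> q) = q s" if s: "s \<in> slots" for s q
    proof -
      have nh: "\<forall>\<^sub>F y in nhds (fst s). y \<in> {fst s - e<..<fst s + e}"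
        using e(1) by (intro eventually_nhds_in_open) auto
      have fx: "\<sigma> q (fst s) = fst s" "p q s (fst s) = fst s"
        using H_fixes[OF \<sigma>H slots_V[OF s]] H_fixes[OF pH[OF s] slots_V[OF s]] by auto
      have eq: "\<sigma> q y = p q s y" if "y \<in> W s" for y
        unfolding \<sigma>_def using patch_in[OF disj s that] .
      have "slope s (\<sigma> q) = slope s (p q s)"
      proof (cases "snd s")
        case True
        have "\<forall>\<^sub>F y in nhds (fst s). fst s \<le> y \<longrightarrow> \<sigma> q y = p q s y"
          using nh
        proof eventually_elim
          case (elim y)
          then show ?case using True fx by (cases "y = fst s") (auto intro!: eq simp: W_def)
        qed
        then show ?thesis using True rslope_cong[OF H_PL2[OF \<sigma>H] H_PL2[OF pH[OF s]]] by (simp add: slope_def)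
      next
        case False
        then have "fst s \<in> \<D>" using s by (auto simp: slots_def)
        have "\<forall>\<^sub>F y in nhds (fst s). y \<le> fst s \<longrightarrow> \<sigma> q y = p q s y"
          using nh
        proof eventually_elim
          case (elim y)
          then show ?case using False fx \<open>fst s \<in> \<D>\<close> by (cases "y = fst s") (auto intro!: eq simp: W_def)
        qed
        then show ?thesis using False lslope_cong[OF H_PL2[OF \<sigma>H] H_PL2[OF pH[OF s]]] by (simp add: slope_def)
      qed
      then have "coord s (\<sigma> q) = coord s (p q s)" by (simp add: coord_def)
      also have "p q s = g s [^]\<^bsub>H_group\<^esub> q s"
        unfolding p_def by (rule PL2.int_pow_consistent[OF H_subgroup gH[OF s]])
      also have "coord s \<dots> = coord s (g s) [^]\<^bsub>integer_group\<^esub> q s"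
        using gH[OF s] by (intro hom_int_pow[OF coord_hom[OF s]] H_group group_integer_group) simp
      also have "coord s (g s) = 1"
        using g(3)[OF s] period(1)[OF slots_Rats[OF s]] by (simp add: coord_def)
      finally show ?thesis by simp
    qed
  qed
qed

end

context fixed_points
begin

definition kernel_H :: "(real \<Rightarrow> real) set" where
  "kernel_H = {f \<in> H. \<forall>s\<in>slots. coord s f = 0}"

lemma kernel_H_subgroup: "subgroup kernel_H PL2_group"
proof (rule PL2.subgroupI)
  note hom = coord_hom[THEN hom_mult]
  show "kernel_H \<subseteq> carrier PL2_group" using H_PL2 by (auto simp: kernel_H_def)
  have "id \<in> H" using subgroup.one_closed[OF H_subgroup] by simp
  then have "id \<in> kernel_H" by (simp add: kernel_H_def coord_def slope_def)
  then show "kernel_H \<noteq> {}" by blast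
  show "f \<otimes>\<^bsub>PL2_group\<^esub> g \<in> kernel_H" if fg: "f \<in> kernel_H" "g \<in> kernel_H" for f g
  proof -
    have H: "f \<in> H" "g \<in> H" using fg by (auto simp: kernel_H_def)
    have "coord s (f \<circ> g) = 0" if "s \<in> slots" for s
      using hom[OF that, of f g] H fg that by (simp add: kernel_H_def integer_group_def del: o_apply)
    then show ?thesis using subgroup.m_closed[OF H_subgroup H] by (simp add: kernel_H_def)
  qed
  show "PL2_inv f \<in> kernel_H" if f: "f \<in> kernel_H" for f
  proof -
    have H: "f \<in> H" "PL2_inv f \<in> H"
      using f subgroup.m_inv_closed[OF H_subgroup] by (auto simp: kernel_H_def)
    have id: "f \<circ> PL2_inv f = id" using PL2_inv_inverts[OF H_PL2[OF H(1)]] by (simp add: fun_eq_iff)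
    have "coord s (PL2_inv f) = 0" if s: "s \<in> slots" for s
    proof -
      have "coord s (f \<circ> PL2_inv f) = coord s f + coord s (PL2_inv f)"
        using hom[OF s, of f "PL2_inv f"] H by (simp add: integer_group_def del: o_apply)
      moreover have "coord s id = 0" by (simp add: coord_def slope_def)
      ultimately show ?thesis using f s by (simp add: id kernel_H_def)
    qed
    then show ?thesis using H(2) by (simp add: kernel_H_def)
  qed
qed

lemma gaps:
  obtains x where "strict_mono_on {..Suc (card U)} x" "x ` {..Suc (card U)} = V"
    "\<And>y. y \<in> {0<..<1} \<Longrightarrow> y \<notin> V \<Longrightarrow> \<exists>i<Suc (card U). x i < y \<and> y < x (Suc i)"
proof -
  have "0 \<notin> insert 1 U" "1 \<notin> U" using U01 by auto
  then have "card V = Suc (Suc (card U))" using finU by (simp add: V_def)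
  then obtain x where x: "strict_mono_on {..Suc (card U)} x" "V = x ` {..Suc (card U)}"
    using finite_set_enumeration[OF finV] by blast
  let ?n = "Suc (card U)"
  have cover: "\<exists>i<?n. x i < y \<and> y < x (Suc i)" if y: "y \<in> {0<..<1}" "y \<notin> V" for y
  proof (rule ccontr)
    assume none: "\<not> ?thesis"
    have le: "x i < y" if "i \<le> ?n" for i
      using that
    proof (induction i)
      case 0
      have "0 \<in> V" by (simp add: V_def)
      then obtain j where j: "j \<le> ?n" "0 = x j" using x(2) by auto
      have "x 0 \<le> x j" using x(1) j(1) by (auto simp: strict_mono_on_leD)
      then show ?case using j(2) y(1) by simp
    next
      case (Suc i)
      then have "\<not> y < x (Suc i)" using none by auto
      moreover have "x (Suc i) \<in> V" using Suc.prems x(2) by simp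
      ultimately show ?case using y(2) by (cases "x (Suc i) = y") auto
    qed
    have "1 \<in> V" by (simp add: V_def)
    then obtain j where "j \<le> ?n" "1 = x j" using x(2) by auto
    then show False using le[of j] y(1) by simp
  qed
  show thesis by (rule that[OF x(1) x(2)[symmetric] cover])
qed

text \<open>An element with vanishing coordinates is the identity near each point of \<open>V\<close>, so it can be cut there
  into pieces with compact supports in the gaps.\<close>

lemma kernel_H_structure:
  obtains a b :: "nat \<Rightarrow> real" and W where "\<And>i. i \<in> {..<card U + 1} \<Longrightarrow> a i < b i"
    "W = (\<lambda>i. {a i<..<b i})" "disjoint_family_on W {..<card U + 1}"
    "\<And>i. i \<in> {..<card U + 1} \<Longrightarrow> compact_support_in (W i) \<subseteq> kernel_H"
    "\<And>f. f \<in> kernel_H \<Longrightarrow> \<exists>g. (\<forall>i\<in>{..<card U + 1}. g i \<in> compact_support_in (W i)) \<and> f = patch {..<card U + 1} W g"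
proof -
  obtain x where x: "strict_mono_on {..Suc (card U)} x" "x ` {..Suc (card U)} = V"
    and cover: "\<And>y. y \<in> {0<..<1} \<Longrightarrow> y \<notin> V \<Longrightarrow> \<exists>i<Suc (card U). x i < y \<and> y < x (Suc i)"
    by (rule gaps) (rule that)
  define W where "W = (\<lambda>i. {x i<..<x (Suc i)})"
  have lt: "x i < x (Suc i)" if "i < Suc (card U)" for i
    using x(1) that by (auto simp: strict_mono_on_def)
  have le: "x i \<le> x j" if "i \<le> j" "j \<le> Suc (card U)" for i j
    using x(1) that by (auto intro: strict_mono_on_leD)
  have xV: "x i \<in> V" if "i \<le> Suc (card U)" for i using that x(2) by blast
  have V_gap: "v \<le> x i \<or> x (Suc i) \<le> v" if "v \<in> V" "i < Suc (card U)" for v i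
  proof -
    obtain j where j: "j \<le> Suc (card U)" "v = x j" using \<open>v \<in> V\<close> x(2) by auto
    then show ?thesis using le[of j i] le[of "Suc i" j] that(2) by (cases "j \<le> i") auto
  qed
  have disj_less: "W i \<inter> W j = {}" if "i < j" "j < Suc (card U)" for i j
  proof -
    have "x (Suc i) \<le> x j" using le that by simp
    then show ?thesis by (auto simp: W_def)
  qed
  have disj: "disjoint_family_on W {..<card U + 1}"
    unfolding disjoint_family_on_def
  proof (intro ballI impI)
    fix i j assume ij: "i \<in> {..<card U + 1}" "j \<in> {..<card U + 1}" "i \<noteq> j"
    then consider "i < j" | "j < i" by linarith
    then show "W i \<inter> W j = {}"
      using ij disj_less[of i j] disj_less[of j i] by cases (simp_all add: Int_commute)
  qed
  have sub: "compact_support_in (W i) \<subseteq> kernel_H" if i: "i \<in> {..<card U + 1}" for i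
  proof
    fix f assume f: "f \<in> compact_support_in (W i)"
    then have supp: "f \<in> support_in (W i)"
      using support_in_mono unfolding compact_support_in_def by blast
    have "0 \<le> x i" "x (Suc i) \<le> 1" using V01[OF xV] i by auto
    then have "W i \<subseteq> {0<..<1}" by (auto simp: W_def)
    then have "f \<in> PLu" using supp support_in_mono by blast
    moreover have near: "\<forall>\<^sub>F y in nhds v. f y = y" if "v \<in> V" for v
      using compact_support_near_end[OF f[unfolded W_def]] V_gap[OF that] i by auto
    then have "f v = v" if "v \<in> U" for v
      using that eventually_nhds_x_imp_x[OF near[of v]] by (simp add: V_def)
    ultimately have "f \<in> H" by (simp add: H_iff)
    then show "f \<in> kernel_H"
      using near near_id_imp_coord_zero slots_V by (simp add: kernel_H_def)
  qed
  have dec: "\<exists>g. (\<forall>i\<in>{..<card U + 1}. g i \<in> compact_support_in (W i)) \<and> f = patch {..<card U + 1} W g"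
    if f: "f \<in> kernel_H" for f
  proof -
    have fH: "f \<in> H" using f by (simp add: kernel_H_def)
    have near: "\<forall>\<^sub>F y in nhds v. f y = y" if "v \<in> V" for v
      using coords_zero_imp_near_id[OF fH _ that] f by (simp add: kernel_H_def)
    have "\<forall>i\<in>{..<card U + 1}. \<exists>g\<in>compact_support_in (W i). \<forall>y\<in>W i. g y = f y"
      unfolding W_def using lt near xV H_PL2[OF fH] by (intro ballI restrict_to_interval) auto
    then obtain g where g: "\<forall>i\<in>{..<card U + 1}. g i \<in> compact_support_in (W i) \<and> (\<forall>y\<in>W i. g i y = f y)"
      by metis
    have "f y = patch {..<card U + 1} W g y" for y
    proof (cases "\<exists>i\<in>{..<card U + 1}. y \<in> W i")
      case True
      then obtain i where i: "i \<in> {..<card U + 1}" "y \<in> W i" by blast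
      then show ?thesis using patch_in[OF disj i, of g] g by simp
    next
      case False
      then have "y \<notin> {0<..<1} \<or> y \<in> V" using cover[of y] by (auto simp: W_def)
      then have "f y = y" using H_fixes[OF fH] support_inD(2)[OF subsetD[OF H_PLu fH]] by blast
      moreover have "patch {..<card U + 1} W g y = y" using False by (intro patch_outside) blast
      ultimately show ?thesis by simp
    qed
    then show ?thesis using g by blast
  qed
  show thesis by (rule that[OF _ W_def disj sub dec]) (use lt in auto)
qed

text \<open>Each piece of the kernel lies in a perfect subgroup of \<open>H\<close>.\<close>

lemma kernel_H_in_derived: "kernel_H \<subseteq> derived PL2_group H"
proof -
  obtain a b :: "nat \<Rightarrow> real" and W where ab: "\<And>i. i \<in> {..<card U + 1} \<Longrightarrow> a i < b i"
    and W: "W = (\<lambda>i. {a i<..<b i})" and disj: "disjoint_family_on W {..<card U + 1}"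
    and sub: "\<And>i. i \<in> {..<card U + 1} \<Longrightarrow> compact_support_in (W i) \<subseteq> kernel_H"
    and dec: "\<And>f. f \<in> kernel_H \<Longrightarrow> \<exists>g. (\<forall>i\<in>{..<card U + 1}. g i \<in> compact_support_in (W i)) \<and> f = patch {..<card U + 1} W g"
    by (rule kernel_H_structure) (rule that)
  have K: "compact_support_in (W i) \<subseteq> derived PL2_group H" if i: "i \<in> {..<card U + 1}" for i
  proof -
    have "compact_support_in (W i) \<subseteq> H" using sub[OF i] by (auto simp: kernel_H_def)
    then have "derived PL2_group (compact_support_in (W i)) \<subseteq> derived PL2_group H" by (rule PL2.mono_derived)
    then show ?thesis using compact_support_perfect[OF ab[OF i]] by (simp add: W)
  qed
  show ?thesis
  proof
    fix f assume "f \<in> kernel_H"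
    then obtain g where g: "\<forall>i\<in>{..<card U + 1}. g i \<in> compact_support_in (W i)" "f = patch {..<card U + 1} W g"
      using dec by blast
    show "f \<in> derived PL2_group H"
      unfolding g(2)
    proof (rule patch_in_subgroup[OF _ disj])
      show "g i \<in> support_in (W i)" if "i \<in> {..<card U + 1}" for i
        using g(1) that support_in_mono unfolding compact_support_in_def by blast
      show "subgroup (derived PL2_group H) PL2_group" using H_PL2 by (intro PL2.derived_is_subgroup) auto
    qed (use g(1) K in auto)
  qed
qed

text \<open>The factor with index \<open>i\<close> is identified with the compactly supported group on the gap number \<open>i\<close>, and
  the resulting elements are patched together.\<close>

lemma kernel_H_is_power:
  obtains \<nu> where "\<nu> \<in> hom (group_power derived_F (card U + 1)) H_group"
    "inj_on \<nu> (carrier (group_power derived_F (card U + 1)))"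
    "\<nu> ` carrier (group_power derived_F (card U + 1)) = kernel_H"
proof -
  let ?I = "{..<card U + 1}"
  obtain a b :: "nat \<Rightarrow> real" and W where ab: "\<And>i. i \<in> ?I \<Longrightarrow> a i < b i"
    and W: "W = (\<lambda>i. {a i<..<b i})" and disj: "disjoint_family_on W ?I"
    and sub: "\<And>i. i \<in> ?I \<Longrightarrow> compact_support_in (W i) \<subseteq> kernel_H"
    and dec: "\<And>f. f \<in> kernel_H \<Longrightarrow> \<exists>g. (\<forall>i\<in>?I. g i \<in> compact_support_in (W i)) \<and> f = patch ?I W g"
    by (rule kernel_H_structure) (rule that)
  let ?K = "\<lambda>i. PL2_group\<lparr>carrier := compact_support_in (W i)\<rparr>"
  have "\<forall>i\<in>?I. \<exists>h. h \<in> iso derived_F (?K i)"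
    using derived_F_iso_compact_support[OF ab] by (auto simp: W is_iso_def)
  then obtain h where h: "\<And>i. i \<in> ?I \<Longrightarrow> h i \<in> iso derived_F (?K i)" by metis
  have h_hom: "h i (s \<otimes>\<^bsub>derived_F\<^esub> t) = h i s \<circ> h i t"
    if "i \<in> ?I" "s \<in> carrier derived_F" "t \<in> carrier derived_F" for i s t
    using h[OF that(1)] hom_mult[of "h i" derived_F "?K i" s t] that by (simp add: iso_def)
  have h_bij: "bij_betw (h i) (carrier derived_F) (compact_support_in (W i))" if "i \<in> ?I" for i
    using h[OF that] by (simp add: iso_def)
  have h_in: "h i s \<in> compact_support_in (W i)" if "i \<in> ?I" "s \<in> carrier derived_F" for i s
    using h_bij[OF that(1)] that(2) by (rule bij_betwE[rule_format])
  have supp: "f \<in> support_in (W i)" if "f \<in> compact_support_in (W i)" for f i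
    using that support_in_mono unfolding compact_support_in_def by blast
  define \<nu> where "\<nu> t = patch ?I W (\<lambda>i. h i (t i))" for t
  let ?N = "group_power derived_F (card U + 1)"
  have N: "carrier ?N = (\<Pi>\<^sub>E i\<in>?I. carrier derived_F)" "s \<otimes>\<^bsub>?N\<^esub> t = (\<lambda>i\<in>?I. s i \<otimes>\<^bsub>derived_F\<^esub> t i)" for s t
    by (simp_all add: group_power_def)
  have t_in: "t i \<in> carrier derived_F" if "t \<in> carrier ?N" "i \<in> ?I" for t i
    using that unfolding N by (rule PiE_mem)
  have ker: "\<nu> t \<in> kernel_H" if "t \<in> carrier ?N" for t
    unfolding \<nu>_def
  proof (rule patch_in_subgroup[OF _ disj _ kernel_H_subgroup])
    fix i assume i: "i \<in> ?I"
    have "h i (t i) \<in> compact_support_in (W i)" by (rule h_in[OF i t_in[OF that i]])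
    then show "h i (t i) \<in> support_in (W i)" "h i (t i) \<in> kernel_H" using supp sub[OF i] by blast+
  qed simp
  show thesis
  proof (rule that[of \<nu>])
    show "\<nu> \<in> hom ?N H_group"
    proof (rule homI)
      show "\<nu> t \<in> carrier H_group" if "t \<in> carrier ?N" for t
        using ker[OF that] by (simp add: kernel_H_def)
      fix s t assume st: "s \<in> carrier ?N" "t \<in> carrier ?N"
      have "\<nu> (s \<otimes>\<^bsub>?N\<^esub> t) = patch ?I W (\<lambda>i. h i (s i) \<circ> h i (t i))"
        unfolding \<nu>_def N(2)
        by (rule patch_cong) (simp add: h_hom t_in[OF st(1)] t_in[OF st(2)] del: lessThan_iff o_apply)
      also have "\<dots> = \<nu> s \<circ> \<nu> t"
        unfolding \<nu>_def
        by (rule patch_compose[OF disj, symmetric]) (intro supp h_in t_in[OF st(2)])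
      finally show "\<nu> (s \<otimes>\<^bsub>?N\<^esub> t) = \<nu> s \<otimes>\<^bsub>H_group\<^esub> \<nu> t" by simp
    qed
    show "inj_on \<nu> (carrier ?N)"
    proof (rule inj_onI)
      fix s t assume st: "s \<in> carrier ?N" "t \<in> carrier ?N" "\<nu> s = \<nu> t"
      show "s = t"
      proof (rule PiE_ext[OF st(1,2)[unfolded N]])
        fix i assume i: "i \<in> ?I"
        have "h i (s i) y = h i (t i) y" for y
        proof (cases "y \<in> W i")
          case True
          then show ?thesis
            using fun_cong[OF st(3), of y] patch_in[OF disj i True] by (simp add: \<nu>_def)
        next
          case False
          then show ?thesis
            using support_inD(2)[OF supp[OF h_in[OF i t_in[OF st(1) i]]] False]
              support_inD(2)[OF supp[OF h_in[OF i t_in[OF st(2) i]]] False] by simp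
        qed
        then have "h i (s i) = h i (t i)" by blast
        then show "s i = t i"
          using inj_onD[OF bij_betw_imp_inj_on[OF h_bij[OF i]]] t_in[OF st(1) i] t_in[OF st(2) i] by blast
      qed
    qed
    show "\<nu> ` carrier ?N = kernel_H"
    proof
      show "\<nu> ` carrier ?N \<subseteq> kernel_H" using ker by blast
      show "kernel_H \<subseteq> \<nu> ` carrier ?N"
      proof
        fix f assume "f \<in> kernel_H"
        then obtain g where g: "\<forall>i\<in>?I. g i \<in> compact_support_in (W i)" "f = patch ?I W g"
          using dec by blast
        define t where "t = (\<lambda>i\<in>?I. inv_into (carrier derived_F) (h i) (g i))"
        have img: "g i \<in> h i ` carrier derived_F" if "i \<in> ?I" for i
          using g(1) that bij_betw_imp_surj_on[OF h_bij[OF that]] by blast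
        have "t \<in> carrier ?N"
          unfolding N t_def using inv_into_into[OF img] by (intro restrict_PiE_iff[THEN iffD2] ballI)
        moreover have "\<nu> t = f"
          unfolding \<nu>_def g(2)
          by (rule patch_cong) (simp add: t_def f_inv_into_f[OF img] del: lessThan_iff)
        ultimately show "f \<in> \<nu> ` carrier ?N" by blast
      qed
    qed
  qed
qed

lemma card_slots: "card slots = 2 * card (U \<inter> \<D>) + card {x \<in> U. x \<in> \<rat> \<and> x \<notin> \<D>} + 2"
proof -
  have 0: "0 \<notin> U \<inter> \<rat>" "1 \<notin> U \<inter> \<D>" using U01 by auto
  have split: "U \<inter> \<rat> = (U \<inter> \<D>) \<union> {x \<in> U. x \<in> \<rat> \<and> x \<notin> \<D>}" using dyadic_Rats by auto
  have "card (U \<inter> \<rat>) = card (U \<inter> \<D>) + card {x \<in> U. x \<in> \<rat> \<and> x \<notin> \<D>}"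
    unfolding split using finU by (intro card_Un_disjoint) auto
  moreover have "card slots = card (insert 0 (U \<inter> \<rat>) \<times> {True}) + card (insert 1 (U \<inter> \<D>) \<times> {False})"
    unfolding slots_def by (rule card_Un_disjoint) (use finU in auto)
  then have "card slots = card (insert 0 (U \<inter> \<rat>)) + card (insert 1 (U \<inter> \<D>))"
    by (simp only: card_cartesian_product card.insert) simp
  ultimately show ?thesis using 0 finU by simp
qed

lemma fixing_subgroup_eq: "fixing_subgroup U = thompson_F\<lparr>carrier := to_unit ` H\<rparr>"
proof -
  have "{f \<in> carrier thompson_F. \<forall>x\<in>U. f x = x} = to_unit ` H"
    unfolding thompson_F_carrier H_def using U01 by (force simp: subset_iff)
  then show ?thesis unfolding fixing_subgroup_def by (simp only:)
qed

text \<open>The data constructed on the line are carried over to \<open>F\<close> by restriction to the unit interval.\<close>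

theorem fixing_subgroup_structure:
  defines "n \<equiv> card slots"
  shows "is_semidirect_product (fixing_subgroup U)
      (group_power derived_F (card U + 1)) (group_power integer_group n)"
    and "abelian_rank (integral_homology 1 (fixing_subgroup U)) = enat n"
proof -
  have "finite slots" using finU by (simp add: slots_def)
  then obtain \<beta> where \<beta>: "bij_betw \<beta> {..<n} slots"
    using ex_bij_betw_nat_finite[of slots] by (auto simp: n_def atLeast0LessThan)
  have \<beta>_in: "\<beta> i \<in> slots" if "i < n" for i using \<beta> that by (auto simp: bij_betw_def)
  obtain \<sigma> where \<sigma>: "\<And>q. \<sigma> q \<in> H" "\<And>q q'. \<sigma> (\<lambda>s. q s + q' s) = \<sigma> q \<circ> \<sigma> q'"
    "\<And>q s. s \<in> slots \<Longrightarrow> coord s (\<sigma> q) = q s"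
    by (rule sections_exist) (rule that)
  define \<gamma> where "\<gamma> = inv_into {..<n} \<beta>"
  have \<gamma>: "\<gamma> (\<beta> i) = i" if "i < n" for i
    unfolding \<gamma>_def using \<beta> that by (intro inv_into_f_f) (auto simp: bij_betw_def)
  let ?Q = "group_power integer_group n"
  have Q: "carrier ?Q = (\<Pi>\<^sub>E i\<in>{..<n}. UNIV)" "q \<otimes>\<^bsub>?Q\<^esub> q' = (\<lambda>i\<in>{..<n}. q i + q' i)"
      "\<one>\<^bsub>?Q\<^esub> = (\<lambda>i\<in>{..<n}. 0)" for q q'
    by (simp_all add: group_power_def integer_group_def)
  have groupQ: "group ?Q" unfolding group_power_def by (rule product_group) simp
  let ?G = "fixing_subgroup U"
  note toG = to_unit_subgroup[OF H_subgroup H_PLu, folded fixing_subgroup_eq]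
  interpret G: group ?G by (rule toG(1))
  interpret u: group_hom H_group ?G to_unit
    using toG H_group by (simp add: group_hom_def group_hom_axioms_def iso_def)
  have carG: "carrier ?G = to_unit ` H" by (simp add: fixing_subgroup_eq)
  define \<epsilon> where "\<epsilon> = inv_into H to_unit"
  have inj: "inj_on to_unit H" by (rule inj_on_subset[OF to_unit_inj H_PLu])
  have \<epsilon>: "\<epsilon> (to_unit f) = f" if "f \<in> H" for f
    unfolding \<epsilon>_def using inj that by (rule inv_into_f_f)
  define \<kappa> where "\<kappa> i f = coord (\<beta> i) (\<epsilon> f)" for i f
  have \<kappa>_unit: "\<kappa> i (to_unit f) = coord (\<beta> i) f" if "f \<in> H" for i f by (simp only: \<kappa>_def \<epsilon>[OF that])
  have \<kappa>_hom: "\<kappa> i \<in> hom ?G integer_group" if i: "i < n" for i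
  proof (rule homI)
    fix x y assume "x \<in> carrier ?G" "y \<in> carrier ?G"
    then obtain f g where f: "f \<in> H" "x = to_unit f" and g: "g \<in> H" "y = to_unit g"
      unfolding carG by blast
    have fg: "f \<circ> g \<in> H" using subgroup.m_closed[OF H_subgroup f(1) g(1)] by simp
    have "x \<otimes>\<^bsub>?G\<^esub> y = to_unit (f \<circ> g)" using u.hom_mult[of f g] f g by (simp only: f(2) g(2)) simp
    then show "\<kappa> i (x \<otimes>\<^bsub>?G\<^esub> y) = \<kappa> i x \<otimes>\<^bsub>integer_group\<^esub> \<kappa> i y"
      using hom_mult[OF coord_hom[OF \<beta>_in[OF i]], of f g] f(1) g(1)
      by (simp only: f(2) g(2) \<kappa>_unit[OF f(1)] \<kappa>_unit[OF g(1)] \<kappa>_unit[OF fg]) simp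
  qed (simp add: integer_group_def)
  have \<kappa>_ker: "x \<in> to_unit ` kernel_H" if x: "x \<in> carrier ?G" "\<And>i. i < n \<Longrightarrow> \<kappa> i x = 0" for x
  proof -
    obtain f where f: "f \<in> H" "x = to_unit f" using x(1) unfolding carG by blast
    have "coord s f = 0" if s: "s \<in> slots" for s
    proof -
      obtain i where "i < n" "s = \<beta> i" using \<beta> s unfolding bij_betw_def by blast
      then show ?thesis using x(2)[of i] \<kappa>_unit[OF f(1), of i] f(2) by simp
    qed
    then have "f \<in> kernel_H" using f(1) by (simp add: kernel_H_def)
    then show ?thesis using f(2) by blast
  qed
  have \<kappa>_kernel: "\<kappa> i (to_unit f) = 0" if "f \<in> kernel_H" "i < n" for f i
    using that \<kappa>_unit[of f i] \<beta>_in by (simp add: kernel_H_def)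
  \<comment> \<open>Exponents indexed by \<open>{..<n}\<close> are read as exponents indexed by slots; the value 0 elsewhere makes
    the translation additive.\<close>
  define lift where "lift q t = (if t \<in> slots then q (\<gamma> t) else 0)" for q :: "nat \<Rightarrow> int" and t
  have \<gamma>_in: "\<gamma> t < n" if "t \<in> slots" for t
  proof -
    have "t \<in> \<beta> ` {..<n}" using that \<beta> by (simp add: bij_betw_def)
    then show ?thesis unfolding \<gamma>_def using inv_into_into[of t \<beta> "{..<n}"] by simp
  qed
  define s where "s q = to_unit (\<sigma> (lift q))" for q
  have s_in: "s q \<in> carrier ?G" for q unfolding s_def carG using \<sigma>(1) by blast
  have \<kappa>_s: "\<kappa> i (s q) = q i" if "i < n" for i q
    using \<kappa>_unit[OF \<sigma>(1)] \<sigma>(3)[OF \<beta>_in[OF that]] \<gamma>[OF that] \<beta>_in[OF that] by (simp add: s_def lift_def)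
  have s_mult: "s (q \<otimes>\<^bsub>?Q\<^esub> q') = s q \<otimes>\<^bsub>?G\<^esub> s q'" for q q'
  proof -
    have "lift (q \<otimes>\<^bsub>?Q\<^esub> q') = (\<lambda>t. lift q t + lift q' t)"
      by (rule ext) (simp add: Q lift_def \<gamma>_in)
    then have "s (q \<otimes>\<^bsub>?Q\<^esub> q') = to_unit (\<sigma> (lift q) \<circ> \<sigma> (lift q'))"
      by (simp only: s_def \<sigma>(2))
    also have "\<dots> = s q \<otimes>\<^bsub>?G\<^esub> s q'"
      using u.hom_mult[of "\<sigma> (lift q)" "\<sigma> (lift q')"] \<sigma>(1) by (simp add: s_def)
    finally show ?thesis .
  qed
  define \<pi> where "\<pi> f = (\<lambda>i\<in>{..<n}. \<kappa> i f)" for f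
  obtain \<nu> where \<nu>: "\<nu> \<in> hom (group_power derived_F (card U + 1)) H_group"
    "inj_on \<nu> (carrier (group_power derived_F (card U + 1)))"
    "\<nu> ` carrier (group_power derived_F (card U + 1)) = kernel_H"
    by (rule kernel_H_is_power)
  have kerH: "kernel_H \<subseteq> H" by (auto simp: kernel_H_def)
  show "is_semidirect_product ?G (group_power derived_F (card U + 1)) ?Q"
  proof (rule split_extension_is_semidirect_product[where \<pi> = \<pi> and s = s and \<nu> = "to_unit \<circ> \<nu>"])
    show "group (group_power derived_F (card U + 1))"
      unfolding group_power_def by (rule product_group) (rule derived_F_group)
    show "\<pi> \<in> hom ?G ?Q"
    proof (rule homI)
      fix x y assume xy: "x \<in> carrier ?G" "y \<in> carrier ?G"
      have "\<kappa> i (x \<otimes>\<^bsub>?G\<^esub> y) = \<kappa> i x + \<kappa> i y" if "i < n" for i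
        using hom_mult[OF \<kappa>_hom[OF that] xy] by (simp add: integer_group_def)
      then show "\<pi> (x \<otimes>\<^bsub>?G\<^esub> y) = \<pi> x \<otimes>\<^bsub>?Q\<^esub> \<pi> y"
        unfolding Q \<pi>_def by (intro restrict_ext) simp
    qed (simp add: \<pi>_def Q)
    show "s \<in> hom ?Q ?G" using s_in s_mult by (intro homI)
    show "\<pi> (s q) = q" if "q \<in> carrier ?Q" for q
    proof
      fix i
      show "\<pi> (s q) i = q i"
        using that \<kappa>_s[of i q] by (cases "i < n") (auto simp: \<pi>_def Q PiE_def extensional_def)
    qed
    show "to_unit \<circ> \<nu> \<in> hom (group_power derived_F (card U + 1)) ?G"
      using \<nu>(1) u.homh by (rule hom_compose)
    show "inj_on (to_unit \<circ> \<nu>) (carrier (group_power derived_F (card U + 1)))"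
      using \<nu>(2) inj_on_subset[OF inj kerH] unfolding \<nu>(3)[symmetric] by (rule comp_inj_on)
    have "kernel ?G ?Q \<pi> = to_unit ` kernel_H"
    proof
      show "kernel ?G ?Q \<pi> \<subseteq> to_unit ` kernel_H"
      proof
        fix x assume "x \<in> kernel ?G ?Q \<pi>"
        then have x: "x \<in> carrier ?G" "\<pi> x = (\<lambda>i\<in>{..<n}. 0)" by (simp_all add: kernel_def Q)
        have "\<kappa> i x = 0" if "i < n" for i using fun_cong[OF x(2), of i] that by (simp add: \<pi>_def)
        then show "x \<in> to_unit ` kernel_H" using x(1) by (intro \<kappa>_ker)
      qed
      show "to_unit ` kernel_H \<subseteq> kernel ?G ?Q \<pi>"
      proof
        fix x assume "x \<in> to_unit ` kernel_H"
        then obtain f where f: "f \<in> kernel_H" "x = to_unit f" by blast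
        then have "x \<in> carrier ?G" using kerH unfolding carG by blast
        moreover have "\<pi> x = (\<lambda>i\<in>{..<n}. 0)"
          unfolding \<pi>_def f(2) by (intro restrict_ext) (simp only: lessThan_iff \<kappa>_kernel[OF f(1)])
        ultimately show "x \<in> kernel ?G ?Q \<pi>" by (simp add: kernel_def Q)
      qed
    qed
    then show "(to_unit \<circ> \<nu>) ` carrier (group_power derived_F (card U + 1)) = kernel ?G ?Q \<pi>"
      using \<nu>(3) by (simp only: image_comp[symmetric])
  qed (use groupQ G.is_group in auto)
  show "abelian_rank (integral_homology 1 ?G) = enat n"
  proof (rule rank_first_homology[where \<kappa> = \<kappa> and e = "\<lambda>j. s (\<lambda>i. if i = j then 1 else 0)"])
    fix x assume x: "x \<in> carrier ?G" "\<And>i. i < n \<Longrightarrow> \<kappa> i x = 0"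
    have "derived ?G (carrier ?G) = to_unit ` derived H_group H"
      unfolding carG by (rule u.derived_img) simp
    also have "derived H_group H = derived PL2_group H"
      by (rule PL2.derived_consistent[OF order_refl H_subgroup])
    finally show "x \<in> derived ?G (carrier ?G)" using \<kappa>_ker[OF x] kernel_H_in_derived by blast
  qed (use \<kappa>_hom s_in \<kappa>_s G.is_group in auto)
qed

end

theorem theorem3p2:
  fixes U U1 U2 U3 :: "real set" and m1 m2 m3 r :: nat
  assumes "finite U" and "U \<subseteq> {0<..<1}"
    and "U1 = U \<inter> dyadic_rationals"
    and "U2 = {x \<in> U. x \<in> \<rat> \<and> x \<notin> dyadic_rationals}"
    and "U3 = {x \<in> U. x \<notin> \<rat>}"
    and "m1 = card U1" and "m2 = card U2" and "m3 = card U3"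
    and "r = card U"
  shows "r = m1 + m2 + m3 \<and>
    is_semidirect_product (fixing_subgroup U)
      (group_power derived_F (r + 1)) (group_power integer_group (2 * m1 + m2 + 2)) \<and>
    abelian_rank (integral_homology 1 (fixing_subgroup U)) = enat (2 * m1 + m2 + 2)"
proof -
  interpret fixed_points U using assms(1,2) by unfold_locales
  have n: "card slots = 2 * m1 + m2 + 2"
    using card_slots assms(3-8) by simp
  have U: "U = U1 \<union> U2 \<union> U3" "U1 \<inter> U2 = {}" "(U1 \<union> U2) \<inter> U3 = {}"
    using dyadic_Rats assms(3-5) by auto
  have fin: "finite U1" "finite U2" "finite U3" using assms(1,3-5) by auto
  have "card U = card (U1 \<union> U2) + card U3"
    unfolding U(1) using fin U(3) by (intro card_Un_disjoint) auto
  also have "card (U1 \<union> U2) = card U1 + card U2"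
    using fin U(2) by (intro card_Un_disjoint) auto
  finally have "r = m1 + m2 + m3" using assms(6-9) by simp
  then show ?thesis using fixing_subgroup_structure unfolding n assms(9) by blast
qed

end
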